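(* Let the $X_{i,j}$ ($1\leq j\leq m$, $1\leq i\leq n_j$) be i.i.d. with a common distribution satisfying condition $\mathcal{C}_2(\gamma,\rho,A)$ (stated in the context), where $m=m(n)\to\infty$ and the $n_j=n_j(n)$ satisfy $\inf_{1\leq j\leq m}n_j/\log m\to\infty$ as $n\to\infty$. Let $k=\sum_{j=1}^mk_j$ and assume that the weight vector $\boldsymbol{\omega}=\boldsymbol{\omega}(n)\in\mathbb{R}^m$ satisfies $\sum_{j=1}^m\omega_j=1$ as well as $$\limsup_{n\to\infty}k\sum_{j=1}^m\frac{\omega_j^2}{k_j}<\infty\quad\text{and}\quad\exists\delta>0,\ \frac{\sum_{j=1}^mk_j^{-\delta/2}(\omega_j^2/k_j)^{1+\delta/2}}{(\sum_{j=1}^m\omega_j^2/k_j)^{1+\delta/2}}\to0\ \text{as } n\to\infty.$$ If $\sup_{1\leq j\leq m}k_j/n_j\to0$ as $n\to\infty$ and $\sqrt{k}\sup_{1\leq j\leq m}|A(n_j/k_j)|=\operatorname{O}(1)$, then $$\left(\sum_{j=1}^m\frac{\omega_j^2}{k_j}\right)^{-1/2}\left(\widehat{\gamma}_n(\boldsymbol{\omega})-\gamma-\frac1{1-\rho}\sum_{j=1}^m\omega_jk_j^\rho\frac{\Gamma(k_j-\rho+1)}{k_j!}A(n_j/k_j)\right)\stackrel{d}{\longrightarrow}\mathcal{N}(0,\gamma^2),$$ where $\Gamma$ denotes Euler's Gamma function. If also $k\sum_{j=1}^m\omega_j^2/k_j\to v\in[1,\infty)$ as $n\to\infty$, then $$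\sqrt{k}\left(\widehat{\gamma}_n(\boldsymbol{\omega})-\gamma-\frac1{1-\rho}\sum_{j=1}^m\omega_jk_j^\rho\frac{\Gamma(k_j-\rho+1)}{k_j!}A(n_j/k_j)\right)\stackrel{d}{\longrightarrow}\mathcal{N}(0,v\gamma^2).$$
   Context: Here $n=\sum_{j=1}^mn_j$ is the total sample size, and $k_j=k_j(n)\geq1$ are integers (bounded or not). The common distribution function $F$ is continuous, with tail quantile function $U(t)=\inf\{x\in\mathbb{R}:1/(1-F(x))\geq t\}$. Condition $\mathcal{C}_2(\gamma,\rho,A)$: $\gamma>0$, $\rho\leq0$, $A$ has constant sign and converges to $0$ at infinity, and for all $x>0$, $\lim_{t\to\infty}\frac{1}{A(t)}\left[\frac{U(tx)}{U(t)}-x^\gamma\right]=x^\gamma\frac{x^\rho-1}{\rho}$ (read as $x^\gamma\log x$ if $\rho=0$). With $X_{1:n_j,j}\leq\cdots\leq X_{n_j:n_j,j}$ the order statistics of the $j$th subsample, $\widehat{\gamma}_j(k_j)=k_j^{-1}\sum_{i=1}^{k_j}\log(X_{n_j-i+1:n_j,j}/X_{n_j-k_j:n_j,j})$ and $\widehat{\gamma}_n(\boldsymbol{\omega})=\sum_{j=1}^m\omega_j\widehat{\gamma}_j(k_j)$. *)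

theory Defs
  imports "HOL-Probability.Probability"
begin

text \<open>
  The disjunct \<open>F x = 1\<close> encodes \<open>1 / (1 - F x) = \<infinity>\<close>, which the total division on the reals
  would turn into \<open>0\<close>.  The infimum is meaningful for \<open>t > 1\<close>; only large \<open>t\<close> matter below.
\<close>

definition tail_quantile :: "(real \<Rightarrow> real) \<Rightarrow> real \<Rightarrow> real" where
  "tail_quantile F t = Inf {x. F x = 1 \<or> 1 / (1 - F x) \<ge> t}"

text \<open>
  The domain of the auxiliary function \<open>A\<close> is a neighbourhood of infinity, so that its
  constant sign is required there.
\<close>

definition second_order_condition ::
    "(real \<Rightarrow> real) \<Rightarrow> real \<Rightarrow> real \<Rightarrow> (real \<Rightarrow> real) \<Rightarrow> bool" where
  "second_order_condition F \<gamma> \<rho> A \<longleftrightarrow>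
     \<gamma> > 0 \<and> \<rho> \<le> 0 \<and>
     ((\<forall>\<^sub>F t in at_top. A t > 0) \<or> (\<forall>\<^sub>F t in at_top. A t < 0)) \<and>
     (A \<longlongrightarrow> 0) at_top \<and>
     (\<forall>x>0. ((\<lambda>t. 1 / A t * (tail_quantile F (t * x) / tail_quantile F t - x powr \<gamma>))
        \<longlongrightarrow> x powr \<gamma> * (if \<rho> = 0 then ln x else (x powr \<rho> - 1) / \<rho>)) at_top)"

text \<open>
  \<open>order_statistic i n x\<close> is the \<open>i\<close>-th smallest (\<open>1 \<le> i \<le> n\<close>) of \<open>x 1, \<dots>, x n\<close>,
  repetitions counted.
\<close>

definition order_statistic :: "nat \<Rightarrow> nat \<Rightarrow> (nat \<Rightarrow> real) \<Rightarrow> real" where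
  "order_statistic i n x = sort (map x [1..<Suc n]) ! (i - 1)"

text \<open>Meaningful for \<open>1 \<le> k < n\<close>.\<close>

definition hill_estimator :: "nat \<Rightarrow> nat \<Rightarrow> (nat \<Rightarrow> real) \<Rightarrow> real" where
  "hill_estimator k n x =
     1 / real k * (\<Sum>i=1..k. ln (order_statistic (n - i + 1) n x / order_statistic (n - k) n x))"

text \<open>
  \<open>m\<close> subsamples; the \<open>j\<close>-th one is \<open>x 1 j, \<dots>, x (N j) j\<close>, with weight \<open>\<omega> j\<close> and
  effective sample size \<open>K j\<close>.
\<close>

definition weighted_hill_estimator ::
    "nat \<Rightarrow> (nat \<Rightarrow> real) \<Rightarrow> (nat \<Rightarrow> nat) \<Rightarrow> (nat \<Rightarrow> nat) \<Rightarrow> (nat \<Rightarrow> nat \<Rightarrow> real) \<Rightarrow> real" where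
  "weighted_hill_estimator m \<omega> K N x =
     (\<Sum>j=1..m. \<omega> j * hill_estimator (K j) (N j) (\<lambda>i. x i j))"

definition hill_bias ::
    "real \<Rightarrow> (real \<Rightarrow> real) \<Rightarrow> nat \<Rightarrow> (nat \<Rightarrow> real) \<Rightarrow> (nat \<Rightarrow> nat) \<Rightarrow> (nat \<Rightarrow> nat) \<Rightarrow> real" where
  "hill_bias \<rho> A m \<omega> K N =
     1 / (1 - \<rho>) *
     (\<Sum>j=1..m. \<omega> j * real (K j) powr \<rho> * (Gamma (real (K j) - \<rho> + 1) / fact (K j))
        * A (real (N j) / real (K j)))"

text \<open>Parametrised by the variance, whereas \<^const>\<open>normal_density\<close> takes the standard deviation.\<close>

definition normal_distribution :: "real \<Rightarrow> real \<Rightarrow> real measure" where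
  "normal_distribution \<mu> v = density lborel (\<lambda>x. ennreal (normal_density \<mu> (sqrt v) x))"

end

theory Submission
  imports Defs
begin

text \<open>
  By the quantile transform an observation is \<open>Q\<close> of a standard exponential variable, where
  \<open>Q l = U (exp l)\<close>.  Conditionally on the threshold \<open>t\<close> (an order statistic of exponentials) the
  excesses over it are i.i.d. standard exponential, so the Hill statistic of a subsample is the
  mean of \<open>ln (Q (t + e i) / Q t)\<close>.  A uniform version of the second-order condition replaces this by
  \<open>\<gamma>\<close> times the mean of the \<open>e i\<close>, plus \<open>A (n / k) * exp (\<rho> (t - ln (n / k)))\<close> times the mean of
  \<open>limit_shape \<rho> (e i)\<close>, up to an error that is small in mean.  The expectation of the second term
  is the bias, up to a factor tending to \<open>1\<close>, by a Beta integral; its fluctuation is negligible since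
  \<open>A (n / k)\<close> is of the order of the standard deviation.  The first term is a weighted sum of
  centred exponentials that are uniformly negligible by the Lyapunov condition.  All estimates are
  made on the characteristic function of each subsample and summed over the subsamples; the
  probabilities that a threshold is not large are exponentially small in the subsample sizes, hence
  summable because these dominate \<open>ln m\<close>.
\<close>

section \<open>Uniform convergence in the second-order condition\<close>

text \<open>The obstacle is that the \<open>k_j\<close> may stay bounded or grow at different
  speeds. A subsample then need not be nearly normal, its threshold need not concentrate at
  \<open>ln (n / k)\<close>, and the bias keeps a Gamma factor: as \<open>n\<close> grows with
  \<open>k\<close> fixed, the mean of \<open>exp (\<rho> (t - ln (n / k)))\<close> tends to
  \<open>k powr \<rho> * Gamma (k - \<rho> + 1) / fact k\<close>, in general not \<open>1\<close>.
  So the expansion must hold at every large threshold \<open>t\<close>, seen from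
  \<open>s = ln (n / k)\<close>, with errors of bounded mean for all \<open>k\<close>. A factor
  \<open>exp (y / 2)\<close> is affordable because a standard exponential has exponential moments of
  every order below \<open>1\<close>, and \<open>exp (\<bar>t - s\<bar> / 2)\<close> because
  \<open>exp (t - s)\<close> has mean \<open>1\<close> and the negative exponential moments of
  \<open>t - s\<close> are bounded. The fluctuation of \<open>W\<close> is not small in a subsample
  with bounded \<open>k_j\<close>; it is harmless there because \<open>k \<ge> m\<close> forces the
  sum of \<open>\<omega>_j^2 / k_j\<close> to \<open>0\<close>. The Lyapunov condition enters as
  uniform smallness of \<open>\<bar>\<omega>_j\<bar> / k_j\<close> relative to the standard
  deviation.\<close>

definition limit_shape :: "real \<Rightarrow> real \<Rightarrow> real" where
  "limit_shape \<rho> y = (if \<rho> = 0 then y else (exp (\<rho> * y) - 1) / \<rho>)"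

lemma limit_shape_measurable [measurable]: "limit_shape \<rho> \<in> borel_measurable borel"
  unfolding limit_shape_def[abs_def] by measurable

text \<open>\<open>limit_shape \<rho> y\<close> is the integral of \<open>exp (\<rho> * v)\<close>
  over \<open>v\<close> from \<open>0\<close> to \<open>y\<close>, so moving the base point by
  \<open>x\<close> rescales an increment by \<open>exp (\<rho> * x)\<close>. This cocycle rule lets
  increments of \<open>f\<close> be chained.\<close>

lemma limit_shape_add:
  "limit_shape \<rho> (x + y) = limit_shape \<rho> x + exp (\<rho> * x) * limit_shape \<rho> y"
  by (auto simp: limit_shape_def field_simps exp_add)

lemma limit_shape_nonneg:
  assumes "0 \<le> y" shows "0 \<le> limit_shape \<rho> y"
proof (cases "\<rho> < 0")
  case True
  then have "exp (\<rho> * y) \<le> 1" using assms by (auto simp: mult_nonpos_nonneg)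
  then show ?thesis using True by (auto simp: limit_shape_def divide_nonpos_neg)
next
  case False
  then have "1 \<le> exp (\<rho> * y)" using assms by auto
  then show ?thesis using False assms by (auto simp: limit_shape_def)
qed

lemma limit_shape_le:
  assumes "0 \<le> y" "\<rho> \<le> 0" shows "limit_shape \<rho> y \<le> y"
proof (cases "\<rho> = 0")
  case False
  then have "\<rho> < 0" using assms by simp
  moreover have "1 + \<rho> * y \<le> exp (\<rho> * y)" by (rule exp_ge_add_one_self)
  ultimately show ?thesis using False by (auto simp: limit_shape_def field_simps)
qed (simp add: limit_shape_def)

lemma limit_shape_1_pos:
  assumes "\<rho> \<le> 0" shows "0 < limit_shape \<rho> 1"
  using assms by (auto simp: limit_shape_def divide_neg_neg)

text \<open>A Steinhaus-type argument. The set of \<open>y\<close> in \<open>[0, 2]\<close> where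
  \<open>D s y\<close> is large has measure below \<open>1 / 4\<close> for large \<open>s\<close>,
  and likewise at base point \<open>s + u\<close>. Translating the second set by \<open>u\<close>
  keeps its measure, so the two cannot cover \<open>[u, 2]\<close>, whose length is at least
  \<open>1\<close>. As \<open>s0\<close> serves all \<open>u\<close> at once, uniformity in
  \<open>u\<close> results from a merely pointwise limit.\<close>

lemma translated_good_point:
  fixes D :: "real \<Rightarrow> real \<Rightarrow> real"
  assumes meas [measurable]: "\<And>s. D s \<in> borel_measurable borel"
    and lim: "\<And>y. ((\<lambda>s. D s y) \<longlongrightarrow> 0) at_top" and "0 < e"
  obtains s0 where "\<And>s u. s0 \<le> s \<Longrightarrow> 0 \<le> u \<Longrightarrow> u \<le> 1 \<Longrightarrow>
    \<exists>z. u \<le> z \<and> z \<le> 2 \<and> \<bar>D s z\<bar> \<le> e \<and> \<bar>D (s + u) (z - u)\<bar> \<le> e"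
proof -
  define bad where "bad s = {y\<in>{0..2}. e < \<bar>D s y\<bar>}" for s
  have [measurable]: "bad s \<in> sets borel" for s
    unfolding bad_def by measurable
  have sub: "bad s \<subseteq> {0..2}" for s by (auto simp: bad_def)
  have fin: "emeasure lborel (bad s) < \<infinity>" for s
    by (rule emeasure_bounded_finite) (rule bounded_subset[OF bounded_closed_interval sub])
  have "((\<lambda>s. \<integral>y. indicat_real (bad s) y \<partial>lborel) \<longlongrightarrow> integral\<^sup>L lborel (\<lambda>_::real. 0)) at_top"
  proof (rule integral_dominated_convergence_at_top[where w="indicat_real {0..2}" and f="\<lambda>_. 0" and s="\<lambda>s. indicat_real (bad s)" and M=lborel])
    show "\<forall>\<^sub>F i in at_top. AE x in lborel. norm (indicat_real (bad i) x) \<le> indicat_real {0..2} x"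
      by (auto simp: indicator_def bad_def intro!: always_eventually)
    show "AE x in lborel. ((\<lambda>i. indicat_real (bad i) x) \<longlongrightarrow> 0) at_top"
    proof (rule AE_I2)
      fix x
      have "\<forall>\<^sub>F s in at_top. \<bar>D s x\<bar> < e"
        using tendstoD[OF lim \<open>0 < e\<close>, of x] by (simp add: dist_real_def)
      then have "\<forall>\<^sub>F s in at_top. indicat_real (bad s) x = 0"
        by eventually_elim (auto simp: bad_def)
      then show "((\<lambda>i. indicat_real (bad i) x) \<longlongrightarrow> 0) at_top"
        by (rule tendsto_eventually)
    qed
  qed auto
  then have "((\<lambda>s. measure lborel (bad s)) \<longlongrightarrow> 0) at_top"
    by simp
  then have "\<forall>\<^sub>F s in at_top. measure lborel (bad s) < 1/4"
    by (rule order_tendstoD) simp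
  then obtain s0 where s0: "\<And>s. s0 \<le> s \<Longrightarrow> measure lborel (bad s) < 1/4"
    by (auto simp: eventually_at_top_linorder)
  show thesis
  proof (rule that[of s0], rule ccontr)
    fix s u :: real
    assume s: "s0 \<le> s" and u: "0 \<le> u" "u \<le> 1"
    assume no: "\<not> (\<exists>z. u \<le> z \<and> z \<le> 2 \<and> \<bar>D s z\<bar> \<le> e \<and> \<bar>D (s + u) (z - u)\<bar> \<le> e)"
    define B where "B = {z\<in>{u..u+2}. e < \<bar>D (s + u) (z - u)\<bar>}"
    have [measurable]: "B \<in> sets borel" unfolding B_def by measurable
    have "emeasure lborel B = emeasure (distr lborel borel ((+) u)) B"
      by (simp only: lborel_distr_plus)
    also have "\<dots> = emeasure lborel ((+) u -` B)"
      by (subst emeasure_distr) auto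
    also have "(+) u -` B = bad (s + u)"
      by (auto simp: B_def bad_def)
    finally have B: "emeasure lborel B = emeasure lborel (bad (s + u))" .
    have "{u..2} \<subseteq> bad s \<union> B"
    proof
      fix z assume "z \<in> {u..2}"
      then show "z \<in> bad s \<union> B"
        using no[unfolded not_ex, rule_format, of z] u by (auto simp: bad_def B_def)
    qed
    then have "emeasure lborel {u..2} \<le> emeasure lborel (bad s) + emeasure lborel B"
      by (intro order_trans[OF emeasure_mono emeasure_subadditive]) auto
    also have "\<dots> = ennreal (measure lborel (bad s)) + ennreal (measure lborel (bad (s + u)))"
      using fin B by (simp add: emeasure_eq_ennreal_measure less_top)
    also have "\<dots> < ennreal 1"
      using s0[of s] s0[of "s+u"] s u by (simp flip: ennreal_plus add: ennreal_lessI)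
    finally have "ennreal (2 - u) < ennreal 1" using u by simp
    then show False using u by (simp add: ennreal_less_iff)
  qed
qed

section \<open>Extended regular variation in additive form: Potter bounds and uniform limits\<close>

lemma abs_exp_minus_1_le: "\<bar>exp (x::real) - 1\<bar> \<le> \<bar>x\<bar> * exp \<bar>x\<bar>"
proof (cases "0 \<le> x")
  case True
  have "1 - x \<le> exp (- x)" using exp_ge_add_one_self[of "- x"] by simp
  then have "(1 - x) * exp x \<le> 1" by (simp add: exp_minus field_simps)
  then show ?thesis using True by (simp add: algebra_simps)
next
  case False
  have "1 - exp x \<le> - x" using exp_ge_add_one_self[of x] by linarith
  also have "\<dots> \<le> - x * exp (- x)" using False by simp
  finally show ?thesis using False by simp
qed

lemma exp_half_le_2: "exp (1 / 2 :: real) \<le> 2"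
  using exp_bound[of "1 / 2 :: real"] by (simp add: power2_eq_square)

text \<open>To be used with \<open>f s = ln (U (exp s)) - \<gamma> * s\<close> and with
  \<open>A (exp s)\<close> in the place of \<open>A s\<close>: in the logarithmic variable the
  second-order condition is extended regular variation of \<open>f\<close>.\<close>

locale second_order_variation =
  fixes f A :: "real \<Rightarrow> real" and \<rho> :: real
  assumes f_meas [measurable]: "f \<in> borel_measurable borel"
    and rho: "\<rho> \<le> 0"
    and A_sign: "(\<forall>\<^sub>F s in at_top. A s > 0) \<or> (\<forall>\<^sub>F s in at_top. A s < 0)"
    and lim_A: "\<And>y. ((\<lambda>s. (f (s + y) - f s) / A s) \<longlongrightarrow> limit_shape \<rho> y) at_top"
begin

text \<open>\<open>A\<close> need not be measurable, but it is equivalent to the measurable function \<open>b\<close>.\<close>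

definition b :: "real \<Rightarrow> real" where
  "b s = (f (s + 1) - f s) / limit_shape \<rho> 1"

lemma b_measurable [measurable]: "b \<in> borel_measurable borel"
  unfolding b_def[abs_def] by measurable

lemma b_equiv: "((\<lambda>s. b s / A s) \<longlongrightarrow> 1) at_top"
proof -
  have "((\<lambda>s. (f (s + 1) - f s) / A s / limit_shape \<rho> 1) \<longlongrightarrow> limit_shape \<rho> 1 / limit_shape \<rho> 1) at_top"
    using limit_shape_1_pos[OF rho] by (intro tendsto_divide lim_A) auto
  then show ?thesis
    using limit_shape_1_pos[OF rho] by (simp add: b_def field_simps)
qed

lemma A_nonzero: "\<forall>\<^sub>F s in at_top. A s \<noteq> 0"
  using A_sign by (auto elim: eventually_mono)

lemma b_sign: "(\<forall>\<^sub>F s in at_top. b s > 0) \<or> (\<forall>\<^sub>F s in at_top. b s < 0)"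
proof -
  have q: "\<forall>\<^sub>F s in at_top. 0 < b s / A s"
    using b_equiv by (rule order_tendstoD) simp
  from A_sign show ?thesis
  proof
    assume "\<forall>\<^sub>F s in at_top. A s > 0"
    with q have "\<forall>\<^sub>F s in at_top. b s > 0"
      by eventually_elim (auto simp: zero_less_divide_iff)
    then show ?thesis ..
  next
    assume "\<forall>\<^sub>F s in at_top. A s < 0"
    with q have "\<forall>\<^sub>F s in at_top. b s < 0"
      by eventually_elim (auto simp: zero_less_divide_iff)
    then show ?thesis ..
  qed
qed

lemma b_nonzero: "\<forall>\<^sub>F s in at_top. b s \<noteq> 0"
  using b_sign by (auto elim: eventually_mono)

lemma lim_b: "((\<lambda>s. (f (s + y) - f s) / b s) \<longlongrightarrow> limit_shape \<rho> y) at_top"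
proof -
  have "((\<lambda>s. ((f (s + y) - f s) / A s) / (b s / A s)) \<longlongrightarrow> limit_shape \<rho> y / 1) at_top"
    by (intro tendsto_divide lim_A b_equiv) auto
  moreover have "\<forall>\<^sub>F s in at_top. ((f (s + y) - f s) / A s) / (b s / A s) = (f (s + y) - f s) / b s"
    using A_nonzero by eventually_elim auto
  ultimately show ?thesis
    by (simp add: Lim_transform_eventually)
qed

text \<open>Subtracting the limits at \<open>y + 1\<close> and \<open>y\<close> leaves the unit
  increment of \<open>f\<close> starting at \<open>s + y\<close>, which is \<open>b (s + y)\<close>
  up to a constant; the cocycle rule evaluates the limit. Thus \<open>b\<close> is regularly varying
  with index \<open>\<rho>\<close> as a function of \<open>exp s\<close>.\<close>

lemma b_ratio: "((\<lambda>s. b (s + y) / b s) \<longlongrightarrow> exp (\<rho> * y)) at_top"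
proof -
  have "((\<lambda>s. ((f (s + (y + 1)) - f s) / b s - (f (s + y) - f s) / b s) / limit_shape \<rho> 1)
      \<longlongrightarrow> (limit_shape \<rho> (y + 1) - limit_shape \<rho> y) / limit_shape \<rho> 1) at_top"
    using limit_shape_1_pos[OF rho] by (intro tendsto_divide tendsto_diff lim_b tendsto_const) auto
  moreover have "((f (s + (y + 1)) - f s) / b s - (f (s + y) - f s) / b s) / limit_shape \<rho> 1
     = b (s + y) / b s" for s
    by (simp add: b_def[of "s + y"] add.assoc flip: diff_divide_distrib)
  ultimately show ?thesis
    using limit_shape_1_pos[OF rho] by (simp add: limit_shape_add)
qed

text \<open>Logarithm of the slowly varying part of \<open>b\<close>: eventually
  \<open>\<bar>b s\<bar> = exp (\<rho> * s + g s)\<close>.\<close>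

definition g :: "real \<Rightarrow> real" where
  "g s = ln \<bar>b s\<bar> - \<rho> * s"

lemma g_measurable [measurable]: "g \<in> borel_measurable borel"
  unfolding g_def[abs_def] by measurable

lemma g_lim: "((\<lambda>s. g (s + y) - g s) \<longlongrightarrow> 0) at_top"
proof -
  have "((\<lambda>s. ln \<bar>b (s + y) / b s\<bar> - \<rho> * y) \<longlongrightarrow> ln \<bar>exp (\<rho> * y)\<bar> - \<rho> * y) at_top"
    by (intro tendsto_diff tendsto_ln tendsto_rabs b_ratio tendsto_const) auto
  moreover have "\<forall>\<^sub>F s in at_top. ln \<bar>b (s + y) / b s\<bar> - \<rho> * y = g (s + y) - g s"
  proof -
    have "filterlim (\<lambda>s. s + y) at_top at_top"
      using filterlim_tendsto_add_at_top[OF tendsto_const[of y] filterlim_ident]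
      by (simp add: add.commute)
    then have "\<forall>\<^sub>F s in at_top. b (s + y) \<noteq> 0"
      by (rule eventually_compose_filterlim[OF b_nonzero])
    with b_nonzero show ?thesis
      by eventually_elim (simp add: g_def ln_div abs_divide algebra_simps)
  qed
  ultimately have "((\<lambda>s. g (s + y) - g s) \<longlongrightarrow> ln \<bar>exp (\<rho> * y)\<bar> - \<rho> * y) at_top"
    by (rule Lim_transform_eventually)
  then show ?thesis by simp
qed

text \<open>The uniform convergence theorem for slowly varying functions: at a common good point
  \<open>z\<close> both \<open>g (s + z) - g s\<close> and \<open>g (s + z) - g (s + u)\<close> are
  small, and their difference is the increment over \<open>u\<close>.\<close>

lemma g_uniform:
  assumes "0 < e"
  obtains s0 where "\<And>s u. s0 \<le> s \<Longrightarrow> 0 \<le> u \<Longrightarrow> u \<le> 1 \<Longrightarrow> \<bar>g (s + u) - g s\<bar> \<le> e"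
proof -
  obtain s0 where s0: "\<And>s u. s0 \<le> s \<Longrightarrow> 0 \<le> u \<Longrightarrow> u \<le> 1 \<Longrightarrow>
    \<exists>z. u \<le> z \<and> z \<le> 2 \<and> \<bar>g (s + z) - g s\<bar> \<le> e / 2 \<and> \<bar>g (s + u + (z - u)) - g (s + u)\<bar> \<le> e / 2"
    using translated_good_point[of "\<lambda>s y. g (s + y) - g s" "e / 2"] assms g_lim by auto
  show thesis
  proof (rule that[of s0])
    fix s u :: real assume "s0 \<le> s" "0 \<le> u" "u \<le> 1"
    then obtain z where "\<bar>g (s + z) - g s\<bar> \<le> e / 2" "\<bar>g (s + z) - g (s + u)\<bar> \<le> e / 2"
      using s0[of s u] by auto
    then show "\<bar>g (s + u) - g s\<bar> \<le> e" by linarith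
  qed
qed

text \<open>Potter's bound. A long distance is cut into its fractional part and unit steps, each
  costing at most \<open>e\<close>; the \<open>+ 1\<close> pays for the fractional part.\<close>

lemma g_potter:
  assumes "0 < e"
  obtains s0 where "\<And>s t. s0 \<le> s \<Longrightarrow> s0 \<le> t \<Longrightarrow> \<bar>g t - g s\<bar> \<le> e * (\<bar>t - s\<bar> + 1)"
proof -
  obtain s0 where s0: "\<And>s u. s0 \<le> s \<Longrightarrow> 0 \<le> u \<Longrightarrow> u \<le> 1 \<Longrightarrow> \<bar>g (s + u) - g s\<bar> \<le> e"
    using g_uniform[OF assms] by blast
  have *: "\<bar>g (s + u + real n) - g s\<bar> \<le> e * (real n + 1)"
    if "s0 \<le> s" "0 \<le> u" "u \<le> 1" for s u n
  proof (induction n)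
    case 0
    then show ?case using s0[OF that] by simp
  next
    case (Suc n)
    have "\<bar>g (s + u + real n + 1) - g (s + u + real n)\<bar> \<le> e"
      using that by (intro s0) auto
    with Suc show ?case by (simp add: algebra_simps)
  qed
  have **: "\<bar>g t - g s\<bar> \<le> e * (\<bar>t - s\<bar> + 1)" if "s0 \<le> s" "s \<le> t" for s t
  proof -
    define n where "n = nat \<lfloor>t - s\<rfloor>"
    define u where "u = t - s - real n"
    have n: "real n = of_int \<lfloor>t - s\<rfloor>" using that by (simp add: n_def)
    have "0 \<le> u" "u \<le> 1" unfolding u_def n by linarith+
    then have "\<bar>g (s + u + real n) - g s\<bar> \<le> e * (real n + 1)"
      using that by (intro *) auto
    also have "\<dots> \<le> e * (\<bar>t - s\<bar> + 1)"
      using assms that unfolding n by (intro mult_left_mono) linarith+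
    finally show ?thesis by (simp add: u_def)
  qed
  show thesis
  proof (rule that[of s0])
    fix s t assume "s0 \<le> s" "s0 \<le> t"
    then show "\<bar>g t - g s\<bar> \<le> e * (\<bar>t - s\<bar> + 1)"
      using **[of s t] **[of t s] by (cases "s \<le> t") (auto simp: abs_minus_commute)
  qed
qed

lemma b_potter:
  assumes "0 < e"
  obtains s0 where "\<And>s t. s0 \<le> s \<Longrightarrow> s0 \<le> t \<Longrightarrow>
    \<bar>b t - b s * exp (\<rho> * (t - s))\<bar> \<le> e * \<bar>b s\<bar> * exp (\<rho> * (t - s)) * exp (\<bar>t - s\<bar> / 2)"
proof -
  \<comment> \<open>\<open>8 = 4 * 2\<close> comes from \<open>x + 1 \<le> 4 * exp (x / 4)\<close>
    and \<open>exp (1 / 4) \<le> 2\<close>. The cap \<open>1 / 4\<close> limits the growth of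
    \<open>exp \<bar>\<delta>\<bar>\<close> to \<open>exp (x / 4)\<close>, so that both together
    stay within \<open>exp (x / 2)\<close>.\<close>
  define d where "d = min (e / 8) (1 / 4)"
  have d: "0 < d" "8 * d \<le> e" "d \<le> 1 / 4" using assms by (auto simp: d_def)
  obtain s1 where s1: "\<And>s t. s1 \<le> s \<Longrightarrow> s1 \<le> t \<Longrightarrow> \<bar>g t - g s\<bar> \<le> d * (\<bar>t - s\<bar> + 1)"
    using g_potter[OF d(1)] by blast
  have "\<exists>s2. \<forall>s\<ge>s2. \<forall>t\<ge>s2. 0 < b s * b t"
    using b_sign unfolding eventually_at_top_linorder by (metis mult_pos_pos mult_neg_neg)
  then obtain s2 where s2: "\<And>s t. s2 \<le> s \<Longrightarrow> s2 \<le> t \<Longrightarrow> 0 < b s * b t"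
    by blast
  show thesis
  proof (rule that[of "max s1 s2"])
    fix s t assume st: "max s1 s2 \<le> s" "max s1 s2 \<le> t"
    define x where "x = \<bar>t - s\<bar>"
    define \<delta> where "\<delta> = g t - g s"
    have \<delta>: "\<bar>\<delta>\<bar> \<le> d * (x + 1)" using s1[of s t] st by (simp add: \<delta>_def x_def)
    have pos: "0 < b s * b t" using s2[of s t] st by simp
    then have nz: "b s \<noteq> 0" "b t \<noteq> 0" by auto
    have "exp \<delta> = \<bar>b t\<bar> / \<bar>b s\<bar> * exp (- \<rho> * (t - s))"
      using nz by (simp add: \<delta>_def g_def exp_diff exp_add exp_minus algebra_simps divide_simps)
    also have "\<bar>b t\<bar> / \<bar>b s\<bar> = b t / b s"
      using pos by (auto simp: zero_less_mult_iff)
    finally have bt: "b t = b s * exp (\<rho> * (t - s)) * exp \<delta>"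
      using nz by (simp add: exp_minus divide_simps mult_ac)
    have "\<bar>b t - b s * exp (\<rho> * (t - s))\<bar> = \<bar>b s * exp (\<rho> * (t - s))\<bar> * \<bar>exp \<delta> - 1\<bar>"
      unfolding bt abs_mult[symmetric] by (simp add: algebra_simps)
    also have "\<dots> = \<bar>b s\<bar> * exp (\<rho> * (t - s)) * \<bar>exp \<delta> - 1\<bar>"
      by (simp add: abs_mult)
    also have "\<dots> \<le> \<bar>b s\<bar> * exp (\<rho> * (t - s)) * (e * exp (x / 2))"
    proof (rule mult_left_mono)
      have x: "0 \<le> x" by (simp add: x_def)
      have e1: "exp (1/4::real) \<le> 2" by (rule order_trans[OF _ exp_half_le_2]) simp
      have "1 + x / 4 \<le> exp (x / 4)" by (rule exp_ge_add_one_self)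
      then have x4: "x + 1 \<le> 4 * exp (x / 4)" by linarith
      have "\<bar>exp \<delta> - 1\<bar> \<le> \<bar>\<delta>\<bar> * exp \<bar>\<delta>\<bar>" by (rule abs_exp_minus_1_le)
      also have "\<dots> \<le> (d * (x + 1)) * exp (1/4 * (x + 1))"
      proof (intro mult_mono)
        have "d * (x + 1) \<le> 1/4 * (x + 1)" using d x by (intro mult_right_mono) auto
        then show "exp \<bar>\<delta>\<bar> \<le> exp (1/4 * (x + 1))" using \<delta> by simp
      qed (use \<delta> d x in auto)
      also have "\<dots> \<le> (d * (4 * exp (x / 4))) * (exp (x / 4) * 2)"
      proof (intro mult_mono)
        have "exp (1/4 * (x + 1)) = exp (x / 4) * exp (1/4::real)"
          by (simp add: exp_add[symmetric] algebra_simps)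
        then show "exp (1/4 * (x + 1)) \<le> exp (x / 4) * 2"
          using e1 by simp
      qed (use x4 d x in auto)
      also have "\<dots> = 8 * d * (exp (x / 4) * exp (x / 4))" by simp
      also have "exp (x / 4) * exp (x / 4) = exp (x / 2)" by (simp add: exp_add[symmetric])
      also have "8 * d * exp (x / 2) \<le> e * exp (x / 2)"
        using d by (intro mult_right_mono) auto
      finally show "\<bar>exp \<delta> - 1\<bar> \<le> e * exp (x / 2)" .
    qed auto
    finally show "\<bar>b t - b s * exp (\<rho> * (t - s))\<bar> \<le> e * \<bar>b s\<bar> * exp (\<rho> * (t - s)) * exp (\<bar>t - s\<bar> / 2)"
      by (simp add: x_def mult_ac)
  qed
qed

text \<open>Going from \<open>s\<close> to \<open>s + z\<close> directly or through
  \<open>s + u\<close> gives the same increment of \<open>f\<close>. If \<open>z\<close> is good for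
  both base points, the two increments ending at \<open>s + z\<close> are controlled, and the error
  over \<open>u\<close> is \<open>P - R - S * limit_shape \<rho> (z - u)\<close>, where
  \<open>S\<close> compares \<open>b (s + u)\<close> with its predicted value. The three parts cost
  \<open>d\<close>, \<open>2 * d\<close> and \<open>2 * d\<close> times
  \<open>\<bar>b s\<bar>\<close>, within the reserved \<open>8 * d\<close>.\<close>

lemma f_uniform:
  assumes "0 < e"
  obtains s0 where "\<And>s u. s0 \<le> s \<Longrightarrow> 0 \<le> u \<Longrightarrow> u \<le> 1 \<Longrightarrow>
    \<bar>f (s + u) - f s - b s * limit_shape \<rho> u\<bar> \<le> e * \<bar>b s\<bar>"
proof -
  define d where "d = min (e / 8) 1"
  have d: "0 < d" "8 * d \<le> e" "d \<le> 1" using assms by (auto simp: d_def)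
  obtain s1 where s1: "\<And>s u. s1 \<le> s \<Longrightarrow> 0 \<le> u \<Longrightarrow> u \<le> 1 \<Longrightarrow>
    \<exists>z. u \<le> z \<and> z \<le> 2 \<and> \<bar>(f (s + z) - f s) / b s - limit_shape \<rho> z\<bar> \<le> d
      \<and> \<bar>(f (s + u + (z - u)) - f (s + u)) / b (s + u) - limit_shape \<rho> (z - u)\<bar> \<le> d"
  proof (rule translated_good_point[of "\<lambda>s y. (f (s + y) - f s) / b s - limit_shape \<rho> y" d])
    show "((\<lambda>s. (f (s + y) - f s) / b s - limit_shape \<rho> y) \<longlongrightarrow> 0) at_top" for y
      using tendsto_diff[OF lim_b[of y] tendsto_const[of "limit_shape \<rho> y"]] by simp
  qed (use d in auto)
  have "0 < d / 2" using d by simp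
  then obtain s2 where s2: "\<And>s t. s2 \<le> s \<Longrightarrow> s2 \<le> t \<Longrightarrow>
    \<bar>b t - b s * exp (\<rho> * (t - s))\<bar> \<le> d / 2 * \<bar>b s\<bar> * exp (\<rho> * (t - s)) * exp (\<bar>t - s\<bar> / 2)"
    using b_potter by blast
  obtain s3 where s3: "\<And>s. s3 \<le> s \<Longrightarrow> b s \<noteq> 0"
    using b_nonzero by (auto simp: eventually_at_top_linorder)
  show thesis
  proof (rule that[of "Max {s1, s2, s3}"])
    fix s u :: real assume s: "Max {s1, s2, s3} \<le> s" and u: "0 \<le> u" "u \<le> 1"
    then have s': "s1 \<le> s" "s2 \<le> s" "s3 \<le> s" by auto
    have nz: "b s \<noteq> 0" "b (s + u) \<noteq> 0" using s' u by (auto intro!: s3)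
    obtain z where z: "u \<le> z" "z \<le> 2" "\<bar>(f (s + z) - f s) / b s - limit_shape \<rho> z\<bar> \<le> d"
      "\<bar>(f (s + z) - f (s + u)) / b (s + u) - limit_shape \<rho> (z - u)\<bar> \<le> d"
      using s1[OF s'(1) u] by auto
    define P where "P = f (s + z) - f s - b s * limit_shape \<rho> z"
    define R where "R = f (s + z) - f (s + u) - b (s + u) * limit_shape \<rho> (z - u)"
    define S where "S = b (s + u) - b s * exp (\<rho> * u)"
    have "P = b s * ((f (s + z) - f s) / b s - limit_shape \<rho> z)"
      using nz by (simp add: P_def field_simps)
    then have P: "\<bar>P\<bar> \<le> \<bar>b s\<bar> * d"
      using z(3) by (simp add: abs_mult mult_left_mono)
    have "R = b (s + u) * ((f (s + z) - f (s + u)) / b (s + u) - limit_shape \<rho> (z - u))"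
      using nz by (simp add: R_def field_simps)
    then have R: "\<bar>R\<bar> \<le> \<bar>b (s + u)\<bar> * d"
      using z(4) by (simp add: abs_mult mult_left_mono)
    have er: "exp (\<rho> * u) \<le> 1" using rho u by (simp add: mult_nonpos_nonneg)
    have "exp (u / 2) \<le> exp (1 / 2)" using u by simp
    also have "\<dots> \<le> (2::real)" by (rule exp_half_le_2)
    finally have eu: "exp (u / 2) \<le> 2" .
    have "\<bar>S\<bar> \<le> d / 2 * \<bar>b s\<bar> * exp (\<rho> * u) * exp (u / 2)"
      using s2[of s "s + u"] s' u by (simp add: S_def)
    also have "\<dots> \<le> d / 2 * \<bar>b s\<bar> * 1 * 2"
      using er eu d by (intro mult_mono mult_left_mono) auto
    finally have S: "\<bar>S\<bar> \<le> \<bar>b s\<bar> * d" by (simp add: mult_ac)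
    have "\<bar>b (s + u)\<bar> \<le> \<bar>S\<bar> + \<bar>b s * exp (\<rho> * u)\<bar>" unfolding S_def by linarith
    also have "\<bar>b s * exp (\<rho> * u)\<bar> \<le> \<bar>b s\<bar>"
      using er by (simp add: abs_mult mult_left_le)
    also have "\<bar>S\<bar> \<le> \<bar>b s\<bar>"
      using S mult_left_mono[OF d(3), of "\<bar>b s\<bar>"] by simp
    finally have bu: "\<bar>b (s + u)\<bar> \<le> 2 * \<bar>b s\<bar>" by simp
    have hz: "\<bar>limit_shape \<rho> (z - u)\<bar> \<le> 2"
      using limit_shape_nonneg[of "z - u" \<rho>] limit_shape_le[of "z - u" \<rho>] z u rho by auto
    have "limit_shape \<rho> z = limit_shape \<rho> u + exp (\<rho> * u) * limit_shape \<rho> (z - u)"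
      using limit_shape_add[of \<rho> u "z - u"] by simp
    then have "f (s + u) - f s - b s * limit_shape \<rho> u = P - R - S * limit_shape \<rho> (z - u)"
      by (simp add: P_def R_def S_def algebra_simps)
    also have "\<bar>\<dots>\<bar> \<le> \<bar>P\<bar> + \<bar>R\<bar> + \<bar>S\<bar> * \<bar>limit_shape \<rho> (z - u)\<bar>"
      unfolding abs_mult[symmetric] by linarith
    also have "\<dots> \<le> \<bar>b s\<bar> * d + 2 * \<bar>b s\<bar> * d + \<bar>b s\<bar> * d * 2"
      using P order_trans[OF R mult_right_mono[OF bu, of d]] mult_mono[OF S hz] d
      by (intro add_mono) auto
    also have "\<dots> = 5 * d * \<bar>b s\<bar>" by simp
    also have "\<dots> \<le> e * \<bar>b s\<bar>" using d by (intro mult_right_mono) auto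
    finally show "\<bar>f (s + u) - f s - b s * limit_shape \<rho> u\<bar> \<le> e * \<bar>b s\<bar>" .
  qed
qed

text \<open>Unit steps are peeled off at the front, so the base point moves to \<open>s + 1\<close>
  and \<open>\<bar>b\<bar>\<close> grows at most by the factor \<open>1 + e \<le> 5 / 4\<close>. The
  constant \<open>8\<close> closes the induction: in units of
  \<open>e * \<bar>b s\<bar> * exp (y / 2)\<close> the carried error is at most
  \<open>8 * 5 / 4 = 10\<close>, the new one at most \<open>2\<close>, and
  \<open>12 = 8 * 3 / 2 \<le> 8 * exp (1 / 2)\<close>.\<close>

lemma f_uniform_exp:
  assumes "0 < e" "e \<le> 1 / 4"
  obtains s0 where "\<And>s y. s0 \<le> s \<Longrightarrow> 0 \<le> y \<Longrightarrow>
    \<bar>f (s + y) - f s - b s * limit_shape \<rho> y\<bar> \<le> 8 * e * \<bar>b s\<bar> * exp (y / 2)"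
proof -
  obtain s1 where s1: "\<And>s u. s1 \<le> s \<Longrightarrow> 0 \<le> u \<Longrightarrow> u \<le> 1 \<Longrightarrow>
      \<bar>f (s + u) - f s - b s * limit_shape \<rho> u\<bar> \<le> e * \<bar>b s\<bar>"
    using f_uniform[OF assms(1)] by blast
  have "0 < e / 2" using assms by simp
  then obtain s2 where s2: "\<And>s t. s2 \<le> s \<Longrightarrow> s2 \<le> t \<Longrightarrow>
    \<bar>b t - b s * exp (\<rho> * (t - s))\<bar> \<le> e / 2 * \<bar>b s\<bar> * exp (\<rho> * (t - s)) * exp (\<bar>t - s\<bar> / 2)"
    using b_potter by blast
  define s0 where "s0 = max s1 s2"
  have er: "exp \<rho> \<le> 1" using rho by simp
  have eh: "3 / 2 \<le> exp (1 / 2 :: real)" "exp (1 / 2 :: real) \<le> 2"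
    using exp_ge_add_one_self[of "1/2::real"] exp_half_le_2 by simp_all
  have bs: "\<bar>b (s + 1) - b s * exp \<rho>\<bar> \<le> e * \<bar>b s\<bar>" if "s0 \<le> s" for s
  proof -
    have "\<bar>b (s + 1) - b s * exp \<rho>\<bar> \<le> e / 2 * \<bar>b s\<bar> * exp \<rho> * exp (1 / 2)"
      using s2[of s "s + 1"] that by (simp add: s0_def)
    also have "\<dots> \<le> e / 2 * \<bar>b s\<bar> * 1 * 2"
      using er eh assms by (intro mult_mono mult_left_mono) auto
    finally show ?thesis by simp
  qed
  have bs1: "\<bar>b (s + 1)\<bar> \<le> (1 + e) * \<bar>b s\<bar>" if "s0 \<le> s" for s
  proof -
    have "\<bar>b (s + 1)\<bar> \<le> \<bar>b (s + 1) - b s * exp \<rho>\<bar> + \<bar>b s * exp \<rho>\<bar>" by linarith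
    also have "\<bar>b s * exp \<rho>\<bar> \<le> \<bar>b s\<bar>" using er by (simp add: abs_mult mult_left_le)
    finally show ?thesis using bs[OF that] by (simp add: algebra_simps)
  qed
  have *: "\<bar>f (s + (u + real n)) - f s - b s * limit_shape \<rho> (u + real n)\<bar> \<le> 8 * e * \<bar>b s\<bar> * exp ((u + real n) / 2)"
    if "s0 \<le> s" "0 \<le> u" "u \<le> 1" for s u n
    using that(1)
  proof (induction n arbitrary: s)
    case 0
    have "\<bar>f (s + u) - f s - b s * limit_shape \<rho> u\<bar> \<le> e * \<bar>b s\<bar>"
      using that 0 by (intro s1) (auto simp: s0_def)
    also have "\<dots> \<le> 8 * e * \<bar>b s\<bar> * 1" using assms by simp
    also have "\<dots> \<le> 8 * e * \<bar>b s\<bar> * exp (u / 2)"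
      using assms that by (intro mult_left_mono) auto
    finally show ?case by simp
  next
    case (Suc n)
    define y where "y = u + real n"
    have y: "0 \<le> y" using that by (simp add: y_def)
    have IH: "\<bar>f (s + 1 + y) - f (s + 1) - b (s + 1) * limit_shape \<rho> y\<bar> \<le> 8 * e * \<bar>b (s + 1)\<bar> * exp (y / 2)"
      using Suc.IH[of "s + 1"] Suc.prems by (simp add: y_def)
    have one: "\<bar>f (s + 1) - f s - b s * limit_shape \<rho> 1\<bar> \<le> e * \<bar>b s\<bar>"
      using Suc.prems by (intro s1) (auto simp: s0_def)
    have hy: "\<bar>limit_shape \<rho> y\<bar> \<le> y"
      using limit_shape_nonneg[OF y, of \<rho>] limit_shape_le[OF y rho] by simp
    have y2: "1 + y \<le> 2 * exp (y / 2)"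
      using exp_ge_add_one_self[of "y / 2"] by linarith
    have "f (s + (1 + y)) - f s - b s * limit_shape \<rho> (1 + y)
       = (f (s + 1) - f s - b s * limit_shape \<rho> 1) + (f (s + 1 + y) - f (s + 1) - b (s + 1) * limit_shape \<rho> y)
         + (b (s + 1) - b s * exp \<rho>) * limit_shape \<rho> y"
      by (simp add: limit_shape_add algebra_simps)
    also have "\<bar>\<dots>\<bar> \<le> e * \<bar>b s\<bar> + 8 * e * \<bar>b (s + 1)\<bar> * exp (y / 2) + e * \<bar>b s\<bar> * y"
    proof -
      have "\<bar>(b (s + 1) - b s * exp \<rho>) * limit_shape \<rho> y\<bar> \<le> e * \<bar>b s\<bar> * y"
        unfolding abs_mult using bs[OF Suc.prems] hy y assms by (intro mult_mono) auto
      then show ?thesis using IH one by linarith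
    qed
    also have "\<dots> \<le> e * \<bar>b s\<bar> + 8 * e * ((1 + 1/4) * \<bar>b s\<bar>) * exp (y / 2) + e * \<bar>b s\<bar> * y"
    proof -
      have "\<bar>b (s + 1)\<bar> \<le> (1 + 1/4) * \<bar>b s\<bar>"
        using bs1[OF Suc.prems] mult_right_mono[of "1 + e" "1 + 1/4" "\<bar>b s\<bar>"] assms by linarith
      then show ?thesis using assms y by (intro add_mono mult_mono) auto
    qed
    also have "\<dots> = e * \<bar>b s\<bar> * (1 + y) + e * \<bar>b s\<bar> * (10 * exp (y / 2))" by (simp add: algebra_simps)
    also have "\<dots> \<le> e * \<bar>b s\<bar> * (2 * exp (y / 2)) + e * \<bar>b s\<bar> * (10 * exp (y / 2))"
      using y2 assms by (intro add_mono mult_left_mono) auto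
    also have "\<dots> = 8 * e * \<bar>b s\<bar> * (exp (y / 2) * (3 / 2))" by (simp add: algebra_simps)
    also have "\<dots> \<le> 8 * e * \<bar>b s\<bar> * (exp (y / 2) * exp (1 / 2))"
      using eh assms by (intro mult_left_mono) auto
    also have "exp (y / 2) * exp (1 / 2) = exp ((1 + y) / 2)"
      by (simp add: exp_add[symmetric] add_divide_distrib)
    finally show ?case by (simp add: y_def add_ac)
  qed
  show thesis
  proof (rule that[of s0])
    fix s y :: real assume "s0 \<le> s" and y: "0 \<le> y"
    define n where "n = nat \<lfloor>y\<rfloor>"
    have n: "real n = of_int \<lfloor>y\<rfloor>" using y by (simp add: n_def)
    have "0 \<le> y - real n" "y - real n \<le> 1" unfolding n by linarith+
    from *[OF \<open>s0 \<le> s\<close> this, of n]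
    show "\<bar>f (s + y) - f s - b s * limit_shape \<rho> y\<bar> \<le> 8 * e * \<bar>b s\<bar> * exp (y / 2)" by simp
  qed
qed

text \<open>Two base points are needed: the bias is written at the deterministic
  \<open>s = ln (n / k)\<close>, whereas the excesses start at the random threshold
  \<open>t\<close>. The expansion is made at \<open>t\<close>, and \<open>b t\<close> is then
  compared with \<open>A s * exp (\<rho> * (t - s))\<close> through the Potter bound for
  \<open>b\<close> and the equivalence of \<open>b\<close> and \<open>A\<close>.\<close>

theorem uniform_second_order:
  assumes "0 < e"
  obtains s0 where "\<And>s t y. s0 \<le> s \<Longrightarrow> s0 \<le> t \<Longrightarrow> 0 \<le> y \<Longrightarrow>
    \<bar>f (t + y) - f t - A s * exp (\<rho> * (t - s)) * limit_shape \<rho> y\<bar>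
      \<le> e * \<bar>A s\<bar> * exp (\<rho> * (t - s)) * exp (\<bar>t - s\<bar> / 2) * exp (y / 2)"
proof -
  define d where "d = min (e / 40) (1 / 4)"
  have d: "0 < d" "40 * d \<le> e" "d \<le> 1 / 4" using assms by (auto simp: d_def)
  obtain s1 where s1: "\<And>s y. s1 \<le> s \<Longrightarrow> 0 \<le> y \<Longrightarrow>
    \<bar>f (s + y) - f s - b s * limit_shape \<rho> y\<bar> \<le> 8 * d * \<bar>b s\<bar> * exp (y / 2)"
    using f_uniform_exp[OF d(1) d(3)] by blast
  obtain s2 where s2: "\<And>s t. s2 \<le> s \<Longrightarrow> s2 \<le> t \<Longrightarrow>
    \<bar>b t - b s * exp (\<rho> * (t - s))\<bar> \<le> d * \<bar>b s\<bar> * exp (\<rho> * (t - s)) * exp (\<bar>t - s\<bar> / 2)"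
    using b_potter[OF d(1)] by blast
  have "\<forall>\<^sub>F s in at_top. \<bar>b s - A s\<bar> \<le> d * \<bar>A s\<bar>"
    using tendstoD[OF b_equiv d(1)] A_nonzero
  proof eventually_elim
    case (elim s)
    then have "\<bar>A s\<bar> * \<bar>b s / A s - 1\<bar> \<le> \<bar>A s\<bar> * d"
      by (intro mult_left_mono) (auto simp: dist_real_def)
    then show ?case using elim(2) by (simp add: abs_mult[symmetric] algebra_simps)
  qed
  then obtain s3 where s3: "\<And>s. s3 \<le> s \<Longrightarrow> \<bar>b s - A s\<bar> \<le> d * \<bar>A s\<bar>"
    by (auto simp: eventually_at_top_linorder)
  show thesis
  proof (rule that[of "Max {s1, s2, s3}"])
    fix s t y :: real assume "Max {s1, s2, s3} \<le> s" "Max {s1, s2, s3} \<le> t" and y: "0 \<le> y"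
    then have s: "s2 \<le> s" "s3 \<le> s" and t: "s1 \<le> t" "s2 \<le> t" by auto
    define E where "E = exp (\<rho> * (t - s))"
    define X where "X = exp (\<bar>t - s\<bar> / 2)"
    define a where "a = \<bar>A s\<bar>"
    have pos: "0 \<le> E" "1 \<le> X" "0 \<le> a" by (auto simp: E_def X_def a_def)
    have bA: "\<bar>b s - A s\<bar> \<le> d * a" using s3[OF s(2)] by (simp add: a_def)
    also have da: "d * a \<le> 1 * a" using d pos by (intro mult_right_mono) auto
    finally have b2: "\<bar>b s\<bar> \<le> 2 * a" by (simp add: a_def)
    have "\<bar>b t - A s * E\<bar> \<le> \<bar>b t - b s * E\<bar> + \<bar>b s - A s\<bar> * E"
    proof -
      have "\<bar>b s - A s\<bar> * E = \<bar>b s * E - A s * E\<bar>"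
        using pos by (simp add: abs_mult[symmetric] left_diff_distrib[symmetric] abs_mult)
      then show ?thesis by linarith
    qed
    also have "\<dots> \<le> d * (2 * a) * E * X + d * a * E * X"
    proof (rule add_mono)
      have "\<bar>b t - b s * E\<bar> \<le> d * \<bar>b s\<bar> * E * X"
        using s2[OF s(1) t(2)] by (simp add: E_def X_def)
      also have "\<dots> \<le> d * (2 * a) * E * X"
        using b2 d pos by (intro mult_right_mono mult_left_mono) auto
      finally show "\<bar>b t - b s * E\<bar> \<le> d * (2 * a) * E * X" .
      have "\<bar>b s - A s\<bar> * E \<le> d * a * E" using bA pos by (intro mult_right_mono) auto
      also have "\<dots> = d * a * E * 1" by simp
      also have "\<dots> \<le> d * a * E * X" using pos d by (intro mult_left_mono) auto
      finally show "\<bar>b s - A s\<bar> * E \<le> d * a * E * X" .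
    qed
    finally have bt: "\<bar>b t - A s * E\<bar> \<le> 3 * d * a * E * X" by (simp add: algebra_simps)
    have "3 * d * a * E * X \<le> 1 * (a * E * X)"
      using d pos unfolding mult.assoc[symmetric] by (intro mult_right_mono) auto
    then have "\<bar>b t\<bar> \<le> a * E * X + \<bar>A s * E\<bar>" using bt by linarith
    also have "\<bar>A s * E\<bar> \<le> a * E * X"
      using pos mult_left_mono[of 1 X "a * E"] by (simp add: a_def abs_mult)
    finally have bt2: "\<bar>b t\<bar> \<le> 2 * (a * E * X)" by (simp add: mult_ac)
    have hy: "\<bar>limit_shape \<rho> y\<bar> \<le> 2 * exp (y / 2)"
      using limit_shape_nonneg[OF y, of \<rho>] limit_shape_le[OF y rho] exp_ge_add_one_self[of "y / 2"]
      by linarith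
    have "f (t + y) - f t - A s * E * limit_shape \<rho> y
      = (f (t + y) - f t - b t * limit_shape \<rho> y) + (b t - A s * E) * limit_shape \<rho> y"
      by (simp add: algebra_simps)
    also have "\<bar>\<dots>\<bar> \<le> \<bar>f (t + y) - f t - b t * limit_shape \<rho> y\<bar> + \<bar>b t - A s * E\<bar> * \<bar>limit_shape \<rho> y\<bar>"
      unfolding abs_mult[symmetric] by linarith
    also have "\<dots> \<le> 8 * d * (2 * (a * E * X)) * exp (y / 2) + 3 * d * a * E * X * (2 * exp (y / 2))"
    proof (rule add_mono)
      have "8 * d * \<bar>b t\<bar> * exp (y / 2) \<le> 8 * d * (2 * (a * E * X)) * exp (y / 2)"
        using bt2 d by (intro mult_right_mono mult_left_mono) auto
      with s1[OF t(1) y] show "\<bar>f (t + y) - f t - b t * limit_shape \<rho> y\<bar> \<le> 8 * d * (2 * (a * E * X)) * exp (y / 2)"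
        by linarith
      show "\<bar>b t - A s * E\<bar> * \<bar>limit_shape \<rho> y\<bar> \<le> 3 * d * a * E * X * (2 * exp (y / 2))"
        using bt hy d pos by (intro mult_mono) auto
    qed
    also have "\<dots> = 22 * d * (a * E * X * exp (y / 2))" by simp
    also have "\<dots> \<le> e * (a * E * X * exp (y / 2))"
      using d pos by (intro mult_right_mono) auto
    finally show "\<bar>f (t + y) - f t - A s * exp (\<rho> * (t - s)) * limit_shape \<rho> y\<bar>
      \<le> e * \<bar>A s\<bar> * exp (\<rho> * (t - s)) * exp (\<bar>t - s\<bar> / 2) * exp (y / 2)"
      by (simp add: E_def X_def a_def mult_ac)
  qed
qed

end

section \<open>Top order statistics of exponential samples\<close>

abbreviation std_exp :: "real measure" where
  "std_exp \<equiv> density lborel (exponential_density 1)"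

lemma (in prob_space) has_bochner_integral_const_prob: "has_bochner_integral M (\<lambda>_. c) (c :: real)"
  by (simp add: has_bochner_integral_iff prob_space)

lemma prob_space_std_exp: "prob_space std_exp"
  by (rule prob_space_exponential_density) simp

lemma nn_integral_std_exp:
  assumes [measurable]: "f \<in> borel_measurable borel"
  shows "(\<integral>\<^sup>+x. f x \<partial>std_exp) = (\<integral>\<^sup>+x. indicator {0..} x * (ennreal (exp (- x)) * f x) \<partial>lborel)"
  by (subst nn_integral_density) (auto intro!: nn_integral_cong simp: exponential_density_def indicator_def)

lemma AE_std_exp_pos: "AE x in std_exp. 0 < x"
proof -
  have "AE x in lborel. x \<noteq> (0::real)" by (rule AE_lborel_singleton)
  then show ?thesis
    by (subst AE_density) (auto simp: exponential_density_def elim!: eventually_mono split: if_splits)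
qed

lemma std_exp_memoryless:
  assumes [measurable]: "f \<in> borel_measurable borel" and t: "0 \<le> t"
  shows "(\<integral>\<^sup>+x. indicator {t<..} x * f x \<partial>std_exp) = ennreal (exp (- t)) * (\<integral>\<^sup>+x. f (t + x) \<partial>std_exp)"
proof -
  have "(\<integral>\<^sup>+x. indicator {t<..} x * f x \<partial>std_exp)
      = (\<integral>\<^sup>+x. indicator {0..} x * (ennreal (exp (- x)) * (indicator {t<..} x * f x)) \<partial>lborel)"
    by (rule nn_integral_std_exp) measurable
  also have "\<dots> = (\<integral>\<^sup>+x. indicator {0..} (t + x) * (ennreal (exp (- (t + x))) * (indicator {t<..} (t + x) * f (t + x))) \<partial>lborel)"
    using nn_integral_real_affine[of "\<lambda>x. indicator {0..} x * (ennreal (exp (- x)) * (indicator {t<..} x * f x))" 1 t]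
    by simp
  also have "\<dots> = (\<integral>\<^sup>+x. ennreal (exp (- t)) * (indicator {0..} x * (ennreal (exp (- x)) * f (t + x))) \<partial>lborel)"
    using AE_lborel_singleton[of "0::real"] t
    by (intro nn_integral_cong_AE)
       (auto elim!: eventually_mono simp: indicator_def exp_add[symmetric] ennreal_mult[symmetric] mult.assoc[symmetric]
         simp flip: ennreal_mult')
  also have "\<dots> = ennreal (exp (- t)) * (\<integral>\<^sup>+x. f (t + x) \<partial>std_exp)"
    by (subst nn_integral_cmult) (auto simp: nn_integral_std_exp)
  finally show ?thesis .
qed

lemma product_sigma_finite_std_exp: "product_sigma_finite (\<lambda>_. std_exp)"
  using prob_space_std_exp by (simp add: product_sigma_finite_def prob_space_imp_sigma_finite)

abbreviation std_exps :: "'i set \<Rightarrow> ('i \<Rightarrow> real) measure" where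
  "std_exps I \<equiv> Pi\<^sub>M I (\<lambda>_. std_exp)"

lemma prob_space_PiM_std_exp: "prob_space (std_exps I)"
  by (intro prob_space_PiM prob_space_std_exp)

lemma sets_PiM_std_exp [measurable_cong]: "sets (std_exps I) = sets (Pi\<^sub>M I (\<lambda>_. borel))"
  by (intro sets_PiM_cong) auto

text \<open>An unnormalised form of the fact that, given all coordinates exceed \<open>t\<close>,
  the excesses are again independent standard exponentials. Keeping the probability
  \<open>exp (- t) ^ card S\<close> as a factor avoids conditional laws.\<close>

lemma PiM_std_exp_memoryless:
  fixes f :: "('i \<Rightarrow> real) \<Rightarrow> ennreal"
  assumes "finite S" "f \<in> borel_measurable (Pi\<^sub>M S (\<lambda>_. borel))" and t: "0 \<le> t"
  shows "(\<integral>\<^sup>+l. (\<Prod>i\<in>S. indicator {t<..} (l i)) * f l \<partial>std_exps S)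
       = ennreal (exp (- t)) ^ card S * (\<integral>\<^sup>+l. f (\<lambda>i\<in>S. t + l i) \<partial>std_exps S)"
  using assms(1,2)
proof (induction S arbitrary: f)
  case empty
  interpret product_sigma_finite "\<lambda>_::'i. std_exp" by (rule product_sigma_finite_std_exp)
  show ?case using prob_space.emeasure_space_1[OF prob_space_PiM_std_exp[of "{} :: 'i set"]]
    by (simp add: nn_integral_empty restrict_def)
next
  case (insert j S)
  interpret product_sigma_finite "\<lambda>_::'i. std_exp" by (rule product_sigma_finite_std_exp)
  note [simp] = insert.hyps
  note [measurable] = insert.prems
  have upd: "(\<lambda>x. x(j := y)) \<in> measurable (Pi\<^sub>M S (\<lambda>_. borel)) (Pi\<^sub>M (insert j S) (\<lambda>_. borel))" for y :: real
    by (rule measurable_fun_upd[where J=S]) auto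
  have upd2: "(\<lambda>y. x(j := y)) \<in> measurable borel (Pi\<^sub>M (insert j S) (\<lambda>_. borel))"
    if "x \<in> space (Pi\<^sub>M S (\<lambda>_. borel))" for x :: "'i \<Rightarrow> real"
    using that insert.hyps by (intro measurable_component_update) auto
  have fm: "(\<lambda>x. f (x(j := y))) \<in> borel_measurable (Pi\<^sub>M S (\<lambda>_. borel))" for y
    using measurable_comp[OF upd insert.prems] by (simp add: comp_def)
  have fm2: "(\<lambda>y. f (x(j := y))) \<in> borel_measurable borel" if "x \<in> space (Pi\<^sub>M S (\<lambda>_. borel))" for x
    using measurable_comp[OF upd2[OF that] insert.prems] by (simp add: comp_def)
  have sp: "space (std_exps S) = space (Pi\<^sub>M S (\<lambda>_. borel))"
    by (simp add: space_PiM)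
  let ?F = "\<lambda>l. (\<Prod>i\<in>insert j S. indicator {t<..} (l i)) * f l"
  have "integral\<^sup>N (std_exps (insert j S)) ?F
      = (\<integral>\<^sup>+x. (\<integral>\<^sup>+y. ?F (x(j := y)) \<partial>std_exp) \<partial>std_exps S)"
    by (rule product_nn_integral_insert) (auto intro!: borel_measurable_times_ennreal borel_measurable_prod_ennreal simp: insert.prems
        measurable_cong_sets[OF sets_PiM_std_exp refl])
  also have "\<dots> = (\<integral>\<^sup>+x. (\<Prod>i\<in>S. indicator {t<..} (x i)) * (\<integral>\<^sup>+y. indicator {t<..} y * f (x(j := y)) \<partial>std_exp) \<partial>std_exps S)"
  proof (rule nn_integral_cong)
    fix x assume x: "x \<in> space (std_exps S)"
    then have x': "x \<in> space (Pi\<^sub>M S (\<lambda>_. borel))" by (simp add: sp)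
    note [measurable] = fm2[OF x']
    have "(\<integral>\<^sup>+y. ?F (x(j := y)) \<partial>std_exp) = (\<integral>\<^sup>+y. (\<Prod>i\<in>S. indicator {t<..} (x i)) * (indicator {t<..} y * f (x(j := y))) \<partial>std_exp)"
    proof (intro nn_integral_cong)
      fix y
      have "(\<Prod>i\<in>S. indicator {t<..} ((x(j := y)) i)) = (\<Prod>i\<in>S. indicator {t<..} (x i) :: ennreal)"
        by (intro prod.cong) auto
      then show "?F (x(j := y)) = (\<Prod>i\<in>S. indicator {t<..} (x i)) * (indicator {t<..} y * f (x(j := y)))"
        by (simp add: mult_ac del: fun_upd_apply) (simp add: mult_ac)
    qed
    also have "\<dots> = (\<Prod>i\<in>S. indicator {t<..} (x i)) * (\<integral>\<^sup>+y. indicator {t<..} y * f (x(j := y)) \<partial>std_exp)"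
      by (rule nn_integral_cmult) measurable
    finally show "(\<integral>\<^sup>+y. ?F (x(j := y)) \<partial>std_exp) = \<dots>" .
  qed
  also have "\<dots> = (\<integral>\<^sup>+x. (\<Prod>i\<in>S. indicator {t<..} (x i)) * (ennreal (exp (- t)) * (\<integral>\<^sup>+y. f (x(j := t + y)) \<partial>std_exp)) \<partial>std_exps S)"
    by (intro nn_integral_cong arg_cong2[where f="(*)"] refl std_exp_memoryless fm2 t) (simp add: sp)
  \<comment> \<open>Coordinate \<open>j\<close> is already integrated out, so the induction
    hypothesis is applied to the function of the remaining coordinates that integrates
    \<open>f\<close> over \<open>j\<close>; this requires its measurability as a parametric
    integral.\<close>
  also have "\<dots> = ennreal (exp (- t)) ^ card S *
     (\<integral>\<^sup>+l. ennreal (exp (- t)) * (\<integral>\<^sup>+y. f ((\<lambda>i\<in>S. t + l i)(j := t + y)) \<partial>std_exp) \<partial>std_exps S)"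
  proof (rule insert.IH)
    have "(\<lambda>(x, y). f (x(j := t + y))) \<in> borel_measurable (Pi\<^sub>M S (\<lambda>_. borel) \<Otimes>\<^sub>M std_exp)"
    proof -
      have "(\<lambda>p. (fst p)(j := t + snd p)) \<in> measurable (Pi\<^sub>M S (\<lambda>_. borel) \<Otimes>\<^sub>M std_exp) (Pi\<^sub>M (insert j S) (\<lambda>_. borel))"
        by (rule measurable_fun_upd[where J=S]) auto
      from measurable_comp[OF this insert.prems] show ?thesis
        by (simp add: comp_def case_prod_beta)
    qed
    then have "(\<lambda>x. \<integral>\<^sup>+y. f (x(j := t + y)) \<partial>std_exp) \<in> borel_measurable (Pi\<^sub>M S (\<lambda>_. borel))"
      by (intro sigma_finite_measure.borel_measurable_nn_integral prob_space_imp_sigma_finite prob_space_std_exp)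
    then show "(\<lambda>x. ennreal (exp (- t)) * (\<integral>\<^sup>+y. f (x(j := t + y)) \<partial>std_exp)) \<in> borel_measurable (Pi\<^sub>M S (\<lambda>_. borel))"
      by measurable
  qed
  also have "(\<integral>\<^sup>+l. ennreal (exp (- t)) * (\<integral>\<^sup>+y. f ((\<lambda>i\<in>S. t + l i)(j := t + y)) \<partial>std_exp) \<partial>std_exps S)
     = ennreal (exp (- t)) * (\<integral>\<^sup>+l. \<integral>\<^sup>+y. f ((\<lambda>i\<in>S. t + l i)(j := t + y)) \<partial>std_exp \<partial>std_exps S)"
  proof (rule nn_integral_cmult)
    have "(\<lambda>(l, y). f ((\<lambda>i\<in>S. t + l i)(j := t + y))) \<in> borel_measurable (std_exps S \<Otimes>\<^sub>M std_exp)"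
    proof -
      have "(\<lambda>p. (\<lambda>i\<in>S. t + fst p i)(j := t + snd p)) \<in> measurable (std_exps S \<Otimes>\<^sub>M std_exp) (Pi\<^sub>M (insert j S) (\<lambda>_. borel))"
        by (rule measurable_fun_upd[where J=S]) (auto intro!: measurable_restrict)
      from measurable_comp[OF this insert.prems] show ?thesis
        by (simp add: comp_def case_prod_beta)
    qed
    then show "(\<lambda>l. \<integral>\<^sup>+y. f ((\<lambda>i\<in>S. t + l i)(j := t + y)) \<partial>std_exp) \<in> borel_measurable (std_exps S)"
      by (intro sigma_finite_measure.borel_measurable_nn_integral prob_space_imp_sigma_finite prob_space_std_exp)
  qed
  also have "(\<integral>\<^sup>+l. \<integral>\<^sup>+y. f ((\<lambda>i\<in>S. t + l i)(j := t + y)) \<partial>std_exp \<partial>std_exps S)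
     = (\<integral>\<^sup>+l. \<integral>\<^sup>+y. f (\<lambda>i\<in>insert j S. t + (l(j := y)) i) \<partial>std_exp \<partial>std_exps S)"
    by (intro nn_integral_cong arg_cong[where f=f]) (auto simp: restrict_def fun_eq_iff)
  also have "\<dots> = (\<integral>\<^sup>+l. f (\<lambda>i\<in>insert j S. t + l i) \<partial>std_exps (insert j S))"
  proof (rule product_nn_integral_insert[symmetric])
    have "(\<lambda>l. \<lambda>i\<in>insert j S. t + l i) \<in> measurable (std_exps (insert j S)) (Pi\<^sub>M (insert j S) (\<lambda>_. borel))"
      by (auto intro!: measurable_restrict)
    from measurable_comp[OF this insert.prems]
    show "(\<lambda>l. f (\<lambda>i\<in>insert j S. t + l i)) \<in> borel_measurable (std_exps (insert j S))"
      by (simp add: comp_def)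
  qed auto
  finally show ?case
    by (simp only: card_insert_disjoint[OF insert.hyps] power_Suc mult_ac)
qed

lemma emeasure_std_exp_Iic: "emeasure std_exp {..a} = ennreal (if 0 \<le> a then 1 - exp (- a) else 0)"
  by (subst emeasure_erlang_density) (auto simp: erlang_CDF_0)

lemma emeasure_std_exp_Ioo:
  assumes "0 \<le> t" shows "emeasure std_exp {0<..<t} = ennreal (1 - exp (- t))"
proof -
  have "emeasure std_exp {0<..<t} = emeasure std_exp {..t}"
  proof (rule emeasure_eq_AE)
    have "AE x in std_exp. x \<noteq> t"
      using AE_lborel_singleton[of t] by (subst AE_density) (auto elim!: eventually_mono)
    with AE_std_exp_pos show "AE x in std_exp. (x \<in> {0<..<t}) = (x \<in> {..t})"
      by eventually_elim auto
  qed auto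
  then show ?thesis using assms by (simp add: emeasure_std_exp_Iic)
qed

lemma distr_std_exp_uniform:
  "distr std_exp borel (\<lambda>t. 1 - exp (- t)) = density lborel (indicator {0..1})"
proof (rule cdf_unique)
  interpret prob_space std_exp by (rule prob_space_std_exp)
  show "real_distribution (distr std_exp borel (\<lambda>t. 1 - exp (- t)))"
    by (auto simp: real_distribution_def real_distribution_axioms_def intro!: prob_space_distr)
  show "real_distribution (density lborel (indicator {0..1::real}))"
    by (auto simp: real_distribution_def real_distribution_axioms_def emeasure_density intro!: prob_spaceI)
  show "cdf (distr std_exp borel (\<lambda>t. 1 - exp (- t))) = cdf (density lborel (indicator {0..1}))"
  proof
    fix x :: real
    have U: "emeasure (density lborel (indicator {0..1})) {..x} = ennreal (max 0 (min 1 x))"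
    proof -
      have "emeasure (density lborel (indicator {0..1})) {..x} = emeasure lborel ({0..1} \<inter> {..x})"
        by (simp add: emeasure_density flip: indicator_inter_arith)
      also have "{0..1} \<inter> {..x} = {0..min 1 x}" by auto
      finally show ?thesis by (auto simp: max_def)
    qed
    have "emeasure (distr std_exp borel (\<lambda>t. 1 - exp (- t))) {..x} = emeasure std_exp {t. 1 - exp (- t) \<le> x}"
      by (subst emeasure_distr) (auto simp: vimage_def)
    also have "\<dots> = ennreal (max 0 (min 1 x))"
    proof (cases "x < 1")
      case True
      have "{t. 1 - exp (- t) \<le> x} = {..- ln (1 - x)}"
      proof (rule set_eqI)
        fix t
        have "1 - exp (- t) \<le> x \<longleftrightarrow> 1 - x \<le> exp (- t)" by auto
        also have "\<dots> \<longleftrightarrow> ln (1 - x) \<le> - t" using True exp_le_cancel_iff[of "ln (1 - x)" "- t"] by simp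
        finally show "t \<in> {t. 1 - exp (- t) \<le> x} \<longleftrightarrow> t \<in> {..- ln (1 - x)}" by auto
      qed
      then show ?thesis using True
        by (auto simp: emeasure_std_exp_Iic max_def)
    next
      case False
      then have "{t. 1 - exp (- t) \<le> x} = space std_exp"
        by (auto intro: order_trans[of _ "1::real"])
      then show ?thesis using False emeasure_space_1 by (auto simp: max_def min_def)
    qed
    finally show "cdf (distr std_exp borel (\<lambda>t. 1 - exp (- t))) x = cdf (density lborel (indicator {0..1})) x"
      by (simp only: cdf_def measure_def U)
  qed
qed

text \<open>Substituting the uniform variable \<open>u = 1 - exp (- t)\<close> gives Euler's Beta
  integral. It serves three times: for the normalisation of the threshold density, for the
  exponential moments of the threshold and, with \<open>q = 0\<close>, for the moment generating
  function of one exponential.\<close>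

lemma nn_integral_std_exp_Beta:
  assumes p: "-1 < p"
  shows "(\<integral>\<^sup>+t. ennreal (exp (- p * t) * (1 - exp (- t)) ^ q) \<partial>std_exp) = ennreal (Beta (p + 1) (real q + 1))"
proof -
  let ?f = "\<lambda>u::real. (1 - u) powr p * u ^ q"
  have "(\<integral>\<^sup>+t. ennreal (exp (- p * t) * (1 - exp (- t)) ^ q) \<partial>std_exp) = (\<integral>\<^sup>+t. ennreal (?f (1 - exp (- t))) \<partial>std_exp)"
    by (intro nn_integral_cong) (simp add: powr_def)
  also have "\<dots> = (\<integral>\<^sup>+u. ennreal (?f u) \<partial>distr std_exp borel (\<lambda>t. 1 - exp (- t)))"
    by (subst nn_integral_distr) auto
  also have "\<dots> = (\<integral>\<^sup>+u. indicator {0..1} u * ennreal (?f u) \<partial>lborel)"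
    by (simp add: distr_std_exp_uniform nn_integral_density)
  also have "\<dots> = (\<integral>\<^sup>+u. ennreal (indicator {0..1} u * (u powr (real q + 1 - 1) * (1 - u) powr (p + 1 - 1))) \<partial>lborel)"
    using AE_lborel_singleton[of "0::real"]
    by (intro nn_integral_cong_AE) (auto elim!: eventually_mono simp: indicator_def powr_realpow mult_ac)
  also have "\<dots> = ennreal (Beta (real q + 1) (p + 1))"
    using has_integral_Beta_real[of "real q + 1" "p + 1"] p
    by (intro nn_integral_has_integral_lebesgue) auto
  finally show ?thesis by (simp add: Beta_commute)
qed

section \<open>Order statistics and the Hill statistic of a split sample\<close>

lemma sorted_nth_le_iff:
  assumes "sorted ys" "i < length ys"
  shows "ys ! i \<le> (a::real) \<longleftrightarrow> i < length (filter (\<lambda>y. y \<le> a) ys)"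
  using assms
proof (induction ys arbitrary: i)
  case (Cons y ys)
  show ?case
  proof (cases "y \<le> a")
    case True
    then show ?thesis using Cons by (cases i) auto
  next
    case False
    then have "filter (\<lambda>y. y \<le> a) (y # ys) = []"
      using Cons.prems by (auto simp: filter_empty_conv)
    moreover have "\<not> (y # ys) ! i \<le> a"
      using Cons.prems False sorted_nth_mono[of "y # ys" 0 i] by auto
    ultimately show ?thesis by simp
  qed
qed simp

text \<open>Counting sample points up to \<open>a\<close> replaces sorting; measurability of order
  statistics follows from that of the count.\<close>

lemma order_statistic_le_iff:
  assumes "1 \<le> i" "i \<le> n"
  shows "order_statistic i n x \<le> a \<longleftrightarrow> i \<le> card {j\<in>{1..n}. x j \<le> a}"
proof -
  let ?xs = "map x [1..<Suc n]"
  have "order_statistic i n x \<le> a \<longleftrightarrow> i - 1 < length (filter (\<lambda>y. y \<le> a) (sort ?xs))"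
    unfolding order_statistic_def using assms by (intro sorted_nth_le_iff) auto
  also have "length (filter (\<lambda>y. y \<le> a) (sort ?xs)) = length (filter (\<lambda>y. y \<le> a) ?xs)"
    by (metis mset_filter mset_sort size_mset)
  also have "\<dots> = length (filter (\<lambda>j. x j \<le> a) [1..<Suc n])"
    by (simp add: filter_map comp_def del: upt_Suc)
  also have "\<dots> = card {j\<in>{1..n}. x j \<le> a}"
    by (subst distinct_length_filter) (auto intro!: arg_cong[where f=card] simp del: upt_Suc)
  finally show ?thesis using assms by auto
qed

lemma order_statistic_cong:
  assumes "\<And>j. j \<in> {1..n} \<Longrightarrow> x j = y j"
  shows "order_statistic i n x = order_statistic i n y"
proof -
  have "map x [1..<Suc n] = map y [1..<Suc n]" using assms by (intro map_cong) auto
  then show ?thesis by (simp only: order_statistic_def)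
qed

lemma hill_estimator_cong:
  assumes "\<And>j. j \<in> {1..n} \<Longrightarrow> x j = y j"
  shows "hill_estimator k n x = hill_estimator k n y"
proof -
  have "order_statistic i n x = order_statistic i n y" for i
    by (intro order_statistic_cong assms)
  then show ?thesis by (simp add: hill_estimator_def)
qed

lemma measurable_order_statistic:
  assumes "1 \<le> i" "i \<le> n" and X [measurable]: "\<And>j. j \<in> {1..n} \<Longrightarrow> X j \<in> borel_measurable M"
  shows "(\<lambda>s. order_statistic i n (\<lambda>j. X j s)) \<in> borel_measurable M"
proof (subst borel_measurable_iff_le, rule allI)
  fix a
  have *: "order_statistic i n (\<lambda>j. X j s) \<le> a \<longleftrightarrow> real i \<le> (\<Sum>j\<in>{1..n}. of_bool (X j s \<le> a))" for s
  proof -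
    have "(\<Sum>j\<in>{1..n}. of_bool (X j s \<le> a)) = real (card {j\<in>{1..n}. X j s \<le> a})"
      by (simp add: of_bool_def sum.If_cases Int_def)
    then show ?thesis using order_statistic_le_iff[OF assms(1,2)] by simp
  qed
  have [measurable]: "(\<lambda>s. \<Sum>j\<in>{1..n}. of_bool (X j s \<le> a) :: real) \<in> borel_measurable M"
  proof (rule borel_measurable_sum)
    fix j assume "j \<in> {1..n}"
    note [measurable] = X[OF this]
    show "(\<lambda>s. of_bool (X j s \<le> a) :: real) \<in> borel_measurable M"
      unfolding of_bool_def by measurable
  qed
  show "{s \<in> space M. order_statistic i n (\<lambda>j. X j s) \<le> a} \<in> sets M"
    unfolding * by measurable
qed

lemma measurable_hill_estimator:
  assumes "1 \<le> k" "k < n" and X: "\<And>j. j \<in> {1..n} \<Longrightarrow> X j \<in> borel_measurable M"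
  shows "(\<lambda>s. hill_estimator k n (\<lambda>j. X j s)) \<in> borel_measurable M"
proof -
  have [measurable]: "(\<lambda>s. order_statistic (n - k) n (\<lambda>j. X j s)) \<in> borel_measurable M"
    using assms by (intro measurable_order_statistic) auto
  have [measurable]: "(\<lambda>s. order_statistic (n - i + 1) n (\<lambda>j. X j s)) \<in> borel_measurable M" if "i \<in> {1..k}" for i
    using assms that by (intro measurable_order_statistic) auto
  show ?thesis
    unfolding hill_estimator_def by measurable
qed

text \<open>The sorted sample consists of the values on \<open>R\<close>, then \<open>x h\<close>,
  then those on \<open>S\<close>, and the Hill sum depends only on the multiset of the last group.
  Weak inequalities are the right hypothesis: strictly ordered exponentials are sent through the
  merely monotone \<open>Q\<close>.\<close>

lemma hill_estimator_split:
  assumes k: "1 \<le> k" and h: "{1..n} = insert h (S \<union> R)" "h \<notin> S" "h \<notin> R" "S \<inter> R = {}" and cS: "card S = k"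
    and up: "\<And>i. i \<in> S \<Longrightarrow> x h \<le> x i" and lo: "\<And>i. i \<in> R \<Longrightarrow> x i \<le> x h"
  shows "hill_estimator k n x = 1 / real k * (\<Sum>i\<in>S. ln (x i / x h))"
proof -
  have fin: "finite S" "finite R"
    using h(1) by (auto intro: finite_subset[of _ "{1..n}"])
  define as where "as = sort (map x (sorted_list_of_set R))"
  define bs where "bs = sort (map x (sorted_list_of_set S))"
  have sas: "set as = x ` R" "set bs = x ` S" using fin by (auto simp: as_def bs_def)
  have mas: "mset as = image_mset x (mset_set R)" "mset bs = image_mset x (mset_set S)"
    using fin by (simp_all add: as_def bs_def mset_set_set[symmetric])
  have len: "length bs = k" "length as = card R"
    using fin cS by (simp_all add: as_def bs_def)
  have "n = card (insert h (S \<union> R))" using h(1) by (metis card_atLeastAtMost diff_Suc_1)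
  then have n: "n = Suc (k + card R)"
    using fin h cS by (simp add: card_Un_disjoint)
  have "mset (as @ x h # bs) = image_mset x (mset_set (insert h (S \<union> R)))"
    using fin h by (simp add: mas mset_set_Union)
  also have "\<dots> = mset (map x [1..<Suc n])"
    by (simp add: h(1)[symmetric] mset_upt atLeastLessThanSuc_atLeastAtMost del: upt_Suc)
  finally have ms: "mset (map x [1..<Suc n]) = mset (as @ x h # bs)" by simp
  have "sorted (as @ x h # bs)"
    using up lo by (auto simp: sorted_append sas as_def[symmetric] bs_def[symmetric])
      (auto simp: as_def bs_def intro: order_trans)
  then have srt: "sort (map x [1..<Suc n]) = as @ x h # bs"
    by (rule properties_for_sort[OF ms[symmetric]])
  \<comment> \<open>The zero-based position is \<open>n - k - 1 = card R\<close>, the entry right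
    after \<open>as\<close>.\<close>
  have th: "order_statistic (n - k) n x = x h"
    unfolding order_statistic_def srt using len n by (simp add: nth_append)
  have top: "order_statistic (n - i + 1) n x = bs ! (k - i)" if "i \<in> {1..k}" for i
    unfolding order_statistic_def srt using len n that by (auto simp: nth_append nth_Cons' Suc_diff_le)
  have "(\<Sum>i=1..k. ln (order_statistic (n - i + 1) n x / order_statistic (n - k) n x))
      = (\<Sum>i=1..k. ln (bs ! (k - i) / x h))"
    by (intro sum.cong refl) (simp only: top th)
  also have "\<dots> = (\<Sum>i\<in>{0..<k}. ln (bs ! i / x h))"
    by (rule sum.reindex_bij_witness[where i="\<lambda>i. k - i" and j="\<lambda>i. k - i"]) auto
  also have "\<dots> = sum_list (map (\<lambda>y. ln (y / x h)) bs)"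
    by (simp add: sum_list_sum_nth len)
  also have "\<dots> = sum_mset (image_mset (\<lambda>y. ln (y / x h)) (mset bs))"
    by (metis mset_map sum_mset_sum_list)
  also have "\<dots> = (\<Sum>i\<in>S. ln (x i / x h))"
    by (simp add: mas multiset.map_comp comp_def sum_unfold_sum_mset)
  finally show ?thesis by (simp add: hill_estimator_def)
qed

text \<open>The inequality for complements, together with equal total mass, is the reverse
  inequality. Hence a lower bound collected from disjoint events can identify a law.\<close>

lemma prob_measure_eqI_le:
  assumes "prob_space M" "prob_space N" and sets: "sets M = sets N"
    and le: "\<And>A. A \<in> sets M \<Longrightarrow> emeasure M A \<le> emeasure N A"
  shows "M = N"
proof (rule measure_eqI[OF sets])
  interpret M: prob_space M by fact
  interpret N: prob_space N by fact
  have sp: "space M = space N" using sets by (rule sets_eq_imp_space_eq)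
  fix A assume A: "A \<in> sets M"
  then have A': "A \<in> sets N" "space M - A \<in> sets M" using sets by auto
  have "M.prob A \<le> N.prob A"
    using le[OF A] by (simp add: M.emeasure_eq_measure N.emeasure_eq_measure)
  moreover have "M.prob (space M - A) \<le> N.prob (space N - A)"
    using le[OF A'(2)] by (simp add: M.emeasure_eq_measure N.emeasure_eq_measure sp)
  ultimately have "M.prob A = N.prob A"
    using M.prob_compl[OF A] N.prob_compl[OF A'(1)] by simp
  then show "emeasure M A = emeasure N A"
    by (simp add: M.emeasure_eq_measure N.emeasure_eq_measure)
qed

text \<open>\<open>threshold_law n k\<close> is the law of the \<open>(n - k)\<close>-th order statistic of \<open>n\<close> standard exponentials.\<close>

definition threshold_law :: "nat \<Rightarrow> nat \<Rightarrow> real measure" where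
  "threshold_law n k = density std_exp
     (\<lambda>t. ennreal (exp (- real k * t) * (1 - exp (- t)) ^ (n - 1 - k) / Beta (real k + 1) (real n - real k)))"

text \<open>Joint law of the threshold and the unordered excesses over it; the product form
  expresses their independence.\<close>

definition excess_law :: "nat \<Rightarrow> nat \<Rightarrow> (real \<times> (nat \<Rightarrow> real)) measure" where
  "excess_law n k = threshold_law n k \<Otimes>\<^sub>M std_exps {1..k}"

definition excess_hill :: "(real \<Rightarrow> real) \<Rightarrow> nat \<Rightarrow> real \<times> (nat \<Rightarrow> real) \<Rightarrow> real" where
  "excess_hill Q k p = 1 / real k * (\<Sum>i=1..k. ln (Q (fst p + snd p i) / Q (fst p)))"

lemma sets_threshold_law [measurable_cong, simp]: "sets (threshold_law n k) = sets borel"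
  by (simp add: threshold_law_def)

lemma space_threshold_law [simp]: "space (threshold_law n k) = UNIV"
  by (simp add: threshold_law_def)

lemma Beta_pos: "0 < Beta (real k + 1) (real n - real k)" if "k < n"
  unfolding Beta_def using that by (intro divide_pos_pos mult_pos_pos Gamma_real_pos) auto

lemma prob_space_threshold_law:
  assumes "k < n" shows "prob_space (threshold_law n k)"
proof (rule prob_spaceI)
  let ?B = "Beta (real k + 1) (real n - real k)"
  have B: "0 < ?B" using Beta_pos[OF assms] .
  have "emeasure (threshold_law n k) (space (threshold_law n k))
     = (\<integral>\<^sup>+t. ennreal (exp (- real k * t) * (1 - exp (- t)) ^ (n - 1 - k) / ?B) \<partial>std_exp)"
    by (simp add: threshold_law_def emeasure_density)
  also have "\<dots> = (\<integral>\<^sup>+t. ennreal (exp (- real k * t) * (1 - exp (- t)) ^ (n - 1 - k)) * ennreal (1 / ?B) \<partial>std_exp)"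
    using B by (intro nn_integral_cong_AE eventually_mono[OF AE_std_exp_pos])
      (simp add: ennreal_mult[symmetric])
  also have "\<dots> = ennreal ?B * ennreal (1 / ?B)"
    using nn_integral_std_exp_Beta[of "real k" "n - 1 - k"] assms
    by (subst nn_integral_multc) (auto simp: of_nat_diff)
  also have "\<dots> = 1" using B by (simp flip: ennreal_mult)
  finally show "emeasure (threshold_law n k) (space (threshold_law n k)) = 1" .
qed

lemma prob_space_excess_law:
  assumes "k < n" shows "prob_space (excess_law n k)"
proof -
  interpret T: prob_space "threshold_law n k" by (rule prob_space_threshold_law[OF assms])
  interpret E: prob_space "std_exps {1..k}" by (rule prob_space_PiM_std_exp)
  interpret pair_prob_space "threshold_law n k" "std_exps {1..k}" ..
  show ?thesis unfolding excess_law_def by (rule prob_space_axioms)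
qed

lemma sets_excess_law [measurable_cong]:
  "sets (excess_law n k) = sets (borel \<Otimes>\<^sub>M Pi\<^sub>M {1..k} (\<lambda>_. borel))"
  unfolding excess_law_def by (intro sets_pair_measure_cong sets_PiM_std_exp) simp

lemma measurable_excess_hill:
  assumes [measurable]: "Q \<in> borel_measurable borel"
  shows "excess_hill Q k \<in> borel_measurable (borel \<Otimes>\<^sub>M Pi\<^sub>M {1..k} (\<lambda>_. borel))"
  unfolding excess_hill_def[abs_def] by measurable

text \<open>One split of the sample: \<open>h\<close> carries the threshold, \<open>S\<close> the
  larger values, \<open>R\<close> the smaller ones. With the value \<open>t\<close> at
  \<open>h\<close> fixed, \<open>R\<close> contributes \<open>(1 - exp (- t)) ^ (n - 1 - k)\<close>,
  and \<open>S\<close> contributes \<open>exp (- t) ^ k\<close> times an integral over fresh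
  excesses. The product of these powers is the density of \<open>threshold_law\<close> up to the
  Beta constant, which is therefore the probability of the split.\<close>

lemma nn_integral_split_event:
  assumes [measurable]: "Q \<in> borel_measurable borel" "B \<in> sets borel" and kn: "k < n"
    and I: "finite S" "finite R" "h \<notin> S" "h \<notin> R" "S \<inter> R = {}" "card S = k" "card R = n - 1 - k"
  shows "(\<integral>\<^sup>+l. (if 0 < l h then 1 else 0) * (\<Prod>i\<in>S. if l h < l i then 1 else 0)
            * (\<Prod>i\<in>R. if 0 < l i \<and> l i < l h then 1 else 0)
            * indicator B (1 / real k * (\<Sum>i\<in>S. ln (Q (l i) / Q (l h)))) \<partial>std_exps (insert h (S \<union> R)))
       = ennreal (Beta (real k + 1) (real n - real k)) * emeasure (distr (excess_law n k) borel (excess_hill Q k)) B"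
    (is "integral\<^sup>N _ ?f = _")
proof -
  interpret E: product_sigma_finite "\<lambda>_::'a. std_exp" by (rule product_sigma_finite_std_exp)
  interpret prob_space "threshold_law n k" by (rule prob_space_threshold_law[OF kn])
  interpret P: prob_space "std_exps {1..k}" by (rule prob_space_PiM_std_exp)
  let ?b = "Beta (real k + 1) (real n - real k)"
  let ?w = "\<lambda>t. exp (- real k * t) * (1 - exp (- t)) ^ (n - 1 - k)"
  define inner where "inner t = (\<integral>\<^sup>+e. indicator B (excess_hill Q k (t, e)) \<partial>std_exps {1..k})" for t
  have [measurable]: "(\<lambda>(t, e). excess_hill Q k (t, e)) \<in> borel_measurable (borel \<Otimes>\<^sub>M std_exps {1..k})"
    unfolding excess_hill_def by measurable
  have inner_meas [measurable]: "inner \<in> borel_measurable borel"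
    unfolding inner_def by measurable
  have slice: "(\<integral>\<^sup>+x. ?f (x(h := t)) \<partial>std_exps (S \<union> R)) = ennreal (?w t) * inner t"
    if t: "0 < t" for t
  proof -
    let ?\<Phi> = "\<lambda>x. indicator B (1 / real k * (\<Sum>i\<in>S. ln (Q (x i) / Q t))) :: ennreal"
    let ?g = "\<lambda>x. ((\<Prod>i\<in>S. if t < x i then 1 else 0) * ?\<Phi> x) * (\<Prod>i\<in>R. if 0 < x i \<and> x i < t then 1 else 0) :: ennreal"
    have "?f (x(h := t)) = ?g x" for x
    proof -
      have 1: "(\<Prod>i\<in>S. if (x(h := t)) h < (x(h := t)) i then 1 else 0) = (\<Prod>i\<in>S. if t < x i then 1 else 0 :: ennreal)"
        using I by (intro prod.cong) auto
      have 2: "(\<Prod>i\<in>R. if 0 < (x(h := t)) i \<and> (x(h := t)) i < (x(h := t)) h then 1 else 0)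
          = (\<Prod>i\<in>R. if 0 < x i \<and> x i < t then 1 else 0 :: ennreal)"
        using I by (intro prod.cong) auto
      have 3: "(\<Sum>i\<in>S. ln (Q ((x(h := t)) i) / Q ((x(h := t)) h))) = (\<Sum>i\<in>S. ln (Q (x i) / Q t))"
        using I by (intro sum.cong) auto
      show ?thesis unfolding 1 2 3 using t by (simp add: mult_ac)
    qed
    then have "(\<integral>\<^sup>+x. ?f (x(h := t)) \<partial>std_exps (S \<union> R)) = (\<integral>\<^sup>+x. ?g x \<partial>std_exps (S \<union> R))"
      by simp
    also have "\<dots> = (\<integral>\<^sup>+x. (\<integral>\<^sup>+y. ?g (merge S R (x, y)) \<partial>std_exps R) \<partial>std_exps S)"
      using I by (intro E.product_nn_integral_fold) auto
    also have "\<dots> = (\<integral>\<^sup>+x. ((\<Prod>i\<in>S. if t < x i then 1 else 0) * ?\<Phi> x) * ennreal (1 - exp (- t)) ^ (n - 1 - k) \<partial>std_exps S)"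
    proof (rule nn_integral_cong)
      fix x
      have "?g (merge S R (x, y)) = ((\<Prod>i\<in>S. if t < x i then 1 else 0) * ?\<Phi> x) * (\<Prod>i\<in>R. indicator {0<..<t} (y i))" for y
      proof -
        have 1: "(\<Prod>i\<in>S. if t < merge S R (x, y) i then 1 else 0) = (\<Prod>i\<in>S. if t < x i then 1 else 0 :: ennreal)"
          by (intro prod.cong) (auto simp: merge_def)
        have 2: "(\<Prod>i\<in>R. if 0 < merge S R (x, y) i \<and> merge S R (x, y) i < t then 1 else 0)
            = (\<Prod>i\<in>R. indicator {0<..<t} (y i) :: ennreal)"
          using I by (intro prod.cong) (auto simp: merge_def indicator_def)
        have 3: "(\<Sum>i\<in>S. ln (Q (merge S R (x, y) i) / Q t)) = (\<Sum>i\<in>S. ln (Q (x i) / Q t))"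
          by (intro sum.cong) (auto simp: merge_def)
        show ?thesis unfolding 1 2 3 ..
      qed
      then have "(\<integral>\<^sup>+y. ?g (merge S R (x, y)) \<partial>std_exps R)
          = (\<integral>\<^sup>+y. ((\<Prod>i\<in>S. if t < x i then 1 else 0) * ?\<Phi> x) * (\<Prod>i\<in>R. indicator {0<..<t} (y i)) \<partial>std_exps R)"
        by simp
      also have "\<dots> = ((\<Prod>i\<in>S. if t < x i then 1 else 0) * ?\<Phi> x) * (\<integral>\<^sup>+y. (\<Prod>i\<in>R. indicator {0<..<t} (y i)) \<partial>std_exps R)"
        by (rule nn_integral_cmult) measurable
      also have "(\<integral>\<^sup>+y. (\<Prod>i\<in>R. indicator {0<..<t} (y i)) \<partial>std_exps R) = ennreal (1 - exp (- t)) ^ (n - 1 - k)"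
        using I t by (subst E.product_nn_integral_prod) (auto simp: emeasure_std_exp_Ioo simp del: emeasure_density)
      finally show "(\<integral>\<^sup>+y. ?g (merge S R (x, y)) \<partial>std_exps R)
          = ((\<Prod>i\<in>S. if t < x i then 1 else 0) * ?\<Phi> x) * ennreal (1 - exp (- t)) ^ (n - 1 - k)" .
    qed
    also have "\<dots> = (\<integral>\<^sup>+x. (\<Prod>i\<in>S. indicator {t<..} (x i)) * ?\<Phi> x \<partial>std_exps S) * ennreal (1 - exp (- t)) ^ (n - 1 - k)"
    proof -
      have "(if t < x i then 1 else 0) = (indicator {t<..} (x i) :: ennreal)" for x :: "'a \<Rightarrow> real" and i
        by simp
      then show ?thesis by (simp only:) (rule nn_integral_multc, measurable)
    qed
    also have "(\<integral>\<^sup>+x. (\<Prod>i\<in>S. indicator {t<..} (x i)) * ?\<Phi> x \<partial>std_exps S)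
       = ennreal (exp (- t)) ^ k * (\<integral>\<^sup>+x. ?\<Phi> (\<lambda>i\<in>S. t + x i) \<partial>std_exps S)"
      unfolding \<open>card S = k\<close>[symmetric] using I t by (intro PiM_std_exp_memoryless) auto
    also have "(\<integral>\<^sup>+x. ?\<Phi> (\<lambda>i\<in>S. t + x i) \<partial>std_exps S) = inner t"
    proof -
      \<comment> \<open>The excesses on \<open>S\<close> are relabelled by \<open>{1..k}\<close>;
        identical independent coordinates permit any bijection, and the Hill sum does not see the
        order.\<close>
      obtain \<pi> where \<pi>: "bij_betw \<pi> {1..k} S"
        using I by (metis card_atLeastAtMost diff_Suc_1 finite_atLeastAtMost finite_same_card_bij)
      have "inner t = (\<integral>\<^sup>+e. indicator B (excess_hill Q k (t, e))
          \<partial>distr (std_exps S) (std_exps {1..k}) (\<lambda>\<omega>. \<lambda>i\<in>{1..k}. \<omega> (\<pi> i)))"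
        unfolding inner_def using \<pi>
        by (subst distr_PiM_reindex) (auto intro: prob_space_std_exp simp: bij_betw_def)
      also have "\<dots> = (\<integral>\<^sup>+x. indicator B (excess_hill Q k (t, \<lambda>i\<in>{1..k}. x (\<pi> i))) \<partial>std_exps S)"
      proof (subst nn_integral_distr)
        show "(\<lambda>\<omega>. \<lambda>i\<in>{1..k}. \<omega> (\<pi> i)) \<in> measurable (std_exps S) (std_exps {1..k})"
          using \<pi> by (intro measurable_restrict) (auto simp: bij_betw_def)
        have "(\<lambda>e. indicator B (excess_hill Q k (t, e))) \<in> borel_measurable (std_exps {1..k})"
          unfolding excess_hill_def fst_conv snd_conv by measurable
        then show "(\<lambda>e. indicator B (excess_hill Q k (t, e))) \<in> borel_measurable
            (distr (std_exps S) (std_exps {1..k}) (\<lambda>\<omega>. \<lambda>i\<in>{1..k}. \<omega> (\<pi> i)))"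
          by simp
      qed simp
      also have "\<dots> = (\<integral>\<^sup>+x. ?\<Phi> (\<lambda>i\<in>S. t + x i) \<partial>std_exps S)"
      proof (intro nn_integral_cong)
        fix x
        have "(\<Sum>i\<in>S. ln (Q ((\<lambda>i\<in>S. t + x i) i) / Q t)) = (\<Sum>i\<in>{1..k}. ln (Q (t + x (\<pi> i)) / Q t))"
          using \<pi> by (intro sum.reindex_bij_betw[OF \<pi>, symmetric, THEN trans] sum.cong) (auto simp: bij_betw_def)
        then show "indicator B (excess_hill Q k (t, \<lambda>i\<in>{1..k}. x (\<pi> i))) = ?\<Phi> (\<lambda>i\<in>S. t + x i)"
          by (simp add: excess_hill_def)
      qed
      finally show ?thesis ..
    qed
    also have "ennreal (exp (- t)) ^ k * inner t * ennreal (1 - exp (- t)) ^ (n - 1 - k) = ennreal (?w t) * inner t"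
    proof -
      have "ennreal (?w t) = ennreal (exp (- t)) ^ k * ennreal (1 - exp (- t)) ^ (n - 1 - k)"
        using t by (simp add: ennreal_power ennreal_mult[symmetric] exp_of_nat_mult[symmetric])
      then show ?thesis by (simp add: mult_ac)
    qed
    finally show ?thesis .
  qed
  have "integral\<^sup>N (std_exps (insert h (S \<union> R))) ?f
      = (\<integral>\<^sup>+t. (\<integral>\<^sup>+x. ?f (x(h := t)) \<partial>std_exps (S \<union> R)) \<partial>std_exp)"
    using I by (intro E.product_nn_integral_insert_rev) auto
  also have "\<dots> = (\<integral>\<^sup>+t. ennreal ?b * (ennreal (?w t / ?b) * inner t) \<partial>std_exp)"
  proof (intro nn_integral_cong_AE eventually_mono[OF AE_std_exp_pos])
    fix t :: real assume t: "0 < t"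
    have "ennreal ?b * ennreal (?w t / ?b) = ennreal (?w t)"
      using Beta_pos[OF kn] t by (simp add: ennreal_mult[symmetric])
    then show "(\<integral>\<^sup>+x. ?f (x(h := t)) \<partial>std_exps (S \<union> R)) = ennreal ?b * (ennreal (?w t / ?b) * inner t)"
      unfolding slice[OF t] by (simp add: mult.assoc[symmetric])
  qed
  also have "\<dots> = ennreal ?b * (\<integral>\<^sup>+t. ennreal (?w t / ?b) * inner t \<partial>std_exp)"
    by (rule nn_integral_cmult) measurable
  also have "(\<integral>\<^sup>+t. ennreal (?w t / ?b) * inner t \<partial>std_exp) = (\<integral>\<^sup>+t. inner t \<partial>threshold_law n k)"
    unfolding threshold_law_def by (subst nn_integral_density) auto
  also have "\<dots> = (\<integral>\<^sup>+p. indicator B (excess_hill Q k p) \<partial>excess_law n k)"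
  proof -
    have [measurable]: "excess_hill Q k \<in> borel_measurable (threshold_law n k \<Otimes>\<^sub>M std_exps {1..k})"
      using measurable_excess_hill[OF assms(1), of k]
      by (simp only: measurable_cong_sets[OF sets_excess_law[unfolded excess_law_def] refl])
    show ?thesis
      unfolding inner_def excess_law_def
      by (rule P.nn_integral_fst[of "\<lambda>p. indicator B (excess_hill Q k p)"]) measurable
  qed
  also have "\<dots> = emeasure (distr (excess_law n k) borel (excess_hill Q k)) B"
    using measurable_excess_hill[OF assms(1), of k]
    by (subst nn_integral_distr[symmetric, where f="indicator B"]) (auto simp: measurable_cong_sets[OF sets_excess_law refl])
  finally show ?thesis .
qed

text \<open>\<open>n * (n - 1 choose k)\<close> is the number of splits and the Beta value the
  probability of each, so the splits carry all the mass.\<close>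

lemma choose_mult_Beta:
  assumes "k < n"
  shows "real (n * (n - 1 choose k)) * Beta (real k + 1) (real n - real k) = 1"
proof -
  obtain r where n: "n = Suc (k + r)" using assms less_iff_Suc_add by auto
  have "Beta (real k + 1) (real n - real k) = fact k * fact r / fact n"
    unfolding Beta_def n
    using Gamma_fact[of k, where 'a=real] Gamma_fact[of r, where 'a=real] Gamma_fact[of "Suc (k + r)", where 'a=real]
    by (simp add: add_ac)
  moreover have "real (n - 1 choose k) = fact (k + r) / (fact k * fact r)"
    using binomial_fact[of k "k + r", where 'a=real] n by simp
  moreover have "fact n = real n * fact (k + r)" "real n \<noteq> 0" using n by simp_all
  ultimately show ?thesis by simp
qed

text \<open>
  Ties need no separate treatment: the events below, one for each choice of the threshold index \<open>h\<close>
  and of the set \<open>S\<close> of the \<open>k\<close> larger indices, are disjoint, and their probabilities add up to \<open>1\<close>.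
\<close>

theorem distr_hill_std_exp:
  assumes k: "1 \<le> k" "k < n" and Q [measurable]: "Q \<in> borel_measurable borel" and mono: "mono_on {0<..} Q"
  shows "distr (std_exps {1..n}) borel (\<lambda>l. hill_estimator k n (\<lambda>i. Q (l i)))
       = distr (excess_law n k) borel (excess_hill Q k)"
proof (rule prob_measure_eqI_le[symmetric])
  let ?\<mu> = "std_exps {1..n}"
  let ?H = "\<lambda>l. hill_estimator k n (\<lambda>i. Q (l i))"
  interpret \<mu>: prob_space ?\<mu> by (rule prob_space_PiM_std_exp)
  interpret X: prob_space "excess_law n k" by (rule prob_space_excess_law[OF k(2)])
  have H [measurable]: "?H \<in> borel_measurable ?\<mu>"
    using k by (intro measurable_hill_estimator) auto
  show "prob_space (distr ?\<mu> borel ?H)" by (rule \<mu>.prob_space_distr) measurable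
  show "prob_space (distr (excess_law n k) borel (excess_hill Q k))"
    using measurable_excess_hill[OF Q, of k]
    by (intro X.prob_space_distr) (simp add: measurable_cong_sets[OF sets_excess_law refl])
  fix B assume "B \<in> sets (distr (excess_law n k) borel (excess_hill Q k))"
  then have B [measurable]: "B \<in> sets borel" by simp
  define P where "P = (SIGMA h:{1..n}. {S. S \<subseteq> {1..n} - {h} \<and> card S = k})"
  have finP: "finite P" unfolding P_def by (intro finite_SigmaI) (auto intro: finite_subset)
  have cardP: "card P = n * (n - 1 choose k)"
    unfolding P_def by (subst card_SigmaI) (auto simp: n_subsets intro: finite_subset)
  define R where "R h S = {1..n} - {h} - S" for h S
  define F where "F p l = (if 0 < l (fst p) then 1 else 0) * (\<Prod>i\<in>snd p. if l (fst p) < l i then 1 else 0)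
      * (\<Prod>i\<in>R (fst p) (snd p). if 0 < l i \<and> l i < l (fst p) then 1 else 0)
      * (indicator B (1 / real k * (\<Sum>i\<in>snd p. ln (Q (l i) / Q (l (fst p))))) :: ennreal)"
    for p and l :: "nat \<Rightarrow> real"
  have P: "finite S" "finite (R h S)" "h \<notin> S" "h \<notin> R h S" "S \<inter> R h S = {}" "card S = k"
      "card (R h S) = n - 1 - k" "{1..n} = insert h (S \<union> R h S)"
    if "(h, S) \<in> P" for h S
  proof -
    have S: "h \<in> {1..n}" "S \<subseteq> {1..n} - {h}" "card S = k" using that by (auto simp: P_def)
    then show "finite S" by (meson finite_Diff finite_atLeastAtMost finite_subset)
    then show "card (R h S) = n - 1 - k"
      using S unfolding R_def by (subst card_Diff_subset) auto
  qed (use that in \<open>auto simp: P_def R_def\<close>)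
  have intF: "(\<integral>\<^sup>+l. F p l \<partial>?\<mu>) = ennreal (Beta (real k + 1) (real n - real k)) * emeasure (distr (excess_law n k) borel (excess_hill Q k)) B"
    if "p \<in> P" for p
  proof -
    obtain h S where p: "p = (h, S)" by (cases p)
    note PS = P[OF that[unfolded p]]
    show ?thesis
      unfolding F_def p fst_conv snd_conv PS(8) by (rule nn_integral_split_event[OF Q B k(2) PS(1-7)])
  qed
  have F_meas: "F p \<in> borel_measurable ?\<mu>" if "p \<in> P" for p
  proof -
    obtain h S where p: "p = (h, S)" by (cases p)
    note PS = P[OF that[unfolded p]]
    show ?thesis
      unfolding F_def p fst_conv snd_conv PS(8) by measurable
  qed
  have zero: "F (h, S) l = 0"
    if "finite S" "finite (R h S)" "\<not> (0 < l h \<and> (\<forall>i\<in>S. l h < l i) \<and> (\<forall>i\<in>R h S. 0 < l i \<and> l i < l h))" for h S l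
    using that unfolding F_def by (auto simp: prod_zero_iff)
  \<comment> \<open>At most one split holds at a given \<open>l\<close>, so the sum is a single
    indicator or \<open>0\<close>. Where no split holds, nothing about the Hill statistic is claimed
    beyond \<open>0 \<le>\<close>: an inequality is enough between laws of total mass
    \<open>1\<close>.\<close>
  have le: "(\<Sum>p\<in>P. F p l) \<le> indicator B (?H l)" for l
  proof (cases "\<exists>p\<in>P. F p l \<noteq> 0")
    case False
    then show ?thesis by simp
  next
    case True
    then obtain h S where hS: "(h, S) \<in> P" "F (h, S) l \<noteq> 0" by auto
    have ev: "0 < l h \<and> (\<forall>i\<in>S. l h < l i) \<and> (\<forall>i\<in>R h S. 0 < l i \<and> l i < l h)"
      if "(h, S) \<in> P" "F (h, S) l \<noteq> 0" for h S
      using zero[of S h l] P[OF that(1)] that(2) by blast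
    have Seq: "S = {i\<in>{1..n}. l h < l i}" if "(h, S) \<in> P" "F (h, S) l \<noteq> 0" for h S
      using ev[OF that] unfolding P(8)[OF that(1)] by fastforce
    have le_h: "l h' \<le> l h" if hS: "(h, S) \<in> P" "F (h, S) l \<noteq> 0" and hS': "(h', S') \<in> P" "F (h', S') l \<noteq> 0" for h S h' S'
    proof (rule ccontr)
      \<comment> \<open>If \<open>h'\<close> had the larger value, \<open>S\<close> would contain
        \<open>h'\<close> and everything above it, hence more than the \<open>k\<close> elements of
        \<open>S'\<close>.\<close>
      assume "\<not> l h' \<le> l h"
      then have "h' \<in> S" "S' \<subseteq> S"
        using Seq[OF hS] Seq[OF hS'] hS'(1) by (auto simp: P_def)
      then have "S' \<subset> S" using P(3)[OF hS'(1)] by auto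
      then have "card S' < card S" using P(1)[OF hS(1)] by (rule psubset_card_mono[rotated])
      then show False using P(6)[OF hS(1)] P(6)[OF hS'(1)] by simp
    qed
    have uniq: "p = (h, S)" if "p \<in> P" "F p l \<noteq> 0" for p
    proof -
      obtain h' S' where p: "p = (h', S')" by (cases p)
      then have hS': "(h', S') \<in> P" "F (h', S') l \<noteq> 0" using that by auto
      have "l h = l h'" using le_h[OF hS hS'] le_h[OF hS' hS] by simp
      then have "h' \<notin> S" "h' \<notin> R h S" using ev[OF hS] by auto
      moreover have "h' \<in> {1..n}" using hS'(1) by (simp add: P_def)
      ultimately have "h' = h" unfolding P(8)[OF hS(1)] by blast
      then show ?thesis using Seq[OF hS] Seq[OF hS'] p by simp
    qed
    have "(\<Sum>p\<in>P. F p l) = (\<Sum>p\<in>{(h, S)}. F p l)"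
    proof (rule sum.mono_neutral_right[OF finP])
      show "{(h, S)} \<subseteq> P" using hS(1) by simp
      show "\<forall>p\<in>P - {(h, S)}. F p l = 0" using uniq by blast
    qed
    also have "\<dots> = F (h, S) l" by simp
    also have "\<dots> = indicator B (1 / real k * (\<Sum>i\<in>S. ln (Q (l i) / Q (l h))))"
      using ev[OF hS] by (simp add: F_def)
    also have "1 / real k * (\<Sum>i\<in>S. ln (Q (l i) / Q (l h))) = ?H l"
    proof (rule hill_estimator_split[symmetric, OF k(1) P(8)[OF hS(1)] P(3-6)[OF hS(1)]])
      note e = ev[OF hS]
      show "Q (l h) \<le> Q (l i)" if "i \<in> S" for i
        using e that by (intro mono_onD[OF mono]) (auto intro: less_trans less_imp_le)
      show "Q (l i) \<le> Q (l h)" if "i \<in> R h S" for i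
        using e that by (intro mono_onD[OF mono]) (auto intro: less_imp_le)
    qed
    finally show ?thesis by simp
  qed
  let ?b = "Beta (real k + 1) (real n - real k)"
  let ?E = "emeasure (distr (excess_law n k) borel (excess_hill Q k)) B"
  have one: "real (card P) * ?b = 1"
    unfolding cardP by (rule choose_mult_Beta[OF k(2)])
  have "?E = ennreal (real (card P) * ?b) * ?E"
    unfolding one by simp
  also have "\<dots> = of_nat (card P) * (ennreal ?b * ?E)"
    unfolding ennreal_of_nat_eq_real_of_nat
    by (subst ennreal_mult) (use Beta_pos[OF k(2)] in \<open>auto simp: mult.assoc\<close>)
  also have "\<dots> = (\<Sum>p\<in>P. ennreal ?b * ?E)"
    by (rule sum_constant[symmetric])
  also have "\<dots> = (\<Sum>p\<in>P. \<integral>\<^sup>+l. F p l \<partial>?\<mu>)"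
    by (intro sum.cong refl intF[symmetric])
  also have "\<dots> = (\<integral>\<^sup>+l. (\<Sum>p\<in>P. F p l) \<partial>?\<mu>)"
    by (rule nn_integral_sum[symmetric]) (rule F_meas)
  also have "\<dots> \<le> (\<integral>\<^sup>+l. indicator B (?H l) \<partial>?\<mu>)"
    by (intro nn_integral_mono le)
  also have "\<dots> = emeasure (distr ?\<mu> borel ?H) B"
    by (subst nn_integral_distr[OF H, where f="indicator B", symmetric]) auto
  finally show "emeasure (distr (excess_law n k) borel (excess_hill Q k)) B \<le> emeasure (distr ?\<mu> borel ?H) B" .
qed simp

corollary distr_hill_estimator:
  assumes k: "1 \<le> k" "k < n" and Q [measurable]: "Q \<in> borel_measurable borel" and mono: "mono_on {0<..} Q"
    and D: "distr std_exp borel Q = D"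
  shows "distr (Pi\<^sub>M {1..n} (\<lambda>_. D)) borel (hill_estimator k n) = distr (excess_law n k) borel (excess_hill Q k)"
proof -
  interpret E: prob_space std_exp by (rule prob_space_std_exp)
  have pD: "prob_space D" unfolding D[symmetric] by (rule E.prob_space_distr) measurable
  have sD: "sets D = sets borel" unfolding D[symmetric] by simp
  have [measurable_cong]: "sets (Pi\<^sub>M {1..n} (\<lambda>_. D)) = sets (Pi\<^sub>M {1..n} (\<lambda>_. borel))"
    by (intro sets_PiM_cong) (auto simp: sD)
  have "distr std_exp D Q = distr std_exp borel Q" by (rule distr_cong) (auto simp: sD)
  then have DQ: "distr std_exp D Q = D" using D by simp
  have "Pi\<^sub>M {1..n} (\<lambda>_. D) = distr (std_exps {1..n}) (Pi\<^sub>M {1..n} (\<lambda>_. D)) (compose {1..n} Q)"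
    by (subst distr_PiM_finite_prob_space') (auto simp: DQ pD prob_space_std_exp measurable_cong_sets[OF refl sD])
  then have "distr (Pi\<^sub>M {1..n} (\<lambda>_. D)) borel (hill_estimator k n)
      = distr (distr (std_exps {1..n}) (Pi\<^sub>M {1..n} (\<lambda>_. D)) (compose {1..n} Q)) borel (hill_estimator k n)"
    by simp
  also have "\<dots> = distr (std_exps {1..n}) borel (\<lambda>l. hill_estimator k n (compose {1..n} Q l))"
  proof (subst distr_distr)
    show "hill_estimator k n \<in> borel_measurable (Pi\<^sub>M {1..n} (\<lambda>_. D))"
    proof (rule measurable_hill_estimator[OF k, where X="\<lambda>j l. l j"])
      fix j assume "j \<in> {1..n}"
      from measurable_component_singleton[OF this, of "\<lambda>_. D"]
      show "(\<lambda>l. l j) \<in> borel_measurable (Pi\<^sub>M {1..n} (\<lambda>_. D))"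
        by (simp only: measurable_cong_sets[OF refl sD])
    qed
    show "compose {1..n} Q \<in> measurable (std_exps {1..n}) (Pi\<^sub>M {1..n} (\<lambda>_. D))"
      unfolding compose_def measurable_cong_sets[OF refl sD]
      by (intro measurable_restrict) (simp only: measurable_cong_sets[OF refl sD], measurable)
  qed (simp add: comp_def)
  also have "\<dots> = distr (std_exps {1..n}) borel (\<lambda>l. hill_estimator k n (\<lambda>i. Q (l i)))"
    by (intro distr_cong refl hill_estimator_cong) (simp add: compose_def)
  also have "\<dots> = distr (excess_law n k) borel (excess_hill Q k)"
    by (rule distr_hill_std_exp[OF k Q mono])
  finally show ?thesis .
qed

section \<open>Quantile transform of an exponential variable\<close>

lemma tail_quantile_exp:
  assumes "real_distribution D" "0 < l"
  shows "tail_quantile (cdf D) (exp l) = Inf {x. 1 - exp (- l) \<le> cdf D x}"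
proof -
  interpret real_distribution D by fact
  have "cdf D x = 1 \<or> exp l \<le> 1 / (1 - cdf D x) \<longleftrightarrow> 1 - exp (- l) \<le> cdf D x" for x
  proof (cases "cdf D x = 1")
    case False
    then have "0 < 1 - cdf D x" using cdf_bounded_prob[of x] by simp
    then have "exp l \<le> 1 / (1 - cdf D x) \<longleftrightarrow> (1 - cdf D x) \<le> exp (- l)"
      by (simp add: pos_le_divide_eq exp_minus inverse_eq_divide mult.commute)
    also have "\<dots> \<longleftrightarrow> 1 - exp (- l) \<le> cdf D x" by linarith
    finally show ?thesis using False by blast
  qed simp
  then show ?thesis unfolding tail_quantile_def by (simp only:)
qed

text \<open>The Galois connection between quantile and distribution function; both the monotonicity
  of the transform and its law follow from it.\<close>

lemma quantile_le_iff:
  assumes "real_distribution D" "0 < l"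
  shows "tail_quantile (cdf D) (exp l) \<le> x \<longleftrightarrow> 1 - exp (- l) \<le> cdf D x"
proof -
  interpret cdf_distribution D using assms by (simp add: cdf_distribution_def)
  show ?thesis
    using pseudoinverse[of "1 - exp (- l)" x] assms by (simp add: tail_quantile_exp)
qed

lemma mono_on_quantile:
  assumes "real_distribution D"
  shows "mono_on {0<..} (\<lambda>l. tail_quantile (cdf D) (exp l))"
proof (rule mono_onI)
  fix r s :: real assume rs: "r \<in> {0<..}" "s \<in> {0<..}" "r \<le> s"
  then have "0 < r" "0 < s" by auto
  have "1 - exp (- r) \<le> 1 - exp (- s)" using rs by simp
  also have "\<dots> \<le> cdf D (tail_quantile (cdf D) (exp s))"
    by (rule quantile_le_iff[OF assms \<open>0 < s\<close>, THEN iffD1]) (rule order_refl)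
  finally show "tail_quantile (cdf D) (exp r) \<le> tail_quantile (cdf D) (exp s)"
    by (rule quantile_le_iff[OF assms \<open>0 < r\<close>, THEN iffD2])
qed

text \<open>For \<open>l > 0\<close> monotonicity suffices. For \<open>l \<le> 0\<close> the level
  \<open>exp l\<close> is at most \<open>1\<close>, every real belongs to the set, and the value is
  the unspecified but fixed \<open>Inf UNIV\<close>; so the function is constant there.\<close>

lemma measurable_quantile:
  assumes "real_distribution D"
  shows "(\<lambda>l. tail_quantile (cdf D) (exp l)) \<in> borel_measurable borel"
proof -
  interpret real_distribution D by fact
  have "cdf D x = 1 \<or> exp l \<le> 1 / (1 - cdf D x)" if "l \<le> 0" for l x
  proof (cases "cdf D x = 1")
    case False
    then have "0 < 1 - cdf D x" "1 - cdf D x \<le> 1"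
      using cdf_bounded_prob[of x] cdf_nonneg[of x] by auto
    then have "1 \<le> 1 / (1 - cdf D x)" by simp
    moreover have "exp l \<le> 1" using that by simp
    ultimately show ?thesis by linarith
  qed simp
  then have *: "tail_quantile (cdf D) (exp l) = Inf UNIV" if "l \<le> 0" for l
    unfolding tail_quantile_def using that by (intro arg_cong[where f=Inf]) auto
  have "(\<lambda>l. tail_quantile (cdf D) (exp l)) \<in> borel_measurable (restrict_space borel {0<..})"
    by (rule borel_measurable_mono_on_fnc[OF mono_on_quantile[OF assms]])
  then have [measurable]: "(\<lambda>l. indicator {0<..} l *\<^sub>R tail_quantile (cdf D) (exp l)) \<in> borel_measurable borel"
    by (subst (asm) borel_measurable_restrict_space_iff) auto
  have "(\<lambda>l. indicator {0<..} l *\<^sub>R tail_quantile (cdf D) (exp l) + indicator {..0} l * Inf UNIV) \<in> borel_measurable borel"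
    by measurable
  also have "(\<lambda>l. indicator {0<..} l *\<^sub>R tail_quantile (cdf D) (exp l) + indicator {..0} l * Inf UNIV)
      = (\<lambda>l. tail_quantile (cdf D) (exp l))"
    using * by (auto simp: fun_eq_iff indicator_def)
  finally show ?thesis .
qed

lemma distr_quantile:
  assumes "real_distribution D"
  shows "distr std_exp borel (\<lambda>l. tail_quantile (cdf D) (exp l)) = D"
proof (rule cdf_unique)
  interpret real_distribution D by fact
  interpret E: prob_space std_exp by (rule prob_space_std_exp)
  note [measurable] = measurable_quantile[OF assms]
  let ?Q = "\<lambda>l. tail_quantile (cdf D) (exp l)"
  show "real_distribution (distr std_exp borel ?Q)"
    by (auto simp: real_distribution_def real_distribution_axioms_def intro!: E.prob_space_distr)
  show "cdf (distr std_exp borel ?Q) = cdf D"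
  proof
    fix x
    have "emeasure (distr std_exp borel ?Q) {..x} = emeasure std_exp {l. ?Q l \<le> x}"
      by (subst emeasure_distr) (auto simp: vimage_def)
    also have "\<dots> = emeasure std_exp {l. 1 - exp (- l) \<le> cdf D x}"
      using quantile_le_iff[OF assms]
      by (intro emeasure_eq_AE eventually_mono[OF AE_std_exp_pos]) auto
    also have "\<dots> = emeasure (distr std_exp borel (\<lambda>t. 1 - exp (- t))) {..cdf D x}"
      by (subst emeasure_distr) (auto simp: vimage_def)
    also have "\<dots> = emeasure lborel ({0..1} \<inter> {..cdf D x})"
      by (simp add: distr_std_exp_uniform emeasure_density flip: indicator_inter_arith)
    also have "{0..1} \<inter> {..cdf D x} = {0..cdf D x}" using cdf_bounded_prob[of x] by auto
    also have "emeasure lborel {0..cdf D x} = ennreal (cdf D x)" by (simp add: cdf_nonneg)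
    finally show "cdf (distr std_exp borel ?Q) x = cdf D x"
      by (simp add: cdf_def[of "distr std_exp borel ?Q"] measure_def cdf_nonneg)
  qed
qed (use assms in auto)

section \<open>Moments of the threshold and of exponential sample means\<close>

text \<open>The mean of \<open>exp (- r * (t - ln (n / k)))\<close> under the threshold law will be
  \<open>gamma_ratio r n / gamma_ratio r k\<close>. The numerator tends to \<open>1\<close>, and for
  \<open>r = - \<rho>\<close> the reciprocal of the denominator is the Gamma factor of the
  bias.\<close>

definition gamma_ratio :: "real \<Rightarrow> nat \<Rightarrow> real" where
  "gamma_ratio r n = real n powr r * Gamma (real n + 1) / Gamma (real n + 1 + r)"

lemma gamma_ratio_pos: "0 < gamma_ratio r n" if "0 \<le> r" "1 \<le> n"
  unfolding gamma_ratio_def using that by (intro divide_pos_pos mult_pos_pos Gamma_real_pos) auto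

text \<open>Euler's limit formula for \<open>Gamma r\<close>, divided by \<open>Gamma r\<close>. The
  pole at \<open>r = 0\<close> is treated directly.\<close>

lemma gamma_ratio_lim:
  assumes "0 \<le> r" shows "gamma_ratio r \<longlonglongrightarrow> 1"
proof (cases "r = 0")
  case True
  have "\<forall>\<^sub>F n in sequentially. gamma_ratio r n = 1"
    using eventually_gt_at_top[of 0]
  proof eventually_elim
    case (elim n)
    have "0 < Gamma (real n + 1)" by (rule Gamma_real_pos) simp
    then have "Gamma (real n + 1) / Gamma (real n + 1) = 1" by (intro divide_self) linarith
    then show ?case using elim True by (simp add: gamma_ratio_def)
  qed
  then show ?thesis by (rule tendsto_eventually)
next
  case False
  then have r: "0 < r" using assms by simp
  have "(\<lambda>n. Gamma_series r n / Gamma r) \<longlonglongrightarrow> Gamma r / Gamma r"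
    using Gamma_real_pos[OF r] by (intro tendsto_divide Gamma_series_LIMSEQ tendsto_const) auto
  moreover have "\<forall>\<^sub>F n in sequentially. Gamma_series r n / Gamma r = gamma_ratio r n"
    using eventually_gt_at_top[of 0]
  proof eventually_elim
    case (elim n)
    have "r \<notin> \<int>\<^sub>\<le>\<^sub>0" using r by (auto dest: nonpos_Ints_nonpos)
    then have p: "pochhammer r (Suc n) = Gamma (real n + 1 + r) / Gamma r"
      using pochhammer_Gamma[of r "Suc n"] by (simp add: add_ac)
    have "fact n = Gamma (real n + 1)"
      using Gamma_fact[of n, where 'a=real] by (simp add: add_ac)
    then show ?case
      using elim Gamma_real_pos[OF r] p by (simp add: Gamma_series_def gamma_ratio_def powr_def mult_ac del: pochhammer_Suc)
  qed
  ultimately show ?thesis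
    using Gamma_real_pos[OF r] by (simp add: tendsto_cong)
qed

text \<open>A positive lower bound for all \<open>n \<ge> 1\<close>, not only in the limit, is
  needed because \<open>gamma_ratio r k\<close> appears as a denominator with \<open>k\<close>
  possibly small.\<close>

lemma gamma_ratio_bounds:
  assumes "0 \<le> r"
  obtains c C where "0 < c" "\<And>n. 1 \<le> n \<Longrightarrow> c \<le> gamma_ratio r n" "\<And>n. 1 \<le> n \<Longrightarrow> gamma_ratio r n \<le> C"
proof -
  have "\<forall>\<^sub>F n in sequentially. 1 / 2 < gamma_ratio r n"
    using gamma_ratio_lim[OF assms] by (rule order_tendstoD) simp
  then obtain n0 where n0: "\<And>n. n0 \<le> n \<Longrightarrow> 1 / 2 < gamma_ratio r n"
    by (auto simp: eventually_sequentially)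
  define c where "c = Min (insert (1 / 2) (gamma_ratio r ` {1..n0}))"
  have "0 < c" unfolding c_def using gamma_ratio_pos[OF assms] by (subst Min_gr_iff) auto
  moreover have "c \<le> gamma_ratio r n" if "1 \<le> n" for n
  proof (cases "n0 \<le> n")
    case True
    have "c \<le> 1 / 2" unfolding c_def by (intro Min_le) auto
    then show ?thesis using n0[OF True] by simp
  next
    case False
    then show ?thesis unfolding c_def using that by (intro Min_le) auto
  qed
  moreover obtain C where "\<And>n. norm (gamma_ratio r n) \<le> C"
    using convergent_imp_Bseq[OF convergentI[OF gamma_ratio_lim[OF assms]]] by (auto simp: Bseq_def)
  then have "gamma_ratio r n \<le> C" if "1 \<le> n" for n
    using abs_ge_self[of "gamma_ratio r n"] by (metis order_trans real_norm_def)
  ultimately show thesis using that by blast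
qed

text \<open>The factor \<open>exp (- p * t)\<close> only shifts the first Beta parameter, so the
  moment is a quotient of two Beta values in which \<open>Gamma (n - k)\<close> cancels. Negative
  \<open>p\<close> gives moments of growing exponentials.\<close>

lemma has_bochner_integral_threshold_exp:
  assumes k: "k < n" and p: "- (real k + 1) < p"
  shows "has_bochner_integral (threshold_law n k) (\<lambda>t. exp (- p * t))
    (Gamma (real k + 1 + p) * Gamma (real n + 1) / (Gamma (real k + 1) * Gamma (real n + 1 + p)))"
    (is "has_bochner_integral _ _ ?I")
proof (rule has_bochner_integral_nn_integral)
  let ?b = "Beta (real k + 1) (real n - real k)"
  have b: "0 < ?b" by (rule Beta_pos[OF k])
  have G: "0 < Gamma (real n - real k)" "0 < Gamma (real k + 1)" "0 < Gamma (real n + 1)"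
    "0 < Gamma (real k + 1 + p)" "0 < Gamma (real n + 1 + p)"
    using k p by (auto intro!: Gamma_real_pos)
  show "0 \<le> ?I" using G by simp
  have "(\<integral>\<^sup>+t. ennreal (exp (- p * t)) \<partial>threshold_law n k)
      = (\<integral>\<^sup>+t. ennreal (exp (- real k * t) * (1 - exp (- t)) ^ (n - 1 - k) / ?b) * ennreal (exp (- p * t)) \<partial>std_exp)"
    unfolding threshold_law_def by (subst nn_integral_density) auto
  also have "\<dots> = (\<integral>\<^sup>+t. ennreal (exp (- (real k + p) * t) * (1 - exp (- t)) ^ (n - 1 - k)) * ennreal (1 / ?b) \<partial>std_exp)"
  proof (intro nn_integral_cong_AE eventually_mono[OF AE_std_exp_pos])
    fix t :: real assume t: "0 < t"
    have "exp (- (real k + p) * t) = exp (- real k * t) * exp (- p * t)"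
      by (simp add: exp_add[symmetric] algebra_simps)
    then show "ennreal (exp (- real k * t) * (1 - exp (- t)) ^ (n - 1 - k) / ?b) * ennreal (exp (- p * t))
      = ennreal (exp (- (real k + p) * t) * (1 - exp (- t)) ^ (n - 1 - k)) * ennreal (1 / ?b)"
      using t b by (simp add: ennreal_mult[symmetric] mult_ac)
  qed
  also have "\<dots> = ennreal (Beta (real k + p + 1) (real (n - 1 - k) + 1)) * ennreal (1 / ?b)"
    using nn_integral_std_exp_Beta[of "real k + p" "n - 1 - k"] p by (subst nn_integral_multc) auto
  also have "\<dots> = ennreal (Beta (real k + 1 + p) (real n - real k) / ?b)"
  proof -
    have "0 < Beta (real k + 1 + p) (real n - real k)"
      unfolding Beta_def using k p by (intro divide_pos_pos mult_pos_pos Gamma_real_pos) auto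
    then show ?thesis
      using b k by (simp add: ennreal_mult[symmetric] of_nat_diff add_ac)
  qed
  also have "Beta (real k + 1 + p) (real n - real k) / ?b = ?I"
    using G unfolding Beta_def by (simp add: add_ac)
  finally show "(\<integral>\<^sup>+t. ennreal (exp (- p * t)) \<partial>threshold_law n k) = ennreal ?I" .
qed auto

lemma has_bochner_integral_threshold_centred:
  assumes k: "1 \<le> k" "k < n" and r: "0 \<le> r"
  shows "has_bochner_integral (threshold_law n k) (\<lambda>t. exp (- r * (t - ln (real n / real k))))
    (gamma_ratio r n / gamma_ratio r k)"
proof -
  have "has_bochner_integral (threshold_law n k) (\<lambda>t. (real n / real k) powr r * exp (- r * t))
     ((real n / real k) powr r * (Gamma (real k + 1 + r) * Gamma (real n + 1) / (Gamma (real k + 1) * Gamma (real n + 1 + r))))"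
    using k r by (intro has_bochner_integral_mult_right has_bochner_integral_threshold_exp) auto
  moreover have "(real n / real k) powr r * exp (- r * t) = exp (- r * (t - ln (real n / real k)))" for t
    using k by (simp add: powr_def exp_add[symmetric] algebra_simps)
  moreover have "(real n / real k) powr r * (Gamma (real k + 1 + r) * Gamma (real n + 1) / (Gamma (real k + 1) * Gamma (real n + 1 + r)))
      = gamma_ratio r n / gamma_ratio r k"
    using k by (simp add: gamma_ratio_def powr_divide mult_ac)
  ultimately show ?thesis by simp
qed

text \<open>The case \<open>p = - 1\<close>: the mean of \<open>exp t\<close> is exactly
  \<open>n / k\<close>, so the upper tail of the threshold around the centre
  \<open>ln (n / k)\<close> is controlled uniformly in \<open>n\<close> and
  \<open>k\<close>.\<close>

lemma has_bochner_integral_threshold_exp_pos: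
  assumes k: "1 \<le> k" "k < n"
  shows "has_bochner_integral (threshold_law n k) (\<lambda>t. exp (t - ln (real n / real k))) 1"
proof -
  have "has_bochner_integral (threshold_law n k) (\<lambda>t. real k / real n * exp (- (-1) * t))
     (real k / real n * (Gamma (real k + 1 + (-1)) * Gamma (real n + 1) / (Gamma (real k + 1) * Gamma (real n + 1 + (-1)))))"
    using k by (intro has_bochner_integral_mult_right has_bochner_integral_threshold_exp) auto
  moreover have "real k / real n * exp (- (-1) * t) = exp (t - ln (real n / real k))" for t
    using k by (simp add: exp_diff)
  moreover have "real k / real n * (Gamma (real k + 1 + (-1)) * Gamma (real n + 1) / (Gamma (real k + 1) * Gamma (real n + 1 + (-1)))) = 1"
  proof -
    have "Gamma (real k + 1) = real k * Gamma (real k)" "Gamma (real n + 1) = real n * Gamma (real n)"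
      using k by (auto intro!: Gamma_plus1 dest: nonpos_Ints_nonpos)
    moreover have "Gamma (real k) \<noteq> 0" "Gamma (real n) \<noteq> 0"
      using Gamma_real_pos[of "real k"] Gamma_real_pos[of "real n"] k by (metis less_irrefl of_nat_0_less_iff less_le_trans zero_less_one less_trans)+
    ultimately show ?thesis using k by simp
  qed
  ultimately show ?thesis by (simp only:)
qed

text \<open>With \<open>x = t - ln (n / k)\<close>, the integrand is at most \<open>exp x\<close>
  for \<open>x \<ge> 0\<close> and at most \<open>exp (- (r + 1) * x)\<close> for
  \<open>x < 0\<close>. Both have means bounded uniformly in \<open>n\<close> and
  \<open>k\<close>.\<close>

lemma threshold_moment_bound:
  assumes r: "0 \<le> r"
  obtains C where "0 \<le> C" "\<And>n k. 1 \<le> k \<Longrightarrow> k < n \<Longrightarrow>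
    integrable (threshold_law n k) (\<lambda>t. exp (- r * (t - ln (real n / real k))) * exp (\<bar>t - ln (real n / real k)\<bar> / 2)) \<and>
    (\<integral>t. exp (- r * (t - ln (real n / real k))) * exp (\<bar>t - ln (real n / real k)\<bar> / 2) \<partial>threshold_law n k) \<le> C"
proof -
  have r1: "0 \<le> r + 1" using r by simp
  obtain c C where c: "0 < c" "\<And>n. 1 \<le> n \<Longrightarrow> c \<le> gamma_ratio (r + 1) n" "\<And>n. 1 \<le> n \<Longrightarrow> gamma_ratio (r + 1) n \<le> C"
    using gamma_ratio_bounds[OF r1] by metis
  have "0 \<le> C" using c(1) c(2)[of 1] c(3)[of 1] by simp
  show thesis
  proof (rule that[of "1 + C / c"])
    show "0 \<le> 1 + C / c" using c \<open>0 \<le> C\<close> by simp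
    fix n k :: nat assume k: "1 \<le> k" "k < n"
    let ?s = "ln (real n / real k)"
    have hb: "has_bochner_integral (threshold_law n k) (\<lambda>t. exp (t - ?s) + exp (- (r + 1) * (t - ?s)))
        (1 + gamma_ratio (r + 1) n / gamma_ratio (r + 1) k)"
      using r1 k by (intro has_bochner_integral_add has_bochner_integral_threshold_exp_pos has_bochner_integral_threshold_centred)
    have le: "exp (- r * (t - ?s)) * exp (\<bar>t - ?s\<bar> / 2) \<le> exp (t - ?s) + exp (- (r + 1) * (t - ?s))" for t
    proof (cases "0 \<le> t - ?s")
      case True
      have "- r * (t - ?s) \<le> 0" using True r by (simp add: mult_nonpos_nonneg)
      moreover have "a + \<bar>x\<bar> / 2 \<le> x" if "a \<le> 0" "0 \<le> x" for a x :: real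
        using that by simp
      ultimately have "- r * (t - ?s) + \<bar>t - ?s\<bar> / 2 \<le> t - ?s" using True by blast
      then have "exp (- r * (t - ?s)) * exp (\<bar>t - ?s\<bar> / 2) \<le> exp (t - ?s)"
        unfolding exp_add[symmetric] by (simp only: exp_le_cancel_iff)
      then show ?thesis by (rule add_increasing2[rotated]) simp
    next
      case False
      have "- r * x + \<bar>x\<bar> / 2 \<le> - (r + 1) * x" if "x < 0" for x :: real
        using that by (simp add: algebra_simps)
      then have "exp (- r * (t - ?s)) * exp (\<bar>t - ?s\<bar> / 2) \<le> exp (- (r + 1) * (t - ?s))"
        using False unfolding exp_add[symmetric] exp_le_cancel_iff by (simp only: not_le)
      then show ?thesis by (rule add_increasing[rotated]) simp
    qed
    show "integrable (threshold_law n k) (\<lambda>t. exp (- r * (t - ?s)) * exp (\<bar>t - ?s\<bar> / 2)) \<and>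
       (\<integral>t. exp (- r * (t - ?s)) * exp (\<bar>t - ?s\<bar> / 2) \<partial>threshold_law n k) \<le> 1 + C / c"
    proof
      have i: "integrable (threshold_law n k) (\<lambda>t. exp (t - ?s) + exp (- (r + 1) * (t - ?s)))"
        using hb by (simp add: has_bochner_integral_iff)
      show int: "integrable (threshold_law n k) (\<lambda>t. exp (- r * (t - ?s)) * exp (\<bar>t - ?s\<bar> / 2))"
        by (rule Bochner_Integration.integrable_bound[OF i]) (use le in \<open>auto intro!: AE_I2 order_trans[OF le]\<close>)
      have "(\<integral>t. exp (- r * (t - ?s)) * exp (\<bar>t - ?s\<bar> / 2) \<partial>threshold_law n k)
          \<le> (\<integral>t. exp (t - ?s) + exp (- (r + 1) * (t - ?s)) \<partial>threshold_law n k)"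
        by (intro integral_mono int i le)
      also have "\<dots> = 1 + gamma_ratio (r + 1) n / gamma_ratio (r + 1) k"
        by (rule has_bochner_integral_integral_eq[OF hb])
      also have "gamma_ratio (r + 1) n / gamma_ratio (r + 1) k \<le> C / c"
        using k c by (intro frac_le) (auto intro: order_trans \<open>0 \<le> C\<close> less_imp_le[OF gamma_ratio_pos[OF r1]])
      finally show "(\<integral>t. exp (- r * (t - ?s)) * exp (\<bar>t - ?s\<bar> / 2) \<partial>threshold_law n k) \<le> 1 + C / c" by simp
    qed
  qed
qed

lemma threshold_variance:
  assumes r: "0 \<le> r" and k: "1 \<le> k" "k < n"
  defines "m \<equiv> gamma_ratio r n / gamma_ratio r k"
  shows "has_bochner_integral (threshold_law n k) (\<lambda>t. (exp (- r * (t - ln (real n / real k))) - m)\<^sup>2)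
     (gamma_ratio (2 * r) n / gamma_ratio (2 * r) k - m\<^sup>2)"
proof -
  interpret prob_space "threshold_law n k" using k by (intro prob_space_threshold_law) auto
  let ?s = "ln (real n / real k)"
  have "has_bochner_integral (threshold_law n k) (\<lambda>t. exp (- (2 * r) * (t - ?s)) - 2 * m * exp (- r * (t - ?s)) + m\<^sup>2)
     (gamma_ratio (2 * r) n / gamma_ratio (2 * r) k - 2 * m * (gamma_ratio r n / gamma_ratio r k) + m\<^sup>2)"
    using r k
    by (intro has_bochner_integral_add has_bochner_integral_diff has_bochner_integral_mult_right
          has_bochner_integral_threshold_centred has_bochner_integral_const_prob) auto
  moreover have "exp (- (2 * r) * (t - ?s)) - 2 * m * exp (- r * (t - ?s)) + m\<^sup>2 = (exp (- r * (t - ?s)) - m)\<^sup>2" for t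
    by (simp add: power2_diff exp_double[symmetric] algebra_simps flip: exp_of_nat_mult)
  moreover have "gamma_ratio (2 * r) n / gamma_ratio (2 * r) k - 2 * m * (gamma_ratio r n / gamma_ratio r k) + m\<^sup>2
     = gamma_ratio (2 * r) n / gamma_ratio (2 * r) k - m\<^sup>2"
    by (simp add: m_def power2_eq_square)
  ultimately show ?thesis by (simp only:)
qed

text \<open>Chernoff's bound with an exponent \<open>p\<close> near \<open>\<theta> * n\<close>. For
  integer \<open>p\<close> the mean of \<open>exp (- p * t)\<close> is a product of \<open>p\<close>
  quotients \<open>(k + 1 + i) / (n + 1 + i)\<close>, each at most \<open>3 * \<theta>\<close>
  because \<open>k + 1 + i \<le> k + p \<le> 3 * \<theta> * n\<close>. The choice of
  \<open>\<theta>\<close> makes \<open>3 * \<theta> = exp (- 1 - s0)\<close>, which cancels the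
  factor \<open>exp (p * s0)\<close> and leaves \<open>exp (- p)\<close>.\<close>

lemma threshold_lower_tail:
  fixes s0 :: real
  defines "\<theta> \<equiv> exp (- 1 - s0) / 3"
  assumes k: "1 \<le> k" "k < n" and kn: "real k \<le> \<theta> * real n" and n: "1 \<le> \<theta> * real n"
  shows "measure (threshold_law n k) {..<s0} \<le> exp (- \<theta> * real n)"
proof -
  interpret prob_space "threshold_law n k" using k by (intro prob_space_threshold_law) auto
  define p where "p = nat \<lceil>\<theta> * real n\<rceil>"
  have p: "\<theta> * real n \<le> real p" "real p \<le> \<theta> * real n + 1" "1 \<le> p"
    using n unfolding p_def by linarith+
  let ?I = "Gamma (real k + 1 + real p) * Gamma (real n + 1) / (Gamma (real k + 1) * Gamma (real n + 1 + real p))"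
  have hb: "has_bochner_integral (threshold_law n k) (\<lambda>t. exp (- real p * t)) ?I"
    using k by (intro has_bochner_integral_threshold_exp) auto
  have "?I = pochhammer (real k + 1) p / pochhammer (real n + 1) p"
  proof -
    have nz: "real k + 1 \<notin> \<int>\<^sub>\<le>\<^sub>0" "real n + 1 \<notin> \<int>\<^sub>\<le>\<^sub>0" by (auto dest: nonpos_Ints_nonpos)
    show ?thesis using pochhammer_Gamma[OF nz(1), of p] pochhammer_Gamma[OF nz(2), of p] by simp
  qed
  also have "\<dots> = (\<Prod>i<p. (real k + 1 + real i) / (real n + 1 + real i))"
    by (simp add: pochhammer_prod prod_dividef lessThan_atLeast0)
  also have "\<dots> \<le> (\<Prod>i<p. 3 * \<theta>)"
  proof (rule prod_mono, rule conjI)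
    fix i assume "i \<in> {..<p}"
    then have "real i + 1 \<le> real p" by auto
    then have "real k + 1 + real i \<le> 3 * \<theta> * real n"
      using p kn n by linarith
    also have "\<dots> \<le> 3 * \<theta> * (real n + 1 + real i)" by (intro mult_left_mono) (auto simp: \<theta>_def)
    finally show "(real k + 1 + real i) / (real n + 1 + real i) \<le> 3 * \<theta>" by (simp add: divide_le_eq)
  qed auto
  also have "\<dots> = exp (- 1 - s0) ^ p" by (simp add: \<theta>_def)
  finally have I: "?I \<le> exp (- 1 - s0) ^ p" .
  have "measure (threshold_law n k) {..<s0} = (\<integral>t. indicator {..<s0} t \<partial>threshold_law n k)" by simp
  also have "\<dots> \<le> (\<integral>t. exp (real p * s0) * exp (- real p * t) \<partial>threshold_law n k)"
  proof (rule integral_mono)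
    show "integrable (threshold_law n k) (\<lambda>t. exp (real p * s0) * exp (- real p * t))"
      using hb by (intro integrable_mult_right) (simp add: has_bochner_integral_iff)
    fix t
    show "indicator {..<s0} t \<le> exp (real p * s0) * exp (- real p * t)"
    proof (cases "t < s0")
      case True
      then have "0 \<le> real p * s0 + - real p * t"
        using mult_left_mono[of t s0 "real p"] by simp
      then show ?thesis unfolding exp_add[symmetric] by (simp add: indicator_def)
    qed (simp add: indicator_def)
  qed (auto intro!: integrable_const_bound[where B=1])
  also have "\<dots> = exp (real p * s0) * ?I"
    using has_bochner_integral_integral_eq[OF hb] by simp
  also have "\<dots> \<le> exp (real p * s0) * exp (- 1 - s0) ^ p" using I by (intro mult_left_mono) auto
  also have "\<dots> = exp (- real p)"
    by (simp add: exp_of_nat_mult[symmetric] exp_add[symmetric] algebra_simps)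
  also have "\<dots> \<le> exp (- \<theta> * real n)" using p by simp
  finally show ?thesis .
qed

section \<open>Means of exponential samples: moments and characteristic function\<close>

lemma distributed_std_exp: "distributed std_exp lborel (\<lambda>x. x) (exponential_density 1)"
  by (auto simp: distributed_def distr_id2 sets_eq_imp_space_eq intro!: exponential_density_nonneg)

lemma std_exp_moment: "has_bochner_integral std_exp (\<lambda>x. x ^ i) (fact i)"
proof -
  interpret prob_space std_exp by (rule prob_space_std_exp)
  show ?thesis
    using has_bochner_integral_erlang_ith_moment[OF _ distributed_std_exp, of i] by simp
qed

lemma std_exp_exp:
  assumes "a < 1" shows "has_bochner_integral std_exp (\<lambda>x. exp (a * x)) (1 / (1 - a))"
proof (rule has_bochner_integral_nn_integral)
  have "Beta (1 - a) 1 = 1 / (1 - a)"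
  proof -
    have "Gamma (1 - a + 1) = (1 - a) * Gamma (1 - a)"
      using assms by (intro Gamma_plus1) (auto dest: nonpos_Ints_nonpos)
    moreover have "0 < Gamma (1 - a)" using assms by (intro Gamma_real_pos) simp
    ultimately show ?thesis by (simp add: Beta_def)
  qed
  then show "(\<integral>\<^sup>+x. ennreal (exp (a * x)) \<partial>std_exp) = ennreal (1 / (1 - a))"
    using nn_integral_std_exp_Beta[of "- a" 0] assms by simp
qed (use assms in auto)

lemma std_exp_limit_shape:
  assumes "\<rho> \<le> 0" shows "has_bochner_integral std_exp (limit_shape \<rho>) (1 / (1 - \<rho>))"
proof (cases "\<rho> = 0")
  case True
  then show ?thesis using std_exp_moment[of 1] by (simp add: limit_shape_def[abs_def])
next
  case False
  interpret prob_space std_exp by (rule prob_space_std_exp)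
  have "has_bochner_integral std_exp (\<lambda>_. 1) (1::real)"
    by (rule has_bochner_integral_const_prob)
  then have "has_bochner_integral std_exp (\<lambda>y. (exp (\<rho> * y) - 1) / \<rho>) ((1 / (1 - \<rho>) - 1) / \<rho>)"
    using assms by (intro has_bochner_integral_divide has_bochner_integral_diff std_exp_exp) auto
  also have "(1 / (1 - \<rho>) - 1) / \<rho> = 1 / (1 - \<rho>)"
    using False assms by (simp add: field_simps)
  finally show ?thesis using False by (simp add: limit_shape_def[abs_def])
qed

lemma std_exp_limit_shape_sq:
  assumes "\<rho> \<le> 0"
  shows "integrable std_exp (\<lambda>y. (limit_shape \<rho> y)\<^sup>2)" "(\<integral>y. (limit_shape \<rho> y)\<^sup>2 \<partial>std_exp) \<le> 2"
proof -
  have i: "integrable std_exp (\<lambda>y. y\<^sup>2)" "(\<integral>y. y\<^sup>2 \<partial>std_exp) = 2"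
    using std_exp_moment[of 2] by (auto simp: has_bochner_integral_iff fact_numeral)
  have le: "AE y in std_exp. (limit_shape \<rho> y)\<^sup>2 \<le> y\<^sup>2"
    using AE_std_exp_pos
    by eventually_elim (auto intro!: power_mono limit_shape_le limit_shape_nonneg assms)
  show 1: "integrable std_exp (\<lambda>y. (limit_shape \<rho> y)\<^sup>2)"
    by (rule Bochner_Integration.integrable_bound[OF i(1)]) (use le in auto)
  show "(\<integral>y. (limit_shape \<rho> y)\<^sup>2 \<partial>std_exp) \<le> 2"
    using integral_mono_AE[OF 1 i(1) le] i(2) by simp
qed

lemma PiM_component_integral:
  assumes "i \<in> I" and [measurable]: "f \<in> borel_measurable borel"
  shows "(\<integral>e. f (e i) \<partial>std_exps I) = (\<integral>y. f y \<partial>std_exp :: real)"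
    and "integrable (std_exps I) (\<lambda>e. f (e i)) \<longleftrightarrow> integrable std_exp f"
proof -
  have d: "distr (std_exps I) std_exp (\<lambda>e. e i) = std_exp"
    using assms by (intro distr_PiM_component prob_space_std_exp)
  have [measurable]: "(\<lambda>e. e i) \<in> measurable (std_exps I) std_exp"
    using assms by (intro measurable_component_singleton)
  show "(\<integral>e. f (e i) \<partial>std_exps I) = (\<integral>y. f y \<partial>std_exp)"
  proof -
    have "(\<integral>y. f y \<partial>std_exp) = (\<integral>y. f y \<partial>distr (std_exps I) std_exp (\<lambda>e. e i))"
      by (simp only: d)
    also have "\<dots> = (\<integral>e. f (e i) \<partial>std_exps I)" by (rule integral_distr) measurable
    finally show ?thesis ..
  qed
  show "integrable (std_exps I) (\<lambda>e. f (e i)) \<longleftrightarrow> integrable std_exp f"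
  proof -
    have "integrable std_exp f \<longleftrightarrow> integrable (distr (std_exps I) std_exp (\<lambda>e. e i)) f"
      by (simp only: d)
    also have "\<dots> \<longleftrightarrow> integrable (std_exps I) (\<lambda>e. f (e i))" by (rule integrable_distr_eq) measurable
    finally show ?thesis ..
  qed
qed

lemma PiM_std_exp_indep:
  assumes "I \<noteq> {}"
  shows "prob_space.indep_vars (std_exps I) (\<lambda>_. borel) (\<lambda>i e. e i) I"
proof -
  interpret prob_space "std_exps I" by (rule prob_space_PiM_std_exp)
  have [measurable]: "(\<lambda>e. e i) \<in> borel_measurable (std_exps I)" if "i \<in> I" for i
    using that by measurable
  have c: "distr (std_exps I) borel (\<lambda>e. e i) = std_exp" if "i \<in> I" for i
  proof -
    have "distr (std_exps I) borel (\<lambda>e. e i) = distr (std_exps I) std_exp (\<lambda>e. e i)"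
      by (rule distr_cong) auto
    also have "\<dots> = std_exp" using that by (intro distr_PiM_component prob_space_std_exp)
    finally show ?thesis .
  qed
  have "distr (std_exps I) (Pi\<^sub>M I (\<lambda>_. borel)) (\<lambda>e. \<lambda>i\<in>I. e i)
      = distr (std_exps I) (std_exps I) (\<lambda>e. e)"
    by (rule distr_cong) (auto simp: sets_PiM_std_exp space_PiM PiE_restrict)
  also have "\<dots> = std_exps I" by (rule distr_id)
  also have "\<dots> = Pi\<^sub>M I (\<lambda>i. distr (std_exps I) borel (\<lambda>e. e i))"
    by (intro PiM_cong refl) (simp add: c)
  finally show ?thesis
    using assms by (subst indep_vars_iff_distr_eq_PiM') auto
qed

lemma sample_mean_variance:
  fixes f :: "real \<Rightarrow> real"
  assumes f [measurable]: "f \<in> borel_measurable borel" and k: "1 \<le> k"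
    and f2: "integrable std_exp (\<lambda>y. (f y)\<^sup>2)"
  defines "m \<equiv> \<integral>y. f y \<partial>std_exp"
  shows "has_bochner_integral (std_exps {1..k}) (\<lambda>e. (1 / real k * (\<Sum>i=1..k. f (e i)) - m)\<^sup>2)
    ((\<integral>y. (f y - m)\<^sup>2 \<partial>std_exp) / real k)"
proof -
  interpret E: prob_space std_exp by (rule prob_space_std_exp)
  let ?P = "std_exps {1..k}"
  interpret prob_space ?P by (rule prob_space_PiM_std_exp)
  have f1: "integrable std_exp f"
  proof (rule E.square_integrable_imp_integrable)
    show "f \<in> borel_measurable std_exp" by measurable
    show "integrable std_exp (\<lambda>y. (f y)\<^sup>2)" by (rule f2)
  qed
  define h where "h y = f y - m" for y
  have h [measurable]: "h \<in> borel_measurable borel" unfolding h_def by measurable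
  have h1: "integrable std_exp h" "(\<integral>y. h y \<partial>std_exp) = 0"
  proof -
    show "integrable std_exp h"
      unfolding h_def by (intro Bochner_Integration.integrable_diff f1 E.integrable_const)
    have "(\<integral>y. h y \<partial>std_exp) = (\<integral>y. f y \<partial>std_exp) - (\<integral>y. m \<partial>std_exp)"
      unfolding h_def by (intro Bochner_Integration.integral_diff f1 E.integrable_const)
    also have "(\<integral>y. m \<partial>std_exp) = m"
      using E.prob_space by simp
    finally show "(\<integral>y. h y \<partial>std_exp) = 0" unfolding m_def by simp
  qed
  have h2: "integrable std_exp (\<lambda>y. (h y)\<^sup>2)"
  proof -
    have "integrable std_exp (\<lambda>y. (f y)\<^sup>2 - 2 * m * f y + m\<^sup>2)"
      by (intro Bochner_Integration.integrable_add Bochner_Integration.integrable_diff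
          integrable_mult_right f1 f2 E.integrable_const)
    also have "(\<lambda>y. (f y)\<^sup>2 - 2 * m * f y + m\<^sup>2) = (\<lambda>y. (h y)\<^sup>2)"
      by (simp add: h_def power2_diff algebra_simps)
    finally show ?thesis .
  qed
  have hb: "has_bochner_integral ?P (\<lambda>e. h (e i) * h (e j)) (if i = j then \<integral>y. (h y)\<^sup>2 \<partial>std_exp else 0)"
    if ij: "i \<in> {1..k}" "j \<in> {1..k}" for i j
  proof (cases "i = j")
    case True
    have "(\<lambda>y. (h y)\<^sup>2) \<in> borel_measurable borel" by measurable
    from PiM_component_integral[OF ij(1) this] show ?thesis
      using True h2 by (simp add: has_bochner_integral_iff power2_eq_square)
  next
    case False
    have ind: "indep_vars (\<lambda>_. borel) (\<lambda>l e. h (e l)) {i, j}"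
    proof (rule indep_vars_compose2[where X="\<lambda>l e. e l" and Y="\<lambda>_. h"])
      show "indep_vars (\<lambda>_. borel) (\<lambda>l e. e l) {i, j}"
        by (rule indep_vars_subset[OF PiM_std_exp_indep]) (use k ij in auto)
    qed measurable
    have int: "integrable ?P (\<lambda>e. h (e l))" "(\<integral>e. h (e l) \<partial>?P) = 0" if "l \<in> {i, j}" for l
    proof -
      have l: "l \<in> {1..k}" using that ij by auto
      show "integrable ?P (\<lambda>e. h (e l))" "(\<integral>e. h (e l) \<partial>?P) = 0"
        using PiM_component_integral[OF l h] h1 by auto
    qed
    have "(\<integral>e. (\<Prod>l\<in>{i, j}. h (e l)) \<partial>?P) = (\<Prod>l\<in>{i, j}. \<integral>e. h (e l) \<partial>?P)"
      by (rule indep_vars_lebesgue_integral[OF _ ind]) (use int in auto)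
    moreover have "integrable ?P (\<lambda>e. \<Prod>l\<in>{i, j}. h (e l))"
      by (rule indep_vars_integrable[OF _ ind]) (use int in auto)
    ultimately show ?thesis using False int by (simp add: has_bochner_integral_iff)
  qed
  have "has_bochner_integral ?P (\<lambda>e. \<Sum>i\<in>{1..k}. \<Sum>j\<in>{1..k}. h (e i) * h (e j))
      (\<Sum>i\<in>{1..k}. \<Sum>j\<in>{1..k}. if i = j then \<integral>y. (h y)\<^sup>2 \<partial>std_exp else 0)"
    by (intro has_bochner_integral_sum hb)
  then have "has_bochner_integral ?P (\<lambda>e. (1 / real k)\<^sup>2 * (\<Sum>i\<in>{1..k}. \<Sum>j\<in>{1..k}. h (e i) * h (e j)))
      ((1 / real k)\<^sup>2 * (\<Sum>i\<in>{1..k}. \<Sum>j\<in>{1..k}. if i = j then \<integral>y. (h y)\<^sup>2 \<partial>std_exp else 0))"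
    by (rule has_bochner_integral_mult_right)
  also have "(1 / real k)\<^sup>2 * (\<Sum>i\<in>{1..k}. \<Sum>j\<in>{1..k}. if i = j then \<integral>y. (h y)\<^sup>2 \<partial>std_exp else 0)
      = (\<integral>y. (h y)\<^sup>2 \<partial>std_exp) / real k"
    using k by (simp add: sum.delta power2_eq_square)
  also have "(\<lambda>e. (1 / real k)\<^sup>2 * (\<Sum>i\<in>{1..k}. \<Sum>j\<in>{1..k}. h (e i) * h (e j)))
      = (\<lambda>e. (1 / real k * (\<Sum>i=1..k. f (e i)) - m)\<^sup>2)"
  proof
    fix e :: "nat \<Rightarrow> real"
    have "(\<Sum>i\<in>{1..k}. \<Sum>j\<in>{1..k}. h (e i) * h (e j)) = (\<Sum>i\<in>{1..k}. h (e i))\<^sup>2"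
      by (simp only: power2_eq_square sum_product)
    also have "(1 / real k)\<^sup>2 * (\<Sum>i\<in>{1..k}. h (e i))\<^sup>2 = (1 / real k * (\<Sum>i\<in>{1..k}. h (e i)))\<^sup>2"
      by (simp only: power_mult_distrib)
    also have "1 / real k * (\<Sum>i\<in>{1..k}. h (e i)) = 1 / real k * (\<Sum>i=1..k. f (e i)) - m"
    proof -
      have "(\<Sum>i\<in>{1..k}. h (e i)) = (\<Sum>i=1..k. f (e i)) - real k * m"
        by (simp add: h_def sum_subtractf)
      then show ?thesis using k by (simp add: right_diff_distrib)
    qed
    finally show "(1 / real k)\<^sup>2 * (\<Sum>i\<in>{1..k}. \<Sum>j\<in>{1..k}. h (e i) * h (e j))
        = (1 / real k * (\<Sum>i=1..k. f (e i)) - m)\<^sup>2" .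
  qed
  finally show ?thesis by (simp only: h_def)
qed

lemma sample_mean_expectation:
  fixes f :: "real \<Rightarrow> real"
  assumes f [measurable]: "f \<in> borel_measurable borel" and k: "1 \<le> k"
    and f1: "has_bochner_integral std_exp f m"
  shows "has_bochner_integral (std_exps {1..k}) (\<lambda>e. 1 / real k * (\<Sum>i=1..k. f (e i))) m"
proof -
  have "has_bochner_integral (std_exps {1..k}) (\<lambda>e. f (e i)) m" if "i \<in> {1..k}" for i
    using PiM_component_integral[OF that f] f1 by (simp add: has_bochner_integral_iff)
  then have "has_bochner_integral (std_exps {1..k}) (\<lambda>e. 1 / real k * (\<Sum>i=1..k. f (e i))) (1 / real k * (\<Sum>i=1..k. m))"
    by (intro has_bochner_integral_mult_right has_bochner_integral_sum)
  then show ?thesis using k by simp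
qed

text \<open>Third-order Taylor expansion. The third absolute moment of \<open>y - 1\<close> is at
  most the mean of \<open>(y + 1) ^ 3\<close>, that is \<open>6 + 6 + 3 + 1 = 16\<close>, so the
  Taylor error is at most \<open>16 / 6 * \<bar>u\<bar> ^ 3\<close>. For
  \<open>\<bar>u\<bar> \<le> 1\<close>, passing from \<open>1 - u^2 / 2\<close> to the Gaussian
  costs at most \<open>1 / 8 * \<bar>u\<bar> ^ 3\<close>, and \<open>8 / 3 + 1 / 8 \<le> 3\<close>.
  For \<open>\<bar>u\<bar> > 1\<close> the trivial bound \<open>2\<close> is below
  \<open>3\<close>.\<close>

lemma char_centred_exp:
  "cmod (char (distr std_exp borel (\<lambda>y. y - 1)) u - complex_of_real (exp (- (u\<^sup>2) / 2))) \<le> 3 * \<bar>u\<bar> ^ 3"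
proof -
  interpret prob_space std_exp by (rule prob_space_std_exp)
  let ?\<mu> = "distr std_exp borel (\<lambda>y. y - 1)"
  interpret \<mu>: real_distribution ?\<mu> by (intro real_distribution_distr) measurable
  have one: "has_bochner_integral std_exp (\<lambda>_. 1) (1::real)"
    by (rule has_bochner_integral_const_prob)
  have m1: "has_bochner_integral std_exp (\<lambda>y. y - 1) (1 - 1)"
    using std_exp_moment[of 1] one by (intro has_bochner_integral_diff) auto
  have "has_bochner_integral std_exp (\<lambda>y. y ^ 2 - 2 * y ^ 1 + 1) (fact 2 - 2 * fact 1 + 1)"
    by (intro has_bochner_integral_add has_bochner_integral_diff has_bochner_integral_mult_right std_exp_moment one)
  moreover have "y ^ 2 - 2 * y ^ 1 + 1 = (y - 1)\<^sup>2" for y :: real by (simp add: power2_diff)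
  ultimately have m2: "has_bochner_integral std_exp (\<lambda>y. (y - 1)\<^sup>2) 1" by (simp add: fact_numeral)
  have m3: "has_bochner_integral std_exp (\<lambda>y. y ^ 3 + 3 * y ^ 2 + 3 * y ^ 1 + 1) (fact 3 + 3 * fact 2 + 3 * fact 1 + 1)"
    by (intro has_bochner_integral_add has_bochner_integral_mult_right std_exp_moment one)
  have "cmod (char ?\<mu> u - (1 - u\<^sup>2 * 1 / 2)) \<le> (u\<^sup>2 / 6) * expectation (\<lambda>y. min (6 * (y - 1)\<^sup>2) (\<bar>u\<bar> * \<bar>y - 1\<bar> ^ 3))"
    using m1 m2 by (intro char_approx3') (auto simp: has_bochner_integral_iff)
  also have "\<dots> \<le> (u\<^sup>2 / 6) * (\<bar>u\<bar> * 16)"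
  proof (rule mult_left_mono)
    have "expectation (\<lambda>y. min (6 * (y - 1)\<^sup>2) (\<bar>u\<bar> * \<bar>y - 1\<bar> ^ 3)) \<le> expectation (\<lambda>y. \<bar>u\<bar> * (y ^ 3 + 3 * y ^ 2 + 3 * y ^ 1 + 1))"
    proof (rule integral_mono_AE)
      show "integrable std_exp (\<lambda>y. min (6 * (y - 1)\<^sup>2) (\<bar>u\<bar> * \<bar>y - 1\<bar> ^ 3))"
      proof (rule Bochner_Integration.integrable_bound[where f="\<lambda>y. 6 * (y - 1)\<^sup>2"])
        show "integrable std_exp (\<lambda>y. 6 * (y - 1)\<^sup>2)" using m2 by (simp add: has_bochner_integral_iff)
      qed (auto simp: min_def)
      show "integrable std_exp (\<lambda>y. \<bar>u\<bar> * (y ^ 3 + 3 * y ^ 2 + 3 * y ^ 1 + 1))"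
        using m3 by (intro integrable_mult_right) (simp only: has_bochner_integral_iff)
      show "AE y in std_exp. min (6 * (y - 1)\<^sup>2) (\<bar>u\<bar> * \<bar>y - 1\<bar> ^ 3) \<le> \<bar>u\<bar> * (y ^ 3 + 3 * y ^ 2 + 3 * y ^ 1 + 1)"
        using AE_std_exp_pos
      proof eventually_elim
        case (elim y)
        have "\<bar>y - 1\<bar> ^ 3 \<le> (y + 1) ^ 3" using elim by (intro power_mono) auto
        also have "\<dots> = y ^ 3 + 3 * y ^ 2 + 3 * y ^ 1 + 1" by (simp add: power3_eq_cube power2_eq_square algebra_simps)
        finally have "\<bar>u\<bar> * \<bar>y - 1\<bar> ^ 3 \<le> \<bar>u\<bar> * (y ^ 3 + 3 * y ^ 2 + 3 * y ^ 1 + 1)" by (intro mult_left_mono) auto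
        then show ?case by (rule min.coboundedI2)
      qed
    qed
    also have "\<dots> = \<bar>u\<bar> * 16"
      using has_bochner_integral_integral_eq[OF m3] by (simp add: fact_numeral)
    finally show "expectation (\<lambda>y. min (6 * (y - 1)\<^sup>2) (\<bar>u\<bar> * \<bar>y - 1\<bar> ^ 3)) \<le> \<bar>u\<bar> * 16" .
  qed auto
  also have "\<dots> = 8 / 3 * \<bar>u\<bar> ^ 3"
    by (simp add: power3_eq_cube power2_eq_square)
  finally have c: "cmod (char ?\<mu> u - (1 - u\<^sup>2 / 2)) \<le> 8 / 3 * \<bar>u\<bar> ^ 3" by simp
  show ?thesis
  proof (cases "\<bar>u\<bar> \<le> 1")
    case True
    define x where "x = u\<^sup>2 / 2"
    have x: "0 \<le> x" by (simp add: x_def)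
    have "\<bar>exp (- x) - (1 - x)\<bar> \<le> x\<^sup>2 / 2"
    proof -
      have "1 - x \<le> exp (- x)" using exp_ge_add_one_self[of "- x"] by simp
      moreover have "exp (- x) \<le> 1 - x + x\<^sup>2 / 2"
      proof -
        have "1 + x + x\<^sup>2 / 2 \<le> exp x" using exp_lower_Taylor_quadratic[OF x] .
        have "exp (- x) = 1 / exp x" by (simp add: exp_minus divide_inverse)
        also have "\<dots> \<le> 1 / (1 + x + x\<^sup>2 / 2)"
          using exp_lower_Taylor_quadratic[OF x] x by (intro divide_left_mono) (auto intro!: mult_pos_pos add_pos_nonneg)
        also have "\<dots> \<le> 1 - x + x\<^sup>2 / 2"
        proof -
          have "(1 - x + x\<^sup>2 / 2) * (1 + x + x\<^sup>2 / 2) = 1 + (x\<^sup>2)\<^sup>2 / 4"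
            by (simp add: power2_eq_square algebra_simps)
          then have "1 \<le> (1 - x + x\<^sup>2 / 2) * (1 + x + x\<^sup>2 / 2)" by simp
          moreover have "0 < 1 + x + x\<^sup>2 / 2" using x by (auto intro!: add_pos_nonneg)
          ultimately show ?thesis by (simp add: divide_le_eq)
        qed
        finally show ?thesis .
      qed
      ultimately show ?thesis by simp
    qed
    also have "x\<^sup>2 / 2 \<le> 1 / 8 * \<bar>u\<bar> ^ 3"
    proof -
      have "x\<^sup>2 / 2 = 1 / 8 * \<bar>u\<bar> ^ 4" by (simp add: x_def power2_eq_square power4_eq_xxxx)
      also have "\<dots> \<le> 1 / 8 * \<bar>u\<bar> ^ 3" using True by (intro mult_left_mono power_decreasing) auto
      finally show ?thesis .
    qed
    finally have d: "\<bar>exp (- x) - (1 - x)\<bar> \<le> 1 / 8 * \<bar>u\<bar> ^ 3" .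
    have "cmod (complex_of_real (1 - x) - complex_of_real (exp (- x))) \<le> 1 / 8 * \<bar>u\<bar> ^ 3"
      using d unfolding of_real_diff[symmetric] norm_of_real by (simp add: abs_minus_commute)
    moreover have "cmod (char ?\<mu> u - complex_of_real (1 - x)) \<le> 8 / 3 * \<bar>u\<bar> ^ 3"
      using c by (simp add: x_def)
    ultimately have "cmod (char ?\<mu> u - complex_of_real (exp (- x))) \<le> 8 / 3 * \<bar>u\<bar> ^ 3 + 1 / 8 * \<bar>u\<bar> ^ 3"
      by (intro norm_diff_triangle_le)
    also have "\<dots> \<le> 3 * \<bar>u\<bar> ^ 3" by simp
    finally show ?thesis unfolding x_def minus_divide_left .
  next
    case False
    have "cmod (char ?\<mu> u - complex_of_real (exp (- (u\<^sup>2) / 2))) \<le> cmod (char ?\<mu> u) + cmod (complex_of_real (exp (- (u\<^sup>2) / 2)))"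
      by (rule norm_triangle_ineq4)
    also have "\<dots> \<le> 1 + 1"
      by (intro add_mono \<mu>.cmod_char_le_1) simp
    also have "\<dots> \<le> 3 * 1" by simp
    also have "\<dots> \<le> 3 * \<bar>u\<bar> ^ 3" using False by (intro mult_left_mono one_le_power) auto
    finally show ?thesis .
  qed
qed

text \<open>All \<open>k\<close> factors have modulus at most \<open>1\<close>, so their errors at
  \<open>u = c / k\<close> add up to \<open>k * 3 * \<bar>c / k\<bar> ^ 3\<close>. The bound will be
  read as \<open>\<bar>c\<bar> / k\<close> times \<open>c^2 / k\<close>: the first is small by the
  Lyapunov condition, the second sums to a variance.\<close>

lemma char_sample_mean:
  assumes k: "1 \<le> k"
  shows "cmod ((\<integral>e. iexp (c * (1 / real k * (\<Sum>i=1..k. e i) - 1)) \<partial>std_exps {1..k})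
      - complex_of_real (exp (- (c\<^sup>2) / (2 * real k)))) \<le> 3 * \<bar>c\<bar> ^ 3 / (real k)\<^sup>2"
proof -
  let ?P = "std_exps {1..k}"
  let ?\<mu> = "distr std_exp borel (\<lambda>y. y - 1)"
  interpret prob_space ?P by (rule prob_space_PiM_std_exp)
  interpret E: prob_space std_exp by (rule prob_space_std_exp)
  interpret \<mu>: real_distribution ?\<mu> by (intro E.real_distribution_distr) measurable
  define u where "u = c / real k"
  have ind: "indep_vars (\<lambda>_. borel) (\<lambda>i e. e i - 1) {1..k}"
    by (rule indep_vars_compose2[OF PiM_std_exp_indep, where Y="\<lambda>_ y. y - 1"]) (use k in auto)
  have "(\<integral>e. iexp (c * (1 / real k * (\<Sum>i=1..k. e i) - 1)) \<partial>?P) = (\<integral>e. iexp (u * (\<Sum>i=1..k. e i - 1)) \<partial>?P)"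
    using k by (intro Bochner_Integration.integral_cong refl arg_cong[where f="\<lambda>x. iexp x"]) (simp add: u_def sum_subtractf field_simps)
  also have "\<dots> = char (distr ?P borel (\<lambda>e. \<Sum>i=1..k. e i - 1)) u"
    unfolding char_def by (subst integral_distr) auto
  also have "\<dots> = (\<Prod>i\<in>{1..k}. char (distr ?P borel (\<lambda>e. e i - 1)) u)"
    by (rule char_distr_sum[OF ind])
  also have "\<dots> = (\<Prod>i\<in>{1..k}. char ?\<mu> u)"
  proof (intro prod.cong refl arg_cong2[where f=char])
    fix i assume i: "i \<in> {1..k}"
    have "distr ?P borel (\<lambda>e. e i - 1) = distr (distr ?P std_exp (\<lambda>e. e i)) borel (\<lambda>y. y - 1)"
      using i by (subst distr_distr) (auto simp: comp_def intro!: measurable_component_singleton)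
    also have "distr ?P std_exp (\<lambda>e. e i) = std_exp"
      using i by (intro distr_PiM_component prob_space_std_exp)
    finally show "distr ?P borel (\<lambda>e. e i - 1) = ?\<mu>" .
  qed
  also have "\<dots> = char ?\<mu> u ^ k" by simp
  finally have L: "(\<integral>e. iexp (c * (1 / real k * (\<Sum>i=1..k. e i) - 1)) \<partial>?P) = char ?\<mu> u ^ k" .
  have R: "exp (- (c\<^sup>2) / (2 * real k)) = (exp (- (u\<^sup>2) / 2)) ^ k"
    using k by (simp add: exp_of_nat_mult[symmetric] u_def power2_eq_square field_simps)
  have "cmod (char ?\<mu> u ^ k - complex_of_real (exp (- (u\<^sup>2) / 2)) ^ k) \<le> real k * cmod (char ?\<mu> u - complex_of_real (exp (- (u\<^sup>2) / 2)))"
    by (intro norm_power_diff \<mu>.cmod_char_le_1) simp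
  also have "\<dots> \<le> real k * (3 * \<bar>u\<bar> ^ 3)"
    using char_centred_exp[of u] by (rule mult_left_mono) simp
  also have "\<dots> = 3 * \<bar>c\<bar> ^ 3 / (real k)\<^sup>2"
    using k by (simp add: u_def power3_eq_cube power2_eq_square abs_divide)
  finally show ?thesis
    unfolding L R of_real_power .
qed

section \<open>The characteristic function of one subsample\<close>

lemma (in pair_sigma_finite) has_bochner_integral_pair_mult:
  fixes \<phi> :: "'a \<Rightarrow> real" and \<psi> :: "'b \<Rightarrow> real"
  assumes \<phi>: "has_bochner_integral M1 \<phi> a" and \<psi>: "has_bochner_integral M2 \<psi> b"
  shows "has_bochner_integral (M1 \<Otimes>\<^sub>M M2) (\<lambda>p. \<phi> (fst p) * \<psi> (snd p)) (a * b)"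
proof -
  have i: "integrable M1 \<phi>" "integrable M2 \<psi>" and I: "integral\<^sup>L M1 \<phi> = a" "integral\<^sup>L M2 \<psi> = b"
    using assms by (auto simp: has_bochner_integral_iff)
  have [measurable]: "\<phi> \<in> borel_measurable M1" "\<psi> \<in> borel_measurable M2"
    using i by auto
  have int: "integrable (M1 \<Otimes>\<^sub>M M2) (\<lambda>p. \<phi> (fst p) * \<psi> (snd p))"
  proof (rule Fubini_integrable)
    show "integrable M1 (\<lambda>x. \<integral>y. norm (\<phi> (fst (x, y)) * \<psi> (snd (x, y))) \<partial>M2)"
      using i by (simp add: abs_mult)
    show "AE x in M1. integrable M2 (\<lambda>y. \<phi> (fst (x, y)) * \<psi> (snd (x, y)))"
      using i by simp
  qed measurable
  have "(\<integral>p. \<phi> (fst p) * \<psi> (snd p) \<partial>(M1 \<Otimes>\<^sub>M M2)) = (\<integral>x. \<integral>y. \<phi> x * \<psi> y \<partial>M2 \<partial>M1)"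
    using integral_fst'[OF int] by simp
  also have "\<dots> = a * b" using i I by simp
  finally show ?thesis using int by (simp add: has_bochner_integral_iff)
qed

text \<open>Intended for an observed \<open>y\<close>, a main term \<open>x\<close> and a centred
  perturbation \<open>z\<close>. The linear term in \<open>z\<close> is kept apart because it
  integrates to \<open>0\<close>. The minimum with \<open>2\<close> allows places where
  \<open>y\<close> is out of control to be paid by their probability. \<open>\<eta>\<close> trades
  the squares: \<open>x^2\<close> has a bounded sum and gets the small coefficient,
  \<open>z^2\<close> has a vanishing sum and can bear \<open>1 / \<eta>\<close>.\<close>

lemma cmod_iexp_perturbation:
  fixes x y z \<eta> :: real
  assumes \<eta>: "0 < \<eta>" "\<eta> \<le> 1"
  shows "cmod (iexp y - iexp x - \<i> * z) \<le> min 2 \<bar>y - x - z\<bar> + (\<eta> * x\<^sup>2 + z\<^sup>2 / \<eta>)"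
proof -
  have lip: "cmod (iexp a - iexp b) \<le> min 2 \<bar>a - b\<bar>" for a b :: real
  proof -
    have "iexp a - iexp b = iexp b * (iexp (a - b) - 1)"
      by (simp add: right_diff_distrib exp_add[symmetric])
    then have "cmod (iexp a - iexp b) = cmod (iexp (a - b) - 1)" by (simp add: norm_mult)
    moreover have "cmod (iexp (a - b) - 1) \<le> \<bar>a - b\<bar>"
      using iexp_approx1[of "a - b" 0] by simp
    moreover have "cmod (iexp (a - b) - 1) \<le> cmod (iexp (a - b)) + cmod 1" by (rule norm_triangle_ineq4)
    ultimately show ?thesis by simp
  qed
  have one: "cmod (iexp x - 1) \<le> \<bar>x\<bar>" using lip[of x 0] by simp
  have two: "cmod (iexp z - 1 - \<i> * z) \<le> z\<^sup>2 / 2"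
    using iexp_approx1[of z 1] by (simp add: numeral_2_eq_2 diff_diff_eq)
  \<comment> \<open>Three effects: replacing \<open>y\<close> by \<open>x + z\<close>, the quadratic
    remainder in \<open>z\<close>, and the interaction of \<open>x\<close> with
    \<open>z\<close>.\<close>
  have "iexp y - iexp x - \<i> * z = (iexp y - iexp (x + z)) + iexp x * (iexp z - 1 - \<i> * z) + (iexp x - 1) * (\<i> * z)"
    by (simp add: exp_add algebra_simps)
  also have "cmod \<dots> \<le> cmod (iexp y - iexp (x + z)) + cmod (iexp x * (iexp z - 1 - \<i> * z)) + cmod ((iexp x - 1) * (\<i> * z))"
    by (intro order_trans[OF norm_triangle_ineq add_mono] norm_triangle_ineq order_refl)
  also have "\<dots> \<le> min 2 \<bar>y - x - z\<bar> + z\<^sup>2 / 2 + \<bar>x\<bar> * \<bar>z\<bar>"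
  proof (intro add_mono)
    show "cmod (iexp y - iexp (x + z)) \<le> min 2 \<bar>y - x - z\<bar>"
      using lip[of y "x + z"] by (simp add: diff_diff_eq)
    show "cmod (iexp x * (iexp z - 1 - \<i> * z)) \<le> z\<^sup>2 / 2" using two by (simp add: norm_mult)
    show "cmod ((iexp x - 1) * (\<i> * z)) \<le> \<bar>x\<bar> * \<bar>z\<bar>"
      using mult_right_mono[OF one, of "\<bar>z\<bar>"] by (simp add: norm_mult)
  qed
  \<comment> \<open>Weighted inequality of arithmetic and geometric means; the \<open>4\<close>
    leaves room to absorb \<open>z^2 / 2\<close> into \<open>z^2 / \<eta>\<close> for
    \<open>\<eta> \<le> 1\<close>.\<close>
  also have "\<bar>x\<bar> * \<bar>z\<bar> \<le> \<eta> * x\<^sup>2 + z\<^sup>2 / (4 * \<eta>)"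
  proof -
    have "0 \<le> (2 * \<eta> * \<bar>x\<bar> - \<bar>z\<bar>)\<^sup>2 / (4 * \<eta>)" using \<eta> by simp
    also have "\<dots> = \<eta> * x\<^sup>2 + z\<^sup>2 / (4 * \<eta>) - \<bar>x\<bar> * \<bar>z\<bar>"
      using \<eta> by (simp add: power2_diff power_mult_distrib field_simps power2_eq_square[of \<eta>])
    finally show ?thesis by simp
  qed
  also have "z\<^sup>2 / 2 + z\<^sup>2 / (4 * \<eta>) \<le> z\<^sup>2 / \<eta>"
  proof -
    have "z\<^sup>2 / 2 * 1 \<le> z\<^sup>2 / 2 * (1 / \<eta>)" using \<eta> by (intro mult_left_mono) auto
    moreover have "0 \<le> z\<^sup>2 / \<eta>" using \<eta> by simp
    ultimately show ?thesis by (simp add: field_simps)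
  qed
  then have "min 2 \<bar>y - x - z\<bar> + z\<^sup>2 / 2 + (\<eta> * x\<^sup>2 + z\<^sup>2 / (4 * \<eta>)) \<le> min 2 \<bar>y - x - z\<bar> + (\<eta> * x\<^sup>2 + z\<^sup>2 / \<eta>)"
    by linarith
  finally show ?thesis by simp
qed

text \<open>Bounds the variance of \<open>threshold factor * sample mean\<close> for
  \<open>r = - \<rho>\<close>: twice the second moment of the threshold factor times
  \<open>2 / k\<close>, which dominates the variance of the sample mean, plus twice the variance of
  the threshold factor.\<close>

definition excess_variance_bound :: "real \<Rightarrow> nat \<Rightarrow> nat \<Rightarrow> real" where
  "excess_variance_bound r n k = 4 * (gamma_ratio (2 * r) n / gamma_ratio (2 * r) k) / real k
     + 2 * (gamma_ratio (2 * r) n / gamma_ratio (2 * r) k - (gamma_ratio r n / gamma_ratio r k)\<^sup>2)"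

text \<open>
  The fluctuating part of the Hill statistic of one subsample is
  \<open>\<gamma> (mean e - 1) + \<alpha> (W - E W)\<close>, where
  \<open>W = exp (\<rho> (t - ln (n / k))) * mean (limit_shape \<rho> e)\<close>.
\<close>

locale one_sample =
  fixes n k :: nat and \<rho> :: real
  assumes k: "1 \<le> k" "k < n" and rho: "\<rho> \<le> 0"
begin

abbreviation "T \<equiv> threshold_law n k"
abbreviation "E \<equiv> std_exps {1..k}"

definition "s = ln (real n / real k)"
definition "G t = exp (\<rho> * (t - s))"
definition "avg f e = 1 / real k * (\<Sum>i=1..k. f (e i))" for f :: "real \<Rightarrow> real" and e :: "nat \<Rightarrow> real"
definition "mG = gamma_ratio (- \<rho>) n / gamma_ratio (- \<rho>) k"
definition "mW = mG / (1 - \<rho>)"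
definition "W p = G (fst p) * avg (limit_shape \<rho>) (snd p)"

sublocale T: prob_space T using k by (intro prob_space_threshold_law) auto
sublocale E: prob_space E by (rule prob_space_PiM_std_exp)
sublocale TE: pair_prob_space T E ..

lemma G_measurable [measurable]: "G \<in> borel_measurable borel"
  unfolding G_def[abs_def] by measurable

lemma avg_measurable [measurable]:
  assumes [measurable]: "f \<in> borel_measurable borel"
  shows "avg f \<in> borel_measurable (Pi\<^sub>M {1..k} (\<lambda>_. borel))"
  unfolding avg_def[abs_def] by measurable

lemma W_measurable [measurable]: "W \<in> borel_measurable (borel \<Otimes>\<^sub>M Pi\<^sub>M {1..k} (\<lambda>_. borel))"
  unfolding W_def[abs_def] by measurable

lemma G_int: "has_bochner_integral T G mG"
  using has_bochner_integral_threshold_centred[OF k, of "- \<rho>"] rho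
  by (simp add: G_def[abs_def] mG_def s_def)

lemma G2_int: "has_bochner_integral T (\<lambda>t. (G t)\<^sup>2) (gamma_ratio (2 * (- \<rho>)) n / gamma_ratio (2 * (- \<rho>)) k)"
proof -
  have "(G t)\<^sup>2 = exp (- (2 * (- \<rho>)) * (t - ln (real n / real k)))" for t
    unfolding G_def s_def exp_double[symmetric] by (simp add: algebra_simps flip: exp_double)
  then show ?thesis
    using has_bochner_integral_threshold_centred[OF k, of "2 * (- \<rho>)"] rho by simp
qed

lemma GG_int: "has_bochner_integral T (\<lambda>t. (G t - mG)\<^sup>2)
    (gamma_ratio (2 * (- \<rho>)) n / gamma_ratio (2 * (- \<rho>)) k - mG\<^sup>2)"
  using threshold_variance[OF _ k, of "- \<rho>"] rho by (simp add: G_def mG_def s_def)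

lemma avg_int: "has_bochner_integral std_exp f m \<Longrightarrow> f \<in> borel_measurable borel \<Longrightarrow> has_bochner_integral E (avg f) m"
  using sample_mean_expectation[OF _ k(1)] by (simp add: avg_def[abs_def])

lemma W_int: "has_bochner_integral (T \<Otimes>\<^sub>M E) W mW"
  using TE.has_bochner_integral_pair_mult[OF G_int avg_int[OF std_exp_limit_shape[OF rho]]]
  by (simp add: W_def[abs_def] mW_def)

text \<open>\<open>W - mW = G * (avg - \<mu>) + \<mu> * (G - mG)\<close> separates the fluctuation
  of the excesses from that of the threshold. The factors of the first product live on different
  components, so their second moments multiply; in the second, \<open>\<mu> \<le> 1\<close>.\<close>

lemma W_variance:
  "integrable (T \<Otimes>\<^sub>M E) (\<lambda>p. (W p - mW)\<^sup>2)"
  "(\<integral>p. (W p - mW)\<^sup>2 \<partial>(T \<Otimes>\<^sub>M E)) \<le> excess_variance_bound (- \<rho>) n k"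
proof -
  define \<mu> where "\<mu> = 1 / (1 - \<rho>)"
  have \<mu>: "0 \<le> \<mu>" "\<mu> \<le> 1" using rho by (auto simp: \<mu>_def divide_le_eq)
  interpret S: prob_space std_exp by (rule prob_space_std_exp)
  let ?h = "limit_shape \<rho>"
  define \<sigma> where "\<sigma> = (\<integral>y. (?h y - \<mu>)\<^sup>2 \<partial>std_exp)"
  note h1 = std_exp_limit_shape[OF rho, folded \<mu>_def]
  note h2 = std_exp_limit_shape_sq[OF rho]
  have h1': "integrable std_exp ?h" "(\<integral>y. ?h y \<partial>std_exp) = \<mu>" using h1 by (auto simp: has_bochner_integral_iff)
  have "\<sigma> = (\<integral>y. (?h y)\<^sup>2 \<partial>std_exp) - \<mu>\<^sup>2"
    unfolding \<sigma>_def using S.variance_eq[OF h1'(1) h2(1)] by (simp add: h1'(2))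
  then have \<sigma>: "\<sigma> \<le> 2" using h2(2) zero_le_power2[of \<mu>] by linarith
  have H: "has_bochner_integral E (\<lambda>e. (avg ?h e - \<mu>)\<^sup>2) (\<sigma> / real k)"
    using sample_mean_variance[OF _ k(1) h2(1)] by (simp add: avg_def h1'(2) \<sigma>_def)
  have one: "has_bochner_integral E (\<lambda>_. 1) (1::real)"
    by (rule E.has_bochner_integral_const_prob)
  let ?g2 = "gamma_ratio (2 * (- \<rho>)) n / gamma_ratio (2 * (- \<rho>)) k"
  let ?B = "\<lambda>p. 2 * ((G (fst p))\<^sup>2 * (avg ?h (snd p) - \<mu>)\<^sup>2) + 2 * ((G (fst p) - mG)\<^sup>2 * 1)"
  have B: "has_bochner_integral (T \<Otimes>\<^sub>M E) ?B (2 * (?g2 * (\<sigma> / real k)) + 2 * ((?g2 - mG\<^sup>2) * 1))"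
    by (intro has_bochner_integral_add has_bochner_integral_mult_right
        TE.has_bochner_integral_pair_mult[OF G2_int H] TE.has_bochner_integral_pair_mult[OF GG_int one])
  have le: "(W p - mW)\<^sup>2 \<le> ?B p" for p
  proof -
    have "mW = mG * \<mu>" by (simp add: mW_def \<mu>_def)
    then have eq: "W p - mW = G (fst p) * (avg ?h (snd p) - \<mu>) + \<mu> * (G (fst p) - mG)"
      unfolding W_def by (simp add: algebra_simps)
    have sq: "(a + b)\<^sup>2 \<le> 2 * a\<^sup>2 + 2 * b\<^sup>2" for a b :: real
      using zero_le_power2[of "a - b"] by (simp add: power2_eq_square algebra_simps)
    have "(W p - mW)\<^sup>2 \<le> 2 * (G (fst p) * (avg ?h (snd p) - \<mu>))\<^sup>2 + 2 * (\<mu> * (G (fst p) - mG))\<^sup>2"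
      unfolding eq by (rule sq)
    also have "(\<mu> * (G (fst p) - mG))\<^sup>2 \<le> (G (fst p) - mG)\<^sup>2"
      using \<mu> by (simp add: power_mult_distrib mult_left_le_one_le power_le_one)
    finally show ?thesis by (simp add: power_mult_distrib)
  qed
  have iB: "integrable (T \<Otimes>\<^sub>M E) ?B" using B by (simp only: has_bochner_integral_iff)
  show i: "integrable (T \<Otimes>\<^sub>M E) (\<lambda>p. (W p - mW)\<^sup>2)"
  proof (rule Bochner_Integration.integrable_bound[OF iB])
    show "AE p in T \<Otimes>\<^sub>M E. norm ((W p - mW)\<^sup>2) \<le> norm (?B p)"
      by (intro AE_I2) (simp only: real_norm_def abs_of_nonneg[OF zero_le_power2], rule order_trans[OF le abs_ge_self])
  qed measurable
  have "(\<integral>p. (W p - mW)\<^sup>2 \<partial>(T \<Otimes>\<^sub>M E)) \<le> (\<integral>p. ?B p \<partial>(T \<Otimes>\<^sub>M E))"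
    by (intro integral_mono i iB le)
  also have "\<dots> = 2 * (?g2 * (\<sigma> / real k)) + 2 * ((?g2 - mG\<^sup>2) * 1)"
    by (rule has_bochner_integral_integral_eq[OF B])
  also have "\<dots> \<le> excess_variance_bound (- \<rho>) n k"
  proof -
    have "0 \<le> ?g2" using k rho by (intro divide_nonneg_nonneg less_imp_le[OF gamma_ratio_pos]) auto
    then have "?g2 * (\<sigma> / real k) \<le> ?g2 * (2 / real k)"
      using \<sigma> k by (intro mult_left_mono divide_right_mono) auto
    then show ?thesis by (simp add: excess_variance_bound_def mG_def)
  qed
  finally show "(\<integral>p. (W p - mW)\<^sup>2 \<partial>(T \<Otimes>\<^sub>M E)) \<le> excess_variance_bound (- \<rho>) n k" .
qed

lemma AE_excess_pos: "AE p in T \<Otimes>\<^sub>M E. \<forall>i\<in>{1..k}. 0 < snd p i"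
proof (rule TE.AE_pair_measure)
  show "{p \<in> space (T \<Otimes>\<^sub>M E). \<forall>i\<in>{1..k}. 0 < snd p i} \<in> sets (T \<Otimes>\<^sub>M E)" by measurable
  have "AE e in E. \<forall>i\<in>{1..k}. 0 < e i"
    by (intro AE_finite_allI) (auto intro: AE_PiM_component prob_space_std_exp AE_std_exp_pos)
  then show "AE t in T. AE e in E. \<forall>i\<in>{1..k}. 0 < snd (t, e) i" by simp
qed

text \<open>Sources of the six terms, in order: thresholds below \<open>s0\<close>, where only the
  trivial bound \<open>2\<close> is available; the uniform expansion, with \<open>2\<close> the mean
  of \<open>exp (y / 2)\<close>; centring at \<open>\<beta>\<close> instead of \<open>mW\<close>;
  the variance of the main part and that of the fluctuation of \<open>W\<close>, traded by
  \<open>\<eta>\<close>; the normal approximation of the exponential mean. \<open>\<beta>\<close> is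
  free so that the limiting Gamma factor can be inserted.\<close>

theorem char_excess_hill:
  assumes Q [measurable]: "Q \<in> borel_measurable borel" and \<eta>: "0 < \<eta>" "\<eta> \<le> 1" and \<epsilon>: "0 \<le> \<epsilon>"
    and C: "integrable T (\<lambda>t. G t * exp (\<bar>t - s\<bar> / 2))" "(\<integral>t. G t * exp (\<bar>t - s\<bar> / 2) \<partial>T) \<le> C"
    and approx: "\<And>t y. s0 \<le> t \<Longrightarrow> 0 \<le> y \<Longrightarrow>
      \<bar>ln (Q (t + y) / Q t) - \<gamma> * y - \<alpha> * G t * limit_shape \<rho> y\<bar> \<le> \<epsilon> * \<bar>\<alpha>\<bar> * (G t * exp (\<bar>t - s\<bar> / 2)) * exp (y / 2)"
  shows "cmod ((\<integral>p. iexp (c * (excess_hill Q k p - \<gamma> - \<alpha> * \<beta>)) \<partial>excess_law n k) - complex_of_real (exp (- ((c * \<gamma>)\<^sup>2) / (2 * real k))))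
    \<le> 2 * measure T {..<s0} + 2 * C * \<epsilon> * (\<bar>c\<bar> * \<bar>\<alpha>\<bar>) + \<bar>c\<bar> * \<bar>\<alpha>\<bar> * \<bar>mW - \<beta>\<bar>
      + \<eta> * ((c * \<gamma>)\<^sup>2 / real k) + (c * \<alpha>)\<^sup>2 * excess_variance_bound (- \<rho>) n k / \<eta> + 3 * \<bar>c * \<gamma>\<bar> ^ 3 / (real k)\<^sup>2"
proof -
  let ?P = "T \<Otimes>\<^sub>M E"
  let ?id = "\<lambda>y::real. y"
  define Y where "Y p = c * (excess_hill Q k p - \<gamma> - \<alpha> * \<beta>)" for p
  define X where "X p = c * \<gamma> * (avg ?id (snd p) - 1)" for p :: "real \<times> (nat \<Rightarrow> real)"
  define Z where "Z p = c * \<alpha> * (W p - mW)" for p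
  have [measurable]: "Y \<in> borel_measurable ?P"
    unfolding Y_def[abs_def] using measurable_excess_hill[OF Q, of k] by measurable
  have [measurable]: "X \<in> borel_measurable ?P" "Z \<in> borel_measurable ?P"
    unfolding X_def[abs_def] Z_def[abs_def] by measurable
  have one: "has_bochner_integral T (\<lambda>_. 1) (1::real)" "has_bochner_integral E (\<lambda>_. 1) (1::real)" "has_bochner_integral ?P (\<lambda>_. 1) (1::real)"
    by (rule T.has_bochner_integral_const_prob E.has_bochner_integral_const_prob TE.has_bochner_integral_const_prob)+
  define J where "J = (\<integral>t. G t * exp (\<bar>t - s\<bar> / 2) \<partial>T)"
  have J: "has_bochner_integral T (\<lambda>t. G t * exp (\<bar>t - s\<bar> / 2)) J"
    using C(1) by (simp add: has_bochner_integral_iff J_def)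
  have ex: "has_bochner_integral E (avg (\<lambda>y. exp (y / 2))) 2"
    using std_exp_exp[of "1/2"] by (intro avg_int) auto
  have tail: "has_bochner_integral T (indicator {..<s0}) (measure T {..<s0})"
    by (rule has_bochner_integral_real_indicator) (simp_all add: T.emeasure_eq_measure)
  have X2: "has_bochner_integral E (\<lambda>e. (avg ?id e - 1)\<^sup>2) (1 / real k)"
  proof -
    interpret S: prob_space std_exp by (rule prob_space_std_exp)
    have m: "integrable std_exp ?id" "(\<integral>y. y \<partial>std_exp) = 1" "integrable std_exp (\<lambda>y. y\<^sup>2)" "(\<integral>y. y\<^sup>2 \<partial>std_exp) = 2"
      using std_exp_moment[of 1] std_exp_moment[of 2] by (auto simp: has_bochner_integral_iff fact_numeral)
    have v: "(\<integral>y. (y - 1)\<^sup>2 \<partial>std_exp) = 1"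
      using S.variance_eq[OF m(1) m(3)] unfolding m(2) m(4) by simp
    have b: "?id \<in> borel_measurable borel" by measurable
    show ?thesis
      using sample_mean_variance[OF b k(1) m(3)] unfolding avg_def m(2) v .
  qed
  define V where "V = (\<integral>p. (W p - mW)\<^sup>2 \<partial>?P)"
  have V: "has_bochner_integral ?P (\<lambda>p. (W p - mW)\<^sup>2) V"
    using W_variance(1) by (simp add: has_bochner_integral_iff V_def)
  \<comment> \<open>\<open>Z\<close> has mean \<open>0\<close>; its linear term can therefore be
    subtracted under the integral, and \<open>Z\<close> enters the bound only through its
    variance.\<close>
  have Z0: "has_bochner_integral ?P Z (c * \<alpha> * (mW - mW))"
    unfolding Z_def[abs_def]
    by (intro has_bochner_integral_mult_right has_bochner_integral_diff W_int TE.has_bochner_integral_const_prob)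
  let ?R = "\<lambda>p. 2 * (indicator {..<s0} (fst p) * 1)
      + \<bar>c\<bar> * (\<epsilon> * \<bar>\<alpha>\<bar>) * ((G (fst p) * exp (\<bar>fst p - s\<bar> / 2)) * avg (\<lambda>y. exp (y / 2)) (snd p))
      + \<bar>c\<bar> * \<bar>\<alpha>\<bar> * \<bar>mW - \<beta>\<bar> * 1
      + \<eta> * (c * \<gamma>)\<^sup>2 * (1 * (avg ?id (snd p) - 1)\<^sup>2)
      + (c * \<alpha>)\<^sup>2 / \<eta> * (W p - mW)\<^sup>2"
  have R: "has_bochner_integral ?P ?R (2 * (measure T {..<s0} * 1) + \<bar>c\<bar> * (\<epsilon> * \<bar>\<alpha>\<bar>) * (J * 2)
      + \<bar>c\<bar> * \<bar>\<alpha>\<bar> * \<bar>mW - \<beta>\<bar> * 1 + \<eta> * (c * \<gamma>)\<^sup>2 * (1 * (1 / real k)) + (c * \<alpha>)\<^sup>2 / \<eta> * V)"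
    by (intro has_bochner_integral_add has_bochner_integral_mult_right one V
        TE.has_bochner_integral_pair_mult[OF tail one(2)] TE.has_bochner_integral_pair_mult[OF J ex]
        TE.has_bochner_integral_pair_mult[OF one(1) X2])
  have bound: "AE p in ?P. cmod (iexp (Y p) - iexp (X p) - \<i> * Z p) \<le> ?R p"
    using AE_excess_pos
  proof eventually_elim
    case (elim p)
    obtain t e where p: "p = (t, e)" by (cases p)
    have Gpos: "0 \<le> G t" by (simp add: G_def)
    have avg_nonneg: "0 \<le> avg (\<lambda>y. exp (y / 2)) e" by (simp add: avg_def sum_nonneg)
    have d: "min 2 \<bar>Y p - X p - Z p\<bar> \<le> 2 * indicator {..<s0} t
        + \<bar>c\<bar> * (\<epsilon> * \<bar>\<alpha>\<bar>) * ((G t * exp (\<bar>t - s\<bar> / 2)) * avg (\<lambda>y. exp (y / 2)) e)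
        + \<bar>c\<bar> * \<bar>\<alpha>\<bar> * \<bar>mW - \<beta>\<bar>"
    proof (cases "t < s0")
      case True
      have "min 2 \<bar>Y p - X p - Z p\<bar> \<le> 2" by simp
      moreover have "0 \<le> \<bar>c\<bar> * (\<epsilon> * \<bar>\<alpha>\<bar>) * ((G t * exp (\<bar>t - s\<bar> / 2)) * avg (\<lambda>y. exp (y / 2)) e)"
        using Gpos avg_nonneg \<epsilon> by simp
      moreover have "0 \<le> \<bar>c\<bar> * \<bar>\<alpha>\<bar> * \<bar>mW - \<beta>\<bar>" by simp
      ultimately show ?thesis using True by (simp only: indicator_def lessThan_iff if_True of_bool_eq)
    next
      case False
      define D where "D y = ln (Q (t + y) / Q t) - \<gamma> * y - \<alpha> * G t * limit_shape \<rho> y" for y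
      have sumD: "avg D e = excess_hill Q k p - \<gamma> * avg ?id e - \<alpha> * W p"
      proof -
        have "(\<Sum>i=1..k. D (e i)) = (\<Sum>i=1..k. ln (Q (t + e i) / Q t)) - \<gamma> * (\<Sum>i=1..k. e i)
            - \<alpha> * G t * (\<Sum>i=1..k. limit_shape \<rho> (e i))"
          by (simp only: D_def sum_subtractf sum_distrib_left)
        then show ?thesis
          by (simp add: avg_def excess_hill_def W_def p diff_divide_distrib mult_ac)
      qed
      have "\<bar>avg D e\<bar> \<le> avg (\<lambda>y. \<epsilon> * \<bar>\<alpha>\<bar> * (G t * exp (\<bar>t - s\<bar> / 2)) * exp (y / 2)) e"
      proof -
        have "\<bar>\<Sum>i=1..k. D (e i)\<bar> \<le> (\<Sum>i=1..k. \<epsilon> * \<bar>\<alpha>\<bar> * (G t * exp (\<bar>t - s\<bar> / 2)) * exp (e i / 2))"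
          using elim False unfolding D_def p
          by (intro order_trans[OF sum_abs sum_mono] approx) (auto intro!: less_imp_le)
        then have "1 / real k * \<bar>\<Sum>i=1..k. D (e i)\<bar> \<le> 1 / real k * (\<Sum>i=1..k. \<epsilon> * \<bar>\<alpha>\<bar> * (G t * exp (\<bar>t - s\<bar> / 2)) * exp (e i / 2))"
          by (intro mult_left_mono) auto
        then show ?thesis by (simp add: avg_def abs_mult)
      qed
      also have "\<dots> = \<epsilon> * \<bar>\<alpha>\<bar> * ((G t * exp (\<bar>t - s\<bar> / 2)) * avg (\<lambda>y. exp (y / 2)) e)"
        by (simp only: avg_def sum_distrib_left mult_ac)
      finally have aD: "\<bar>avg D e\<bar> \<le> \<epsilon> * \<bar>\<alpha>\<bar> * ((G t * exp (\<bar>t - s\<bar> / 2)) * avg (\<lambda>y. exp (y / 2)) e)" .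
      \<comment> \<open>\<open>X\<close> and \<open>Z\<close> absorb the centred parts; what remains
        is the averaged expansion error and the discrepancy of the centring.\<close>
      have "Y p - X p - Z p = c * (avg D e + \<alpha> * (mW - \<beta>))"
        unfolding sumD by (simp add: Y_def X_def Z_def p algebra_simps)
      then have "\<bar>Y p - X p - Z p\<bar> = \<bar>c\<bar> * \<bar>avg D e + \<alpha> * (mW - \<beta>)\<bar>" by (simp add: abs_mult)
      also have "\<dots> \<le> \<bar>c\<bar> * (\<epsilon> * \<bar>\<alpha>\<bar> * ((G t * exp (\<bar>t - s\<bar> / 2)) * avg (\<lambda>y. exp (y / 2)) e) + \<bar>\<alpha>\<bar> * \<bar>mW - \<beta>\<bar>)"
        using aD by (intro mult_left_mono order_trans[OF abs_triangle_ineq add_mono]) (auto simp: abs_mult)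
      also have "\<dots> = 2 * indicator {..<s0} t + \<bar>c\<bar> * (\<epsilon> * \<bar>\<alpha>\<bar>) * ((G t * exp (\<bar>t - s\<bar> / 2)) * avg (\<lambda>y. exp (y / 2)) e)
        + \<bar>c\<bar> * \<bar>\<alpha>\<bar> * \<bar>mW - \<beta>\<bar>"
        using False by (simp add: algebra_simps)
      finally show ?thesis by (rule min.coboundedI2)
    qed
    have "cmod (iexp (Y p) - iexp (X p) - \<i> * Z p) \<le> min 2 \<bar>Y p - X p - Z p\<bar> + (\<eta> * (X p)\<^sup>2 + (Z p)\<^sup>2 / \<eta>)"
      by (rule cmod_iexp_perturbation[OF \<eta>])
    also have "\<dots> \<le> (2 * indicator {..<s0} t
        + \<bar>c\<bar> * (\<epsilon> * \<bar>\<alpha>\<bar>) * ((G t * exp (\<bar>t - s\<bar> / 2)) * avg (\<lambda>y. exp (y / 2)) e)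
        + \<bar>c\<bar> * \<bar>\<alpha>\<bar> * \<bar>mW - \<beta>\<bar>) + (\<eta> * (X p)\<^sup>2 + (Z p)\<^sup>2 / \<eta>)"
      using d by (rule add_right_mono)
    also have "\<dots> = ?R p"
      by (simp add: p X_def Z_def power_mult_distrib)
    finally show ?case .
  qed
  have iexp_int: "integrable ?P (\<lambda>p. iexp (f p))" if "f \<in> borel_measurable ?P" for f :: "_ \<Rightarrow> real"
    using that by (intro TE.integrable_iexp) auto
  have iY: "integrable ?P (\<lambda>p. iexp (Y p))" "integrable ?P (\<lambda>p. iexp (X p))"
    by (rule iexp_int, measurable)+
  have iZ: "integrable ?P (\<lambda>p. \<i> * complex_of_real (Z p))" "(\<integral>p. \<i> * complex_of_real (Z p) \<partial>?P) = 0"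
    using Z0 by (auto simp: has_bochner_integral_iff)
  have "(\<integral>p. iexp (Y p) \<partial>?P) - (\<integral>p. iexp (X p) \<partial>?P) = (\<integral>p. iexp (Y p) - iexp (X p) - \<i> * Z p \<partial>?P)"
    using iY iZ by simp
  also have "cmod \<dots> \<le> (\<integral>p. cmod (iexp (Y p) - iexp (X p) - \<i> * Z p) \<partial>?P)"
    by (rule integral_norm_bound)
  also have "\<dots> \<le> (\<integral>p. ?R p \<partial>?P)"
    using R iY iZ bound by (intro integral_mono_AE integrable_norm Bochner_Integration.integrable_diff) (auto simp: has_bochner_integral_iff)
  also have "\<dots> = 2 * (measure T {..<s0} * 1) + \<bar>c\<bar> * (\<epsilon> * \<bar>\<alpha>\<bar>) * (J * 2)
      + \<bar>c\<bar> * \<bar>\<alpha>\<bar> * \<bar>mW - \<beta>\<bar> * 1 + \<eta> * (c * \<gamma>)\<^sup>2 * (1 * (1 / real k)) + (c * \<alpha>)\<^sup>2 / \<eta> * V"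
    by (rule has_bochner_integral_integral_eq[OF R])
  also have "\<dots> \<le> 2 * measure T {..<s0} + 2 * C * \<epsilon> * (\<bar>c\<bar> * \<bar>\<alpha>\<bar>) + \<bar>c\<bar> * \<bar>\<alpha>\<bar> * \<bar>mW - \<beta>\<bar>
      + \<eta> * ((c * \<gamma>)\<^sup>2 / real k) + (c * \<alpha>)\<^sup>2 * excess_variance_bound (- \<rho>) n k / \<eta>"
  proof -
    have "\<bar>c\<bar> * (\<epsilon> * \<bar>\<alpha>\<bar>) * (J * 2) \<le> \<bar>c\<bar> * (\<epsilon> * \<bar>\<alpha>\<bar>) * (C * 2)"
      using C(2) \<epsilon> by (intro mult_left_mono) (auto simp: J_def)
    moreover have "(c * \<alpha>)\<^sup>2 / \<eta> * V \<le> (c * \<alpha>)\<^sup>2 / \<eta> * excess_variance_bound (- \<rho>) n k"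
      using W_variance(2) \<eta> by (intro mult_left_mono) (auto simp: V_def)
    ultimately show ?thesis by (simp add: mult_ac)
  qed
  finally have A: "cmod ((\<integral>p. iexp (Y p) \<partial>?P) - (\<integral>p. iexp (X p) \<partial>?P)) \<le> \<dots>" .
  have "(\<integral>p. iexp (X p) \<partial>?P) = (\<integral>t. \<integral>e. iexp (c * \<gamma> * (avg ?id e - 1)) \<partial>E \<partial>T)"
    using TE.integral_fst'[OF iY(2)] by (simp add: X_def)
  also have "\<dots> = (\<integral>e. iexp (c * \<gamma> * (1 / real k * (\<Sum>i=1..k. e i) - 1)) \<partial>E)"
    using T.prob_space by (simp add: avg_def)
  finally have "cmod ((\<integral>p. iexp (X p) \<partial>?P) - complex_of_real (exp (- ((c * \<gamma>)\<^sup>2) / (2 * real k)))) \<le> 3 * \<bar>c * \<gamma>\<bar> ^ 3 / (real k)\<^sup>2"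
    using char_sample_mean[OF k(1), of "c * \<gamma>"] by (simp only:)
  from norm_diff_triangle_le[OF A this] show ?thesis
    unfolding excess_law_def Y_def by simp
qed

end

section \<open>Second-order expansion of the log-quantile\<close>

lemma quantile_second_order_exp:
  assumes C2: "second_order_condition F \<gamma> \<rho> A"
  defines "Q \<equiv> \<lambda>l. tail_quantile F (exp l)"
  shows "((\<lambda>s. (Q (s + y) / Q s - exp (\<gamma> * y)) / A (exp s)) \<longlongrightarrow> exp (\<gamma> * y) * limit_shape \<rho> y) at_top"
proof -
  have "\<forall>x>0. ((\<lambda>t. 1 / A t * (tail_quantile F (t * x) / tail_quantile F t - x powr \<gamma>))
        \<longlongrightarrow> x powr \<gamma> * (if \<rho> = 0 then ln x else (x powr \<rho> - 1) / \<rho>)) at_top"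
    using C2 unfolding second_order_condition_def by blast
  then have "((\<lambda>t. 1 / A t * (tail_quantile F (t * exp y) / tail_quantile F t - exp y powr \<gamma>))
        \<longlongrightarrow> exp y powr \<gamma> * (if \<rho> = 0 then ln (exp y) else (exp y powr \<rho> - 1) / \<rho>)) at_top"
    by (rule allE[where x="exp y"]) simp
  from filterlim_compose[OF this exp_at_top]
  have "((\<lambda>s. 1 / A (exp s) * (tail_quantile F (exp s * exp y) / tail_quantile F (exp s) - exp y powr \<gamma>))
        \<longlongrightarrow> exp y powr \<gamma> * (if \<rho> = 0 then ln (exp y) else (exp y powr \<rho> - 1) / \<rho>)) at_top" .
  moreover have "exp y powr \<gamma> = exp (\<gamma> * y)" "exp y powr \<rho> = exp (\<rho> * y)" by (simp_all add: powr_def)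
  ultimately show ?thesis
    unfolding Q_def limit_shape_def by (cases "\<rho> = 0") (simp_all add: exp_add)
qed

text \<open>The condition forces \<open>Q (s + 1) / Q s\<close> towards
  \<open>exp \<gamma> > 1\<close>. A nondecreasing \<open>Q\<close> with \<open>Q s < 0\<close>
  would have quotient at most \<open>1\<close>, and \<open>Q s = 0\<close> gives quotient
  \<open>0\<close> by the convention for division by zero. Positivity is what makes the logarithms
  below meaningful.\<close>

lemma quantile_eventually_pos:
  assumes C2: "second_order_condition F \<gamma> \<rho> A" and mono: "mono_on {0<..} (\<lambda>l. tail_quantile F (exp l))"
  shows "\<forall>\<^sub>F s in at_top. 0 < tail_quantile F (exp s)"
proof -
  define Q where "Q = (\<lambda>l. tail_quantile F (exp l))"
  have A0: "((\<lambda>s. A (exp s)) \<longlongrightarrow> 0) at_top" and \<gamma>: "0 < \<gamma>"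
    using C2 filterlim_compose[OF _ exp_at_top] unfolding second_order_condition_def by blast+
  have nz: "\<forall>\<^sub>F s in at_top. A (exp s) \<noteq> 0"
  proof -
    have "\<forall>\<^sub>F t in at_top. A t \<noteq> 0"
      using C2 unfolding second_order_condition_def by (auto elim: eventually_mono)
    then show ?thesis by (rule eventually_compose_filterlim[OF _ exp_at_top])
  qed
  have "((\<lambda>s. A (exp s) * ((Q (s + 1) / Q s - exp (\<gamma> * 1)) / A (exp s)) + exp (\<gamma> * 1))
      \<longlongrightarrow> 0 * (exp (\<gamma> * 1) * limit_shape \<rho> 1) + exp (\<gamma> * 1)) at_top"
    unfolding Q_def by (intro tendsto_intros A0 quantile_second_order_exp[OF C2])
  moreover have "\<forall>\<^sub>F s in at_top. A (exp s) * ((Q (s + 1) / Q s - exp (\<gamma> * 1)) / A (exp s)) + exp (\<gamma> * 1) = Q (s + 1) / Q s"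
    using nz by eventually_elim simp
  ultimately have "((\<lambda>s. Q (s + 1) / Q s) \<longlongrightarrow> exp \<gamma>) at_top"
    by (simp add: tendsto_cong)
  moreover have "1 < exp \<gamma>" using \<gamma> by simp
  ultimately have "\<forall>\<^sub>F s in at_top. 1 < Q (s + 1) / Q s" by (rule order_tendstoD)
  then have "\<forall>\<^sub>F s in at_top. 0 < Q s"
    using eventually_gt_at_top[of 0]
  proof eventually_elim
    case (elim s)
    have "Q s \<le> Q (s + 1)" unfolding Q_def using elim(2) by (intro mono_onD[OF mono]) auto
    show ?case
    proof (rule ccontr)
      assume "\<not> 0 < Q s"
      moreover have "Q s \<noteq> 0" using elim(1) by auto
      ultimately have "Q s < 0" by simp
      then have "Q (s + 1) / Q s \<le> 1" using \<open>Q s \<le> Q (s + 1)\<close> by (simp add: divide_le_eq)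
      then show False using elim(1) by simp
    qed
  qed
  then show ?thesis by (simp add: Q_def)
qed

text \<open>With \<open>R\<close> the relative deviation of \<open>Q (s + y) / Q s\<close> from
  \<open>exp (\<gamma> * y)\<close>, passing to the logarithm changes \<open>R / A\<close> by at
  most \<open>2 * \<bar>R\<bar> * \<bar>R / A\<bar>\<close>. Here \<open>R / A\<close> converges and
  \<open>R\<close> vanishes, so \<open>ln Q\<close> minus its linear part inherits the limit and the
  uniform theorem applies.\<close>

theorem log_quantile_uniform_second_order:
  assumes C2: "second_order_condition F \<gamma> \<rho> A" and mono: "mono_on {0<..} (\<lambda>l. tail_quantile F (exp l))"
    and meas: "(\<lambda>l. tail_quantile F (exp l)) \<in> borel_measurable borel" and "0 < e"
  defines "Q \<equiv> \<lambda>l. tail_quantile F (exp l)"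
  obtains s0 where "\<And>s t y. s0 \<le> s \<Longrightarrow> s0 \<le> t \<Longrightarrow> 0 \<le> y \<Longrightarrow>
    \<bar>ln (Q (t + y) / Q t) - \<gamma> * y - A (exp s) * exp (\<rho> * (t - s)) * limit_shape \<rho> y\<bar>
      \<le> e * \<bar>A (exp s)\<bar> * (exp (\<rho> * (t - s)) * exp (\<bar>t - s\<bar> / 2)) * exp (y / 2)"
proof -
  define f where "f s = ln (Q s) - \<gamma> * s" for s
  have [measurable]: "Q \<in> borel_measurable borel" using meas by (simp add: Q_def)
  have A0: "((\<lambda>s. A (exp s)) \<longlongrightarrow> 0) at_top" and \<rho>: "\<rho> \<le> 0"
    using C2 filterlim_compose[OF _ exp_at_top] unfolding second_order_condition_def by blast+
  have sign: "(\<forall>\<^sub>F s in at_top. A (exp s) > 0) \<or> (\<forall>\<^sub>F s in at_top. A (exp s) < 0)"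
    using C2 eventually_compose_filterlim[OF _ exp_at_top] unfolding second_order_condition_def by blast
  then have nz: "\<forall>\<^sub>F s in at_top. A (exp s) \<noteq> 0" by (auto elim: eventually_mono)
  have Qpos: "\<forall>\<^sub>F s in at_top. 0 < Q s"
    using quantile_eventually_pos[OF C2 mono] by (simp add: Q_def)
  interpret second_order_variation f "\<lambda>s. A (exp s)" \<rho>
  proof
    show "f \<in> borel_measurable borel" unfolding f_def[abs_def] by measurable
    fix y
    define R where "R s = Q (s + y) / Q s * exp (- \<gamma> * y) - 1" for s
    have Rq: "((\<lambda>s. R s / A (exp s)) \<longlongrightarrow> limit_shape \<rho> y) at_top"
    proof -
      have "((\<lambda>s. exp (- \<gamma> * y) * ((Q (s + y) / Q s - exp (\<gamma> * y)) / A (exp s)))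
          \<longlongrightarrow> exp (- \<gamma> * y) * (exp (\<gamma> * y) * limit_shape \<rho> y)) at_top"
        unfolding Q_def by (intro tendsto_intros quantile_second_order_exp[OF C2])
      moreover have "exp (- \<gamma> * y) * ((Q (s + y) / Q s - exp (\<gamma> * y)) / A (exp s)) = R s / A (exp s)" for s
        by (simp add: R_def right_diff_distrib exp_minus field_simps)
      moreover have "exp (- \<gamma> * y) * (exp (\<gamma> * y) * limit_shape \<rho> y) = limit_shape \<rho> y"
        by (simp add: exp_minus)
      ultimately show ?thesis by (simp only:)
    qed
    have "((\<lambda>s. R s / A (exp s) * A (exp s)) \<longlongrightarrow> limit_shape \<rho> y * 0) at_top"
      by (intro tendsto_mult Rq A0)
    moreover have "\<forall>\<^sub>F s in at_top. R s / A (exp s) * A (exp s) = R s"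
      using nz by eventually_elim simp
    ultimately have R0: "(R \<longlongrightarrow> 0) at_top" by (simp add: tendsto_cong)
    have "((\<lambda>s. (ln (1 + R s) - R s) / A (exp s)) \<longlongrightarrow> 0) at_top"
    proof (rule Lim_null_comparison)
      have "\<forall>\<^sub>F s in at_top. \<bar>R s\<bar> < 1 / 2"
        using tendstoD[OF R0, of "1/2"] by (simp add: dist_real_def)
      then show "\<forall>\<^sub>F s in at_top. norm ((ln (1 + R s) - R s) / A (exp s)) \<le> 2 * \<bar>R s\<bar> * \<bar>R s / A (exp s)\<bar>"
      proof eventually_elim
        case (elim s)
        have "\<bar>ln (1 + R s) - R s\<bar> / \<bar>A (exp s)\<bar> \<le> 2 * (R s)\<^sup>2 / \<bar>A (exp s)\<bar>"
          using elim by (intro divide_right_mono abs_ln_one_plus_x_minus_x_bound) auto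
        then show ?case by (simp add: abs_divide power2_eq_square)
      qed
      have "((\<lambda>s. 2 * \<bar>R s\<bar> * \<bar>R s / A (exp s)\<bar>) \<longlongrightarrow> 2 * \<bar>0\<bar> * \<bar>limit_shape \<rho> y\<bar>) at_top"
        by (intro tendsto_intros R0 Rq)
      then show "((\<lambda>s. 2 * \<bar>R s\<bar> * \<bar>R s / A (exp s)\<bar>) \<longlongrightarrow> 0) at_top" by simp
    qed
    from tendsto_add[OF this Rq]
    have "((\<lambda>s. ln (1 + R s) / A (exp s)) \<longlongrightarrow> limit_shape \<rho> y) at_top"
      by (simp add: diff_divide_distrib)
    moreover have "\<forall>\<^sub>F s in at_top. ln (1 + R s) / A (exp s) = (f (s + y) - f s) / A (exp s)"
    proof -
      have "filterlim (\<lambda>s. s + y) at_top at_top"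
        using filterlim_tendsto_add_at_top[OF tendsto_const[of y] filterlim_ident]
        by (simp add: add.commute)
      from eventually_compose_filterlim[OF Qpos this] Qpos
      show ?thesis
      proof eventually_elim
        case (elim s)
        have "ln (1 + R s) = ln (Q (s + y) / Q s * exp (- \<gamma> * y))" by (simp add: R_def)
        also have "\<dots> = ln (Q (s + y)) - ln (Q s) - \<gamma> * y"
          using elim by (simp add: ln_mult ln_div)
        also have "\<dots> = f (s + y) - f s" by (simp add: f_def algebra_simps)
        finally show ?case by simp
      qed
    qed
    ultimately show "((\<lambda>s. (f (s + y) - f s) / A (exp s)) \<longlongrightarrow> limit_shape \<rho> y) at_top"
      by (simp add: tendsto_cong)
  qed (use \<rho> sign in auto)
  obtain s1 where s1: "\<And>s t y. s1 \<le> s \<Longrightarrow> s1 \<le> t \<Longrightarrow> 0 \<le> y \<Longrightarrow>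
    \<bar>f (t + y) - f t - A (exp s) * exp (\<rho> * (t - s)) * limit_shape \<rho> y\<bar>
      \<le> e * \<bar>A (exp s)\<bar> * exp (\<rho> * (t - s)) * exp (\<bar>t - s\<bar> / 2) * exp (y / 2)"
    using uniform_second_order[OF \<open>0 < e\<close>] by blast
  obtain s2 where s2: "\<And>s. s2 \<le> s \<Longrightarrow> 0 < Q s"
    using Qpos by (auto simp: eventually_at_top_linorder)
  show thesis
  proof (rule that[of "max s1 s2"])
    fix s t y assume *: "max s1 s2 \<le> s" "max s1 s2 \<le> t" "0 \<le> (y::real)"
    have "0 < Q t" "0 < Q (t + y)" using * by (auto intro!: s2)
    then have "ln (Q (t + y) / Q t) - \<gamma> * y = f (t + y) - f t"
      by (simp add: f_def ln_div algebra_simps)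
    then show "\<bar>ln (Q (t + y) / Q t) - \<gamma> * y - A (exp s) * exp (\<rho> * (t - s)) * limit_shape \<rho> y\<bar>
      \<le> e * \<bar>A (exp s)\<bar> * (exp (\<rho> * (t - s)) * exp (\<bar>t - s\<bar> / 2)) * exp (y / 2)"
      using s1[of s t y] * by (simp add: mult.assoc)
  qed
qed

section \<open>Laws of the subsample statistics, weak convergence, limits of the variance
  bound\<close>

lemma (in prob_space) indep_subsamples:
  fixes X :: "nat \<Rightarrow> nat \<Rightarrow> 'a \<Rightarrow> real"
  assumes indep: "indep_vars (\<lambda>_. borel) (\<lambda>(j, i). X i j) (SIGMA j:{1..m}. {1..N j})"
    and KN: "\<And>j. j \<in> {1..m} \<Longrightarrow> 1 \<le> K j \<and> K j < N j"
  shows "indep_vars (\<lambda>_. borel) (\<lambda>j s. hill_estimator (K j) (N j) (\<lambda>i. X i j s)) {1..m}"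
proof -
  let ?B = "\<lambda>j. {j} \<times> {1..N j}"
  have "indep_vars (\<lambda>j. PiM (?B j) (\<lambda>_. borel)) (\<lambda>j s. restrict (\<lambda>p. (\<lambda>(j, i). X i j) p s) (?B j)) {1..m}"
    by (rule indep_vars_restrict[OF indep]) (auto simp: disjoint_family_on_def)
  then have "indep_vars (\<lambda>_. borel) (\<lambda>j s. hill_estimator (K j) (N j)
      (\<lambda>i. (restrict (\<lambda>p. (\<lambda>(j, i). X i j) p s) (?B j)) (j, i))) {1..m}"
  proof (rule indep_vars_compose2)
    fix j assume j: "j \<in> {1..m}"
    show "(\<lambda>f. hill_estimator (K j) (N j) (\<lambda>i. f (j, i))) \<in> borel_measurable (PiM (?B j) (\<lambda>_. borel))"
      using KN[OF j] by (intro measurable_hill_estimator measurable_component_singleton) auto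
  qed
  also have "(\<lambda>j s. hill_estimator (K j) (N j) (\<lambda>i. (restrict (\<lambda>p. (\<lambda>(j, i). X i j) p s) (?B j)) (j, i)))
      = (\<lambda>j s. hill_estimator (K j) (N j) (\<lambda>i. X i j s))"
    by (intro ext hill_estimator_cong) auto
  finally show ?thesis .
qed

lemma (in prob_space) distr_hill_subsample:
  fixes X :: "nat \<Rightarrow> 'a \<Rightarrow> real"
  assumes indep: "indep_vars (\<lambda>_. borel) X {1..n}" and k: "1 \<le> k" "k < n"
    and D: "\<And>i. i \<in> {1..n} \<Longrightarrow> distr M borel (X i) = D" "real_distribution D"
  shows "distr M borel (\<lambda>s. hill_estimator k n (\<lambda>i. X i s))
    = distr (excess_law n k) borel (excess_hill (\<lambda>l. tail_quantile (cdf D) (exp l)) k)"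
proof -
  have rv [measurable]: "random_variable borel (X i)" if "i \<in> {1..n}" for i
    using indep that by (auto simp: indep_vars_def)
  have ne: "{1..n} \<noteq> {}" using k by auto
  have "distr M (Pi\<^sub>M {1..n} (\<lambda>_. borel)) (\<lambda>s. \<lambda>i\<in>{1..n}. X i s) = Pi\<^sub>M {1..n} (\<lambda>i. distr M borel (X i))"
    using indep rv by (subst (asm) indep_vars_iff_distr_eq_PiM'[OF ne]) auto
  also have "\<dots> = Pi\<^sub>M {1..n} (\<lambda>_. D)" by (intro PiM_cong refl D)
  finally have P: "distr M (Pi\<^sub>M {1..n} (\<lambda>_. borel)) (\<lambda>s. \<lambda>i\<in>{1..n}. X i s) = Pi\<^sub>M {1..n} (\<lambda>_. D)" .
  have H: "hill_estimator k n \<in> borel_measurable (Pi\<^sub>M {1..n} (\<lambda>_. borel))"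
    by (rule measurable_hill_estimator[OF k, where X="\<lambda>j l. l j"]) (rule measurable_component_singleton)
  have "distr M borel (\<lambda>s. hill_estimator k n (\<lambda>i. X i s)) = distr M borel (\<lambda>s. hill_estimator k n (\<lambda>i\<in>{1..n}. X i s))"
    by (intro distr_cong refl hill_estimator_cong) simp
  also have "\<dots> = distr (distr M (Pi\<^sub>M {1..n} (\<lambda>_. borel)) (\<lambda>s. \<lambda>i\<in>{1..n}. X i s)) borel (hill_estimator k n)"
    by (subst distr_distr[OF H]) (auto simp: comp_def intro!: measurable_restrict)
  also have "\<dots> = distr (excess_law n k) borel (excess_hill (\<lambda>l. tail_quantile (cdf D) (exp l)) k)"
    unfolding P using k D(2)
    by (intro distr_hill_estimator measurable_quantile mono_on_quantile distr_quantile)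
  finally show ?thesis .
qed

lemma char_normal_distribution:
  assumes "0 < v"
  shows "char (normal_distribution 0 v) t = complex_of_real (exp (- (v * t\<^sup>2) / 2))"
    and "real_distribution (normal_distribution 0 v)"
proof -
  interpret S: real_distribution std_normal_distribution by (rule real_dist_normal_dist)
  have "distributed std_normal_distribution lborel (\<lambda>x. x) (normal_density 0 1)"
    by (auto simp: distributed_def distr_id2 sets_eq_imp_space_eq)
  from S.normal_density_affine[OF this, of "sqrt v" 0] assms
  have "distributed std_normal_distribution lborel (\<lambda>x. sqrt v * x) (normal_density 0 (sqrt v))" by simp
  then have "distr std_normal_distribution lborel (\<lambda>x. sqrt v * x) = normal_distribution 0 v"
    by (simp add: distributed_def normal_distribution_def)
  then have N: "normal_distribution 0 v = distr std_normal_distribution borel (\<lambda>x. sqrt v * x)"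
    by (metis distr_cong sets_lborel)
  show "real_distribution (normal_distribution 0 v)"
    unfolding N by (intro S.real_distribution_distr) measurable
  have "char (normal_distribution 0 v) t = char std_normal_distribution (t * sqrt v)"
    unfolding N char_def by (subst integral_distr) (auto simp: mult_ac)
  then show "char (normal_distribution 0 v) t = complex_of_real (exp (- (v * t\<^sup>2) / 2))"
    using assms by (simp add: char_std_normal_distribution power_mult_distrib mult_ac)
qed

text \<open>Measurability of the Hill statistics is available once \<open>1 \<le> K < N\<close>,
  which is known only for large \<open>n\<close>; a shift of the sequence makes Levy's theorem
  applicable.\<close>

lemma levy_continuity_eventually:
  assumes "\<forall>\<^sub>F n in sequentially. real_distribution (\<mu> n)" "real_distribution \<nu>"
    and "\<And>t. (\<lambda>n. char (\<mu> n) t) \<longlonglongrightarrow> char \<nu> t"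
  shows "weak_conv_m \<mu> \<nu>"
proof -
  obtain n0 where "\<And>n. n0 \<le> n \<Longrightarrow> real_distribution (\<mu> n)"
    using assms(1) by (auto simp: eventually_sequentially)
  then have "weak_conv_m (\<lambda>n. \<mu> (n + n0)) \<nu>"
    using assms(2,3) by (intro levy_continuity) (auto intro: LIMSEQ_ignore_initial_segment)
  then show ?thesis
    unfolding weak_conv_m_def weak_conv_def by (blast intro: LIMSEQ_offset)
qed

text \<open>As \<open>k < n\<close>, a large \<open>k\<close> makes \<open>n\<close> large too, so
  the joint limit in both arguments suffices: all Gamma ratios tend to \<open>1\<close>, the
  \<open>1 / k\<close> term vanishes, and so does the variance of the threshold factor.\<close>

lemma excess_variance_bound_lim:
  assumes r: "0 \<le> r" and e: "0 < e"
  obtains k0 where "\<And>n k. k0 \<le> k \<Longrightarrow> k < n \<Longrightarrow> excess_variance_bound r n k \<le> e"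
proof -
  let ?F = "sequentially \<times>\<^sub>F sequentially"
  have g: "((\<lambda>p. gamma_ratio a (fst p)) \<longlongrightarrow> 1) ?F" "((\<lambda>p. gamma_ratio a (snd p)) \<longlongrightarrow> 1) ?F" if "0 \<le> a" for a
    using gamma_ratio_lim[OF that] by (auto intro: filterlim_compose filterlim_fst filterlim_snd)
  have i: "((\<lambda>p. 1 / real (snd p)) \<longlongrightarrow> 0) ?F"
    by (rule filterlim_compose[OF lim_1_over_n filterlim_snd])
  have r2: "0 \<le> 2 * r" using r by simp
  have "((\<lambda>p. 4 * (gamma_ratio (2 * r) (fst p) / gamma_ratio (2 * r) (snd p)) * (1 / real (snd p))
     + 2 * (gamma_ratio (2 * r) (fst p) / gamma_ratio (2 * r) (snd p) - (gamma_ratio r (fst p) / gamma_ratio r (snd p))\<^sup>2))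
     \<longlongrightarrow> 4 * (1 / 1) * 0 + 2 * (1 / 1 - (1 / 1)\<^sup>2)) ?F"
    by (intro tendsto_intros g i r r2) auto
  then have "\<forall>\<^sub>F p in ?F. excess_variance_bound r (fst p) (snd p) < e"
    using e by (intro order_tendstoD(2)[of _ 0]) (simp_all add: excess_variance_bound_def)
  then obtain k0 where "\<forall>m\<ge>k0. \<forall>n\<ge>k0. excess_variance_bound r n m < e"
    unfolding eventually_prod_sequentially by auto
  then show thesis by (intro that[of k0]) (auto intro!: less_imp_le)
qed

text \<open>Covers the subsamples with small \<open>k\<close>, where the bound need not be
  small.\<close>

lemma excess_variance_bound_bounded:
  assumes r: "0 \<le> r"
  obtains C where "0 \<le> C" "\<And>n k. 1 \<le> k \<Longrightarrow> k < n \<Longrightarrow> excess_variance_bound r n k \<le> C"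
proof -
  have r2: "0 \<le> 2 * r" using r by simp
  obtain c C where c: "0 < c" "\<And>n. 1 \<le> n \<Longrightarrow> c \<le> gamma_ratio (2 * r) n" "\<And>n. 1 \<le> n \<Longrightarrow> gamma_ratio (2 * r) n \<le> C"
    using gamma_ratio_bounds[OF r2] by metis
  have C: "0 \<le> C" using c(1) c(2)[of 1] c(3)[of 1] by simp
  show thesis
  proof (rule that[of "6 * (C / c)"])
    show "0 \<le> 6 * (C / c)" using C c by simp
    fix n k :: nat assume k: "1 \<le> k" "k < n"
    let ?q = "gamma_ratio (2 * r) n / gamma_ratio (2 * r) k"
    have q: "?q \<le> C / c" using k c C by (intro frac_le) auto
    have q0: "0 \<le> ?q" using k by (intro divide_nonneg_nonneg less_imp_le[OF gamma_ratio_pos[OF r2]]) auto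
    have "x / real k \<le> x" if "0 \<le> x" for x :: real
      using that k mult_left_mono[of 1 "real k" x] by (simp add: divide_le_eq)
    from this[of "4 * ?q"] have "4 * ?q / real k \<le> 4 * ?q" using q0 by linarith
    then have "excess_variance_bound r n k \<le> 4 * ?q + 2 * ?q"
      unfolding excess_variance_bound_def by (intro add_mono) auto
    also have "\<dots> = 6 * ?q" by simp
    also have "\<dots> \<le> 6 * (C / c)" using q by (intro mult_left_mono) auto
    finally show "excess_variance_bound r n k \<le> 6 * (C / c)" .
  qed
qed

section \<open>Aggregation over the subsamples\<close>

locale weighted_hill_setting =
  fixes M :: "nat \<Rightarrow> 'a measure"
    and X :: "nat \<Rightarrow> nat \<Rightarrow> nat \<Rightarrow> 'a \<Rightarrow> real"
    and D :: "real measure"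
    and \<gamma> \<rho> :: real and A :: "real \<Rightarrow> real"
    and m :: "nat \<Rightarrow> nat" and N K :: "nat \<Rightarrow> nat \<Rightarrow> nat"
    and k :: "nat \<Rightarrow> nat"
    and \<omega> :: "nat \<Rightarrow> nat \<Rightarrow> real"
  assumes prob: "\<And>n. prob_space (M n)"
    and indep: "\<And>n. prob_space.indep_vars (M n) (\<lambda>_. borel) (\<lambda>(j, i). X n i j)
                  (SIGMA j:{1..m n}. {1..N n j})"
    and ident: "\<And>n j i. j \<in> {1..m n} \<Longrightarrow> i \<in> {1..N n j} \<Longrightarrow> distr (M n) borel (X n i j) = D"
    and distD: "real_distribution D"
    and C2: "second_order_condition (cdf D) \<gamma> \<rho> A"
    and m_lim: "filterlim m at_top sequentially"
    and N_lim: "filterlim (\<lambda>n. INF j\<in>{1..m n}. real (N n j) / ln (real (m n))) at_top sequentially"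
    and K_pos: "\<And>n j. n \<ge> 1 \<Longrightarrow> j \<in> {1..m n} \<Longrightarrow> K n j \<ge> 1"
    and k_def: "\<And>n. k n = (\<Sum>j=1..m n. K n j)"
    and w_sum: "\<And>n. n \<ge> 1 \<Longrightarrow> (\<Sum>j=1..m n. \<omega> n j) = 1"
    and w_limsup: "limsup (\<lambda>n. ereal (real (k n) * (\<Sum>j=1..m n. (\<omega> n j)\<^sup>2 / real (K n j)))) < \<infinity>"
    and w_lyapunov: "\<exists>\<delta>>0. (\<lambda>n.
          (\<Sum>j=1..m n. real (K n j) powr (- \<delta> / 2) * ((\<omega> n j)\<^sup>2 / real (K n j)) powr (1 + \<delta> / 2))
          / (\<Sum>j=1..m n. (\<omega> n j)\<^sup>2 / real (K n j)) powr (1 + \<delta> / 2)) \<longlonglongrightarrow> 0"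
    and KN_lim: "(\<lambda>n. SUP j\<in>{1..m n}. real (K n j) / real (N n j)) \<longlonglongrightarrow> 0"
    and A_bigo: "(\<lambda>n. sqrt (real (k n)) * (SUP j\<in>{1..m n}. \<bar>A (real (N n j) / real (K n j))\<bar>))
                   \<in> O(\<lambda>_. 1)"
begin

section \<open>Consequences of the asymptotic hypotheses, uniform over the subsamples\<close>

definition "S2 n = (\<Sum>j=1..m n. (\<omega> n j)\<^sup>2 / real (K n j))"

text \<open>The limit of the mean of \<open>W\<close> as the subsample size grows with
  \<open>j\<close> upper order statistics; \<open>hill_bias\<close> is the weighted sum of
  \<open>\<beta> (K j)\<close> times \<open>A (N j / K j)\<close>.\<close>

definition "\<beta> j = 1 / (1 - \<rho>) * (real j powr \<rho> * (Gamma (real j - \<rho> + 1) / fact j))"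

lemma gam: "0 < \<gamma>" and rho: "\<rho> \<le> 0"
  using C2 unfolding second_order_condition_def by blast+

lemma ev_m: "\<forall>\<^sub>F n in sequentially. c \<le> real (m n)"
proof -
  have "\<forall>\<^sub>F n in sequentially. nat \<lceil>c\<rceil> \<le> m n" using m_lim unfolding filterlim_at_top by blast
  then show ?thesis by eventually_elim (simp add: nat_ceiling_le_eq)
qed

lemma ev_N_ln: "\<forall>\<^sub>F n in sequentially. \<forall>j\<in>{1..m n}. R * ln (real (m n)) \<le> real (N n j)"
proof -
  have "\<forall>\<^sub>F n in sequentially. R \<le> (INF j\<in>{1..m n}. real (N n j) / ln (real (m n)))"
    using N_lim by (simp add: filterlim_at_top)
  then show ?thesis using ev_m[of 2]
  proof eventually_elim
    case (elim n)
    show ?case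
    proof
      fix j assume j: "j \<in> {1..m n}"
      have "(INF j\<in>{1..m n}. real (N n j) / ln (real (m n))) \<le> real (N n j) / ln (real (m n))"
        by (rule cINF_lower[OF _ j]) auto
      with elim(1) have "R \<le> real (N n j) / ln (real (m n))" by linarith
      moreover have "0 < ln (real (m n))" using elim(2) by simp
      ultimately show "R * ln (real (m n)) \<le> real (N n j)" by (simp add: pos_le_divide_eq)
    qed
  qed
qed

lemma ev_N: "\<forall>\<^sub>F n in sequentially. \<forall>j\<in>{1..m n}. R \<le> real (N n j)"
  using ev_N_ln[of "max R 0"] ev_m[of "exp 1"]
proof eventually_elim
  case (elim n)
  have "1 \<le> ln (real (m n))"
    using elim(2) less_le_trans[OF exp_gt_zero elim(2)] by (subst ln_ge_iff) auto
  then have "max R 0 * 1 \<le> max R 0 * ln (real (m n))" by (intro mult_left_mono) auto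
  then show ?case using elim(1) by force
qed

lemma ev_K:
  assumes "0 < e"
  shows "\<forall>\<^sub>F n in sequentially. \<forall>j\<in>{1..m n}. real (K n j) \<le> e * real (N n j)"
proof -
  have "\<forall>\<^sub>F n in sequentially. (SUP j\<in>{1..m n}. real (K n j) / real (N n j)) < e"
    using KN_lim assms by (rule order_tendstoD)
  then show ?thesis using ev_N[of 1]
  proof eventually_elim
    case (elim n)
    show ?case
    proof
      fix j assume j: "j \<in> {1..m n}"
      have "real (K n j) / real (N n j) \<le> (SUP j\<in>{1..m n}. real (K n j) / real (N n j))"
        by (rule cSUP_upper[OF j]) auto
      then have "real (K n j) / real (N n j) \<le> e" using elim(1) by linarith
      moreover have "0 < real (N n j)" using elim(2) j by force
      ultimately show "real (K n j) \<le> e * real (N n j)" by (simp add: pos_divide_le_eq)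
    qed
  qed
qed

lemma ev_KN: "\<forall>\<^sub>F n in sequentially. 1 \<le> n \<and> (\<forall>j\<in>{1..m n}. 1 \<le> K n j \<and> K n j < N n j)"
proof -
  have "0 < (1/2::real)" by simp
  from ev_K[OF this] ev_N[of 1] eventually_ge_at_top[of 1] show ?thesis
  proof eventually_elim
    case (elim n)
    have "1 \<le> K n j \<and> K n j < N n j" if "j \<in> {1..m n}" for j
    proof
      show "1 \<le> K n j" by (rule K_pos[OF elim(3) that])
      have "real (K n j) < real (N n j)" using elim(1,2) that by fastforce
      then show "K n j < N n j" by simp
    qed
    then show ?case using elim(3) by blast
  qed
qed

lemma ev_ratio: "\<forall>\<^sub>F n in sequentially. \<forall>j\<in>{1..m n}. s0 \<le> ln (real (N n j) / real (K n j))"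
  using ev_K[of "exp (- s0)", OF exp_gt_zero] ev_KN
proof eventually_elim
  case (elim n)
  show ?case
  proof
    fix j assume j: "j \<in> {1..m n}"
    then have K: "0 < real (K n j)" "0 < real (N n j)" using elim(2) by force+
    have "real (K n j) \<le> exp (- s0) * real (N n j)" using elim(1) j by blast
    then have "exp s0 * real (K n j) \<le> exp s0 * (exp (- s0) * real (N n j))" by (rule mult_left_mono) simp
    also have "\<dots> = real (N n j)" by (simp add: exp_minus)
    finally have "exp s0 \<le> real (N n j) / real (K n j)" using K by (simp add: pos_le_divide_eq)
    then show "s0 \<le> ln (real (N n j) / real (K n j))" using K by (subst ln_ge_iff) auto
  qed
qed

text \<open>Cauchy-Schwarz for \<open>\<bar>\<omega>\<bar> = (\<bar>\<omega>\<bar> / sqrt K) * sqrt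
  K\<close>. As the weights sum to \<open>1\<close>, it also yields \<open>1 \<le> k * S2\<close>;
  this explains \<open>v \<ge> 1\<close> in the theorem and bounds \<open>1 / sqrt S2\<close> by
  \<open>sqrt k\<close>.\<close>

lemma kS2_ge:
  assumes "1 \<le> n" "\<forall>j\<in>{1..m n}. 1 \<le> K n j"
  shows "(\<Sum>j=1..m n. \<bar>\<omega> n j\<bar>)\<^sup>2 \<le> real (k n) * S2 n" "1 \<le> real (k n) * S2 n"
proof -
  have "(\<Sum>j=1..m n. \<bar>\<omega> n j\<bar>)\<^sup>2 = (\<Sum>j=1..m n. (\<bar>\<omega> n j\<bar> / sqrt (real (K n j))) * sqrt (real (K n j)))\<^sup>2"
  proof (intro arg_cong[where f="\<lambda>x. x\<^sup>2"] sum.cong refl)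
    fix j assume "j \<in> {1..m n}"
    then have "1 \<le> K n j" using assms(2) by blast
    then show "\<bar>\<omega> n j\<bar> = \<bar>\<omega> n j\<bar> / sqrt (real (K n j)) * sqrt (real (K n j))" by simp
  qed
  also have "\<dots> \<le> (\<Sum>j=1..m n. (\<bar>\<omega> n j\<bar> / sqrt (real (K n j)))\<^sup>2) * (\<Sum>j=1..m n. (sqrt (real (K n j)))\<^sup>2)"
    by (rule Cauchy_Schwarz_ineq_sum)
  also have "\<dots> = real (k n) * S2 n"
    by (simp add: S2_def k_def power_divide mult.commute)
  finally show *: "(\<Sum>j=1..m n. \<bar>\<omega> n j\<bar>)\<^sup>2 \<le> real (k n) * S2 n" .
  have "1 \<le> (\<Sum>j=1..m n. \<bar>\<omega> n j\<bar>)"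
    using w_sum[OF assms(1)] sum_mono[of "{1..m n}" "\<omega> n" "\<lambda>j. \<bar>\<omega> n j\<bar>"] by simp
  then have "1 \<le> (\<Sum>j=1..m n. \<bar>\<omega> n j\<bar>)\<^sup>2" by (rule one_le_power)
  with * show "1 \<le> real (k n) * S2 n" by linarith
qed

lemma S2_nonneg: "0 \<le> S2 n"
  unfolding S2_def by (intro sum_nonneg divide_nonneg_nonneg) auto

lemma kS2_bounded:
  obtains L where "1 \<le> L" "\<forall>\<^sub>F n in sequentially. real (k n) * S2 n \<le> L"
proof -
  obtain C :: ereal where C: "limsup (\<lambda>n. ereal (real (k n) * S2 n)) < C" "C < \<infinity>"
    using w_limsup dense unfolding S2_def by blast
  from Limsup_lessD[OF C(1)] have "\<forall>\<^sub>F n in sequentially. real (k n) * S2 n \<le> max 1 (real_of_ereal C)"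
  proof eventually_elim
    case (elim n)
    then show ?case using C(2) by (cases C) auto
  qed
  then show thesis by (intro that[of "max 1 (real_of_ereal C)"]) auto
qed

text \<open>\<open>k * S2\<close> stays bounded, while \<open>k \<ge> m\<close> tends to infinity
  because every \<open>K\<close> is at least \<open>1\<close>.\<close>

lemma ev_S2_small:
  assumes "0 < e" shows "\<forall>\<^sub>F n in sequentially. S2 n \<le> e"
proof -
  obtain L where L: "1 \<le> L" "\<forall>\<^sub>F n in sequentially. real (k n) * S2 n \<le> L"
    by (rule kS2_bounded)
  from L(2) ev_m[of "L / e"] ev_KN show ?thesis
  proof eventually_elim
    case (elim n)
    have "(\<Sum>j=1..m n. 1) \<le> (\<Sum>j=1..m n. K n j)" using elim(3) by (intro sum_mono) blast
    then have "m n \<le> k n" by (simp add: k_def)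
    then have "L / e \<le> real (k n)" using elim(2) by linarith
    then have "L / e * S2 n \<le> L"
      using mult_right_mono[OF _ S2_nonneg[of n]] elim(1) by (meson order_trans)
    then have "L * S2 n \<le> L * e" using assms by (simp add: field_simps)
    then show ?case using L(1) by simp
  qed
qed

lemma ev_A_bound:
  obtains B where "0 \<le> B" "\<forall>\<^sub>F n in sequentially. \<forall>j\<in>{1..m n}. sqrt (real (k n)) * \<bar>A (real (N n j) / real (K n j))\<bar> \<le> B"
proof -
  obtain B where B: "0 < B" "\<forall>\<^sub>F n in sequentially.
      norm (sqrt (real (k n)) * (SUP j\<in>{1..m n}. \<bar>A (real (N n j) / real (K n j))\<bar>)) \<le> B * norm (1::real)"
    using A_bigo by (rule landau_o.bigE)
  from B(2) have "\<forall>\<^sub>F n in sequentially. \<forall>j\<in>{1..m n}. sqrt (real (k n)) * \<bar>A (real (N n j) / real (K n j))\<bar> \<le> B"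
  proof eventually_elim
    case (elim n)
    show ?case
    proof
      fix j assume j: "j \<in> {1..m n}"
      have "\<bar>A (real (N n j) / real (K n j))\<bar> \<le> (SUP j\<in>{1..m n}. \<bar>A (real (N n j) / real (K n j))\<bar>)"
        by (rule cSUP_upper[OF j]) auto
      then have "sqrt (real (k n)) * \<bar>A (real (N n j) / real (K n j))\<bar>
          \<le> sqrt (real (k n)) * (SUP j\<in>{1..m n}. \<bar>A (real (N n j) / real (K n j))\<bar>)"
        by (rule mult_left_mono) simp
      also have "\<dots> \<le> B" using elim by (auto intro: order_trans[OF abs_ge_self])
      finally show "sqrt (real (k n)) * \<bar>A (real (N n j) / real (K n j))\<bar> \<le> B" .
    qed
  qed
  then show thesis using B(1) by (intro that[of B]) auto
qed

text \<open>
  With \<open>x = (\<omega> j)^2 / (K j^2 S2)\<close>, the \<open>j\<close>-th term of the Lyapunov ratio is \<open>K j * x powr (1 + \<delta> / 2)\<close>.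
\<close>

lemma ev_weight_small:
  assumes "0 < e"
  shows "\<forall>\<^sub>F n in sequentially. \<forall>j\<in>{1..m n}. \<bar>\<omega> n j\<bar> / real (K n j) \<le> e * sqrt (S2 n)"
proof -
  obtain \<delta> where \<delta>: "0 < \<delta>" "(\<lambda>n.
          (\<Sum>j=1..m n. real (K n j) powr (- \<delta> / 2) * ((\<omega> n j)\<^sup>2 / real (K n j)) powr (1 + \<delta> / 2))
          / S2 n powr (1 + \<delta> / 2)) \<longlonglongrightarrow> 0"
    using w_lyapunov unfolding S2_def by blast
  have "0 < (e\<^sup>2) powr (1 + \<delta> / 2)" using assms by simp
  from order_tendstoD(2)[OF \<delta>(2) this] ev_KN show ?thesis
  proof eventually_elim
    case (elim n)
    have KS: "1 \<le> real (k n) * S2 n" using elim(2) by (intro kS2_ge) auto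
    have "S2 n \<noteq> 0" using KS by auto
    then have S: "0 < S2 n" using S2_nonneg[of n] by simp
    show ?case
    proof
      fix j assume j: "j \<in> {1..m n}"
      have K: "1 \<le> real (K n j)" using elim(2) j by simp
      define x where "x = (\<omega> n j)\<^sup>2 / ((real (K n j))\<^sup>2 * S2 n)"
      have x: "0 \<le> x" using S by (simp add: x_def)
      have "(\<omega> n j)\<^sup>2 / real (K n j) = x * real (K n j) * S2 n"
        using S K by (simp add: x_def power2_eq_square)
      then have "((\<omega> n j)\<^sup>2 / real (K n j)) powr (1 + \<delta> / 2)
          = x powr (1 + \<delta> / 2) * real (K n j) powr (1 + \<delta> / 2) * S2 n powr (1 + \<delta> / 2)"
        using x S by (simp add: powr_mult)
      then have "real (K n j) powr (- \<delta> / 2) * ((\<omega> n j)\<^sup>2 / real (K n j)) powr (1 + \<delta> / 2)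
          = x powr (1 + \<delta> / 2) * (real (K n j) powr (- \<delta> / 2) * real (K n j) powr (1 + \<delta> / 2)) * S2 n powr (1 + \<delta> / 2)"
        by (simp add: mult_ac)
      also have "real (K n j) powr (- \<delta> / 2) * real (K n j) powr (1 + \<delta> / 2) = real (K n j)"
        using K by (simp add: powr_add[symmetric])
      finally have trm: "real (K n j) powr (- \<delta> / 2) * ((\<omega> n j)\<^sup>2 / real (K n j)) powr (1 + \<delta> / 2)
          = x powr (1 + \<delta> / 2) * real (K n j) * S2 n powr (1 + \<delta> / 2)" .
      \<comment> \<open>Dropping \<open>K \<ge> 1\<close> and bounding one term by the whole
        nonnegative sum turns the Lyapunov ratio into a bound valid for every
        \<open>j\<close>.\<close>
      have "x powr (1 + \<delta> / 2) * 1 \<le> x powr (1 + \<delta> / 2) * real (K n j)"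
        using K by (intro mult_left_mono) auto
      also have "\<dots> = real (K n j) powr (- \<delta> / 2) * ((\<omega> n j)\<^sup>2 / real (K n j)) powr (1 + \<delta> / 2) / S2 n powr (1 + \<delta> / 2)"
        unfolding trm using S by simp
      also have "\<dots> \<le> (\<Sum>j=1..m n. real (K n j) powr (- \<delta> / 2) * ((\<omega> n j)\<^sup>2 / real (K n j)) powr (1 + \<delta> / 2)) / S2 n powr (1 + \<delta> / 2)"
        using j by (intro divide_right_mono member_le_sum) auto
      also have "\<dots> < (e\<^sup>2) powr (1 + \<delta> / 2)" by (rule elim(1))
      finally have "x powr (1 + \<delta> / 2) < (e\<^sup>2) powr (1 + \<delta> / 2)" by simp
      then have "x < e\<^sup>2" using powr_less_cancel2[of "1 + \<delta> / 2" x "e\<^sup>2"] x \<delta>(1) assms by (cases "x = 0") auto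
      then have "(\<omega> n j)\<^sup>2 \<le> e\<^sup>2 * ((real (K n j))\<^sup>2 * S2 n)"
        using S K by (simp add: x_def pos_divide_less_eq)
      then have "\<bar>\<omega> n j\<bar>\<^sup>2 \<le> (e * real (K n j) * sqrt (S2 n))\<^sup>2"
        using S by (simp add: power_mult_distrib mult.assoc)
      then have "\<bar>\<omega> n j\<bar> \<le> e * real (K n j) * sqrt (S2 n)"
        by (rule power2_le_imp_le) (use assms S in auto)
      then show "\<bar>\<omega> n j\<bar> / real (K n j) \<le> e * sqrt (S2 n)"
        using K by (simp add: pos_divide_le_eq mult_ac)
    qed
  qed
qed

text \<open>Each lower tail is at most \<open>exp (- \<theta> * N)\<close>, and
  \<open>N \<ge> 2 / \<theta> * ln m\<close> brings this below \<open>1 / m^2\<close>;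
  \<open>m\<close> such terms sum to at most \<open>1 / m\<close>. This is where the growth of
  \<open>N\<close> relative to \<open>ln m\<close> enters.\<close>

lemma ev_tail_sum:
  assumes "0 < e"
  shows "\<forall>\<^sub>F n in sequentially. (\<Sum>j=1..m n. measure (threshold_law (N n j) (K n j)) {..<s0}) \<le> e"
proof -
  define \<theta> where "\<theta> = exp (- 1 - s0) / 3"
  have \<theta>: "0 < \<theta>" by (simp add: \<theta>_def)
  from ev_K[OF \<theta>] ev_N[of "1 / \<theta>"] ev_N_ln[of "2 / \<theta>"] ev_m[of "1 / e"] ev_m[of 1] ev_KN show ?thesis
  proof eventually_elim
    case (elim n)
    have mpos: "0 < real (m n)" using elim(5) by simp
    have "measure (threshold_law (N n j) (K n j)) {..<s0} \<le> 1 / (real (m n))\<^sup>2" if j: "j \<in> {1..m n}" for j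
    proof -
      have "measure (threshold_law (N n j) (K n j)) {..<s0} \<le> exp (- \<theta> * real (N n j))"
        unfolding \<theta>_def
      proof (rule threshold_lower_tail)
        show "1 \<le> K n j" "K n j < N n j" using elim(6) j by auto
        show "real (K n j) \<le> exp (- 1 - s0) / 3 * real (N n j)" using elim(1) j by (simp add: \<theta>_def)
        have "1 / \<theta> \<le> real (N n j)" using elim(2) j by blast
        then have "1 \<le> \<theta> * real (N n j)" using \<theta> by (simp add: pos_divide_le_eq mult.commute)
        then show "1 \<le> exp (- 1 - s0) / 3 * real (N n j)" by (simp add: \<theta>_def)
      qed
      also have "\<dots> \<le> exp (- (2 * ln (real (m n))))"
      proof -
        have "\<theta> * (2 / \<theta> * ln (real (m n))) \<le> \<theta> * real (N n j)"
          using elim(3) j \<theta> by (intro mult_left_mono) auto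
        then show ?thesis using \<theta> by simp
      qed
      also have "\<dots> = 1 / (real (m n))\<^sup>2"
        using mpos by (simp add: exp_minus exp_double inverse_eq_divide)
      finally show ?thesis .
    qed
    then have "(\<Sum>j=1..m n. measure (threshold_law (N n j) (K n j)) {..<s0}) \<le> (\<Sum>j=1..m n. 1 / (real (m n))\<^sup>2)"
      by (rule sum_mono)
    also have "\<dots> = 1 / real (m n)" using mpos by (simp add: power2_eq_square)
    also have "\<dots> \<le> e" using elim(4) assms mpos by (simp add: field_simps)
    finally show ?case .
  qed
qed

text \<open>The variance bound is small for \<open>K \<ge> k0\<close> and at most \<open>C\<close>
  otherwise, hence at most \<open>e / (2 * L) + C' / K\<close> in all cases. The first part is
  summed against \<open>\<omega>^2\<close>, whose total is at most \<open>L\<close>; the second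
  against \<open>\<omega>^2 / K\<close>, whose total \<open>S2\<close> vanishes. So bounded and
  unbounded \<open>K\<close> need no separate theorem.\<close>

lemma ev_variance_sum:
  assumes "0 < e"
  shows "\<forall>\<^sub>F n in sequentially. (\<Sum>j=1..m n. (\<omega> n j)\<^sup>2 * excess_variance_bound (- \<rho>) (N n j) (K n j)) \<le> e"
proof -
  have r: "0 \<le> - \<rho>" using rho by simp
  obtain L where L: "1 \<le> L" "\<forall>\<^sub>F n in sequentially. real (k n) * S2 n \<le> L"
    by (rule kS2_bounded)
  have "0 < e / (2 * L)" using assms L by simp
  then obtain k0 where k0: "\<And>n k. k0 \<le> k \<Longrightarrow> k < n \<Longrightarrow> excess_variance_bound (- \<rho>) n k \<le> e / (2 * L)"
    using excess_variance_bound_lim[OF r] by blast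
  obtain C where C: "0 \<le> C" "\<And>n k. 1 \<le> k \<Longrightarrow> k < n \<Longrightarrow> excess_variance_bound (- \<rho>) n k \<le> C"
    using excess_variance_bound_bounded[OF r] by blast
  define C' where "C' = C * real k0 + 1"
  have C': "0 < C'" using C by (simp add: C'_def add_nonneg_pos)
  have "0 < e / (2 * C')" using assms C' by simp
  from ev_S2_small[OF this] L(2) ev_KN show ?thesis
  proof eventually_elim
    case (elim n)
    have "(\<Sum>j=1..m n. (\<omega> n j)\<^sup>2) \<le> (\<Sum>j=1..m n. \<bar>\<omega> n j\<bar>)\<^sup>2"
    proof -
      have "(\<Sum>j=1..m n. \<bar>\<omega> n j\<bar> * \<bar>\<omega> n j\<bar>) \<le> (\<Sum>j=1..m n. \<bar>\<omega> n j\<bar> * (\<Sum>i=1..m n. \<bar>\<omega> n i\<bar>))"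
        by (intro sum_mono mult_left_mono member_le_sum) auto
      then show ?thesis by (simp add: power2_eq_square sum_distrib_right[symmetric])
    qed
    also have "\<dots> \<le> real (k n) * S2 n" using elim(3) by (intro kS2_ge) auto
    also have "\<dots> \<le> L" by (rule elim(2))
    finally have wL: "(\<Sum>j=1..m n. (\<omega> n j)\<^sup>2) \<le> L" .
    have "(\<omega> n j)\<^sup>2 * excess_variance_bound (- \<rho>) (N n j) (K n j)
        \<le> e / (2 * L) * (\<omega> n j)\<^sup>2 + C' * ((\<omega> n j)\<^sup>2 / real (K n j))" if j: "j \<in> {1..m n}" for j
    proof -
      have K: "1 \<le> K n j" "K n j < N n j" using elim(3) j by auto
      have "excess_variance_bound (- \<rho>) (N n j) (K n j) \<le> e / (2 * L) + C' / real (K n j)"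
      proof (cases "k0 \<le> K n j")
        case True
        have "0 \<le> C' / real (K n j)" using C' by simp
        then show ?thesis using k0[OF True K(2)] by linarith
      next
        case False
        have "C * real (K n j) \<le> C * real k0" using False C by (intro mult_left_mono) auto
        then have "C * real (K n j) \<le> C'" unfolding C'_def by linarith
        then have "C \<le> C' / real (K n j)" using K by (simp add: pos_le_divide_eq)
        moreover have "0 \<le> e / (2 * L)" using assms L by simp
        ultimately show ?thesis using C(2)[OF K] by linarith
      qed
      then have "(\<omega> n j)\<^sup>2 * excess_variance_bound (- \<rho>) (N n j) (K n j) \<le> (\<omega> n j)\<^sup>2 * (e / (2 * L) + C' / real (K n j))"
        by (rule mult_left_mono) simp
      then show ?thesis by (simp add: distrib_left mult_ac)
    qed
    then have "(\<Sum>j=1..m n. (\<omega> n j)\<^sup>2 * excess_variance_bound (- \<rho>) (N n j) (K n j))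
        \<le> (\<Sum>j=1..m n. e / (2 * L) * (\<omega> n j)\<^sup>2 + C' * ((\<omega> n j)\<^sup>2 / real (K n j)))"
      by (rule sum_mono)
    also have "\<dots> = e / (2 * L) * (\<Sum>j=1..m n. (\<omega> n j)\<^sup>2) + C' * S2 n"
      by (simp only: sum.distrib sum_distrib_left[symmetric] S2_def)
    also have "\<dots> \<le> e / (2 * L) * L + C' * (e / (2 * C'))"
      using wL elim(1) assms L C' by (intro add_mono mult_left_mono) auto
    also have "\<dots> = e" using L C' by simp
    finally show ?case .
  qed
qed

lemma \<beta>_eq:
  assumes "1 \<le> j" shows "\<beta> j = 1 / gamma_ratio (- \<rho>) j / (1 - \<rho>)"
proof -
  have "fact j = Gamma (real j + 1)" using Gamma_fact[of j, where 'a=real] by (simp add: add_ac)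
  moreover have "real j powr \<rho> = 1 / real j powr (- \<rho>)" by (simp add: powr_minus_divide)
  ultimately show ?thesis
    by (simp add: \<beta>_def gamma_ratio_def add_ac)
qed

text \<open>All \<open>N\<close> are uniformly large, so the Gamma ratios in the numerators are
  uniformly close to \<open>1\<close>, and those in the denominators are bounded below for every
  \<open>K \<ge> 1\<close>. The constant \<open>b\<close> is fixed before \<open>e\<close>.\<close>

lemma ev_bias:
  obtains b where "0 \<le> b" "\<And>e. 0 < e \<Longrightarrow> \<forall>\<^sub>F n in sequentially. \<forall>j\<in>{1..m n}.
    \<bar>gamma_ratio (- \<rho>) (N n j) / gamma_ratio (- \<rho>) (K n j) / (1 - \<rho>) - \<beta> (K n j)\<bar> \<le> b * e"
proof -
  have r: "0 \<le> - \<rho>" using rho by simp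
  obtain c where c: "0 < c" "\<And>n. 1 \<le> n \<Longrightarrow> c \<le> gamma_ratio (- \<rho>) n"
    using gamma_ratio_bounds[OF r] by metis
  show thesis
  proof (rule that[of "1 / c"])
    fix e :: real assume e: "0 < e"
    have "\<forall>\<^sub>F n in sequentially. \<bar>gamma_ratio (- \<rho>) n - 1\<bar> < e"
      using tendstoD[OF gamma_ratio_lim[OF r] e] by (simp add: dist_real_def)
    then obtain n0 where n0: "\<And>n. n0 \<le> n \<Longrightarrow> \<bar>gamma_ratio (- \<rho>) n - 1\<bar> < e"
      by (auto simp: eventually_sequentially)
    from ev_N[of "real n0"] ev_KN
    show "\<forall>\<^sub>F n in sequentially. \<forall>j\<in>{1..m n}.
      \<bar>gamma_ratio (- \<rho>) (N n j) / gamma_ratio (- \<rho>) (K n j) / (1 - \<rho>) - \<beta> (K n j)\<bar> \<le> 1 / c * e"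
    proof eventually_elim
      case (elim n)
      show ?case
      proof
        fix j assume j: "j \<in> {1..m n}"
        let ?g = "gamma_ratio (- \<rho>)"
        have K: "1 \<le> K n j" using elim(2) j by blast
        have g: "c \<le> ?g (K n j)" "0 < ?g (K n j)" using c K less_le_trans by blast+
        have "n0 \<le> N n j" using elim(1) j by auto
        then have N: "\<bar>?g (N n j) - 1\<bar> \<le> e" using n0 by (meson less_imp_le)
        have "?g (N n j) / ?g (K n j) / (1 - \<rho>) - \<beta> (K n j) = (1 / (?g (K n j) * (1 - \<rho>))) * (?g (N n j) - 1)"
          unfolding \<beta>_eq[OF K] by (simp add: right_diff_distrib)
        also have "\<bar>\<dots>\<bar> = (1 / (?g (K n j) * (1 - \<rho>))) * \<bar>?g (N n j) - 1\<bar>"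
          using g rho by (simp add: abs_mult)
        also have "\<dots> \<le> (1 / c) * e"
        proof (rule mult_mono)
          have "c * 1 \<le> ?g (K n j) * (1 - \<rho>)" using g rho c by (intro mult_mono) auto
          then show "1 / (?g (K n j) * (1 - \<rho>)) \<le> 1 / c" using c by (intro divide_left_mono) (use g rho in auto)
        qed (use N c in auto)
        finally show "\<bar>?g (N n j) / ?g (K n j) / (1 - \<rho>) - \<beta> (K n j)\<bar> \<le> 1 / c * e" .
      qed
    qed
  qed (use c in simp)
qed

end

text \<open>It dominates the integral of a square.\<close>

lemma (in one_sample) variance_bound_nonneg: "0 \<le> excess_variance_bound (- \<rho>) n k"
  by (rule order_trans[OF _ W_variance(2)]) simp

context weighted_hill_setting
begin

section \<open>Characteristic function of the weighted statistic and passage to the limit\<close>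

definition "Q l = tail_quantile (cdf D) (exp l)"

definition "statistic \<tau> n s = \<tau> * (weighted_hill_estimator (m n) (\<omega> n) (K n) (N n) (\<lambda>i j. X n i j s)
                    - \<gamma> - hill_bias \<rho> A (m n) (\<omega> n) (K n) (N n))"

text \<open>Characteristic function at \<open>c\<close> of the centred Hill statistic of subsample
  \<open>j\<close>, written on \<open>excess_law\<close> so that the spaces \<open>M n\<close> no
  longer occur.\<close>

definition "factor c n j = (\<integral>p. iexp (c * (excess_hill Q (K n j) p - \<gamma> - A (real (N n j) / real (K n j)) * \<beta> (K n j)))
      \<partial>excess_law (N n j) (K n j))"

lemma Q_measurable [measurable]: "Q \<in> borel_measurable borel"
  using measurable_quantile[OF distD] by (simp add: Q_def[abs_def])

lemma char_statistic:
  assumes n: "1 \<le> n" and KN: "\<forall>j\<in>{1..m n}. 1 \<le> K n j \<and> K n j < N n j"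
  shows "real_distribution (distr (M n) borel (statistic \<tau> n))"
    and "char (distr (M n) borel (statistic \<tau> n)) u = (\<Prod>j=1..m n. factor (u * \<tau> * \<omega> n j) n j)"
proof -
  interpret prob_space "M n" by (rule prob)
  define \<alpha> where "\<alpha> j = A (real (N n j) / real (K n j))" for j
  define Z where "Z j s = hill_estimator (K n j) (N n j) (\<lambda>i. X n i j s)" for j s
  define Y where "Y j s = \<tau> * \<omega> n j * (Z j s - \<gamma> - \<alpha> j * \<beta> (K n j))" for j s
  have indZ: "indep_vars (\<lambda>_. borel) Z {1..m n}"
    unfolding Z_def[abs_def] by (rule indep_subsamples[OF indep]) (use KN in blast)
  have indY: "indep_vars (\<lambda>_. borel) Y {1..m n}"
    unfolding Y_def[abs_def]
    by (rule indep_vars_compose2[OF indZ, where Y="\<lambda>j z. \<tau> * \<omega> n j * (z - \<gamma> - \<alpha> j * \<beta> (K n j))"]) measurable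
  have rvZ [measurable]: "random_variable borel (Z j)" if "j \<in> {1..m n}" for j
    using indZ that by (auto simp: indep_vars_def)
  have rvY [measurable]: "random_variable borel (Y j)" if "j \<in> {1..m n}" for j
    using indY that by (auto simp: indep_vars_def)
  have stat: "statistic \<tau> n = (\<lambda>s. \<Sum>j=1..m n. Y j s)"
  proof
    fix s
    have bias: "hill_bias \<rho> A (m n) (\<omega> n) (K n) (N n) = (\<Sum>j=1..m n. \<omega> n j * (\<alpha> j * \<beta> (K n j)))"
      unfolding hill_bias_def \<alpha>_def \<beta>_def by (simp add: sum_distrib_left mult_ac)
    \<comment> \<open>The weights sum to \<open>1\<close>, so the centring \<open>\<gamma>\<close>
      can be distributed over the subsamples and the statistic is a sum of independent
      terms.\<close>
    have "\<gamma> = (\<Sum>j=1..m n. \<omega> n j * \<gamma>)"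
      using w_sum[OF n] by (simp only: sum_distrib_right[symmetric])
    then have "statistic \<tau> n s = \<tau> * ((\<Sum>j=1..m n. \<omega> n j * Z j s) - (\<Sum>j=1..m n. \<omega> n j * \<gamma>) - (\<Sum>j=1..m n. \<omega> n j * (\<alpha> j * \<beta> (K n j))))"
      unfolding statistic_def weighted_hill_estimator_def bias Z_def by simp
    also have "\<dots> = (\<Sum>j=1..m n. \<tau> * (\<omega> n j * Z j s - \<omega> n j * \<gamma> - \<omega> n j * (\<alpha> j * \<beta> (K n j))))"
      by (simp only: sum_subtractf[symmetric] sum_distrib_left)
    also have "\<dots> = (\<Sum>j=1..m n. Y j s)"
      by (intro sum.cong refl) (simp add: Y_def algebra_simps)
    finally show "statistic \<tau> n s = (\<Sum>j=1..m n. Y j s)" .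
  qed
  show "real_distribution (distr (M n) borel (statistic \<tau> n))"
    unfolding stat by (intro real_distribution_distr borel_measurable_sum rvY)
  have "char (distr (M n) borel (Y j)) u = factor (u * \<tau> * \<omega> n j) n j" if j: "j \<in> {1..m n}" for j
  proof -
    have K: "1 \<le> K n j" "K n j < N n j" using KN j by auto
    let ?c = "u * \<tau> * \<omega> n j"
    let ?\<phi> = "\<lambda>z. iexp (?c * (z - \<gamma> - \<alpha> j * \<beta> (K n j)))"
    have dZ: "distr (M n) borel (Z j) = distr (excess_law (N n j) (K n j)) borel (excess_hill Q (K n j))"
      unfolding Z_def[abs_def] Q_def[abs_def]
    proof (rule distr_hill_subsample[OF _ K _ distD])
      \<comment> \<open>Grouping by the singletons \<open>{(j, i)}\<close> with \<open>j\<close>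
        fixed extracts one subsample from the doubly indexed family and reindexes it by
        \<open>i\<close>.\<close>
      have "indep_vars (\<lambda>i. PiM {(j, i)} (\<lambda>_. borel)) (\<lambda>i s. restrict (\<lambda>p. (\<lambda>(j, i). X n i j) p s) {(j, i)}) {1..N n j}"
        by (rule indep_vars_restrict[OF indep]) (use j in \<open>auto simp: disjoint_family_on_def\<close>)
      then have "indep_vars (\<lambda>_. borel) (\<lambda>i s. (restrict (\<lambda>p. (\<lambda>(j, i). X n i j) p s) {(j, i)}) (j, i)) {1..N n j}"
        by (rule indep_vars_compose2[where Y="\<lambda>i f. f (j, i)"]) (auto intro: measurable_component_singleton)
      then show "indep_vars (\<lambda>_. borel) (\<lambda>i s. X n i j s) {1..N n j}" by simp
      show "distr (M n) borel (\<lambda>s. X n i j s) = D" if "i \<in> {1..N n j}" for i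
        using ident[OF j that] by simp
    qed
    have mX: "excess_hill Q (K n j) \<in> borel_measurable (excess_law (N n j) (K n j))"
      using measurable_excess_hill[OF Q_measurable, of "K n j"] by (simp add: measurable_cong_sets[OF sets_excess_law refl])
    have "char (distr (M n) borel (Y j)) u = (\<integral>s. ?\<phi> (Z j s) \<partial>M n)"
      unfolding char_def using j by (subst integral_distr) (auto simp: Y_def mult.assoc)
    also have "\<dots> = (\<integral>z. ?\<phi> z \<partial>distr (M n) borel (Z j))"
      using j by (intro integral_distr[symmetric]) auto
    also have "\<dots> = (\<integral>p. ?\<phi> (excess_hill Q (K n j) p) \<partial>excess_law (N n j) (K n j))"
      unfolding dZ using mX by (intro integral_distr) auto
    finally show ?thesis by (simp add: factor_def \<alpha>_def)
  qed
  then show "char (distr (M n) borel (statistic \<tau> n)) u = (\<Prod>j=1..m n. factor (u * \<tau> * \<omega> n j) n j)"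
    unfolding stat char_distr_sum[OF indY] by (intro prod.cong refl)
qed

lemma powr_minus_half: "0 \<le> x \<Longrightarrow> x powr (- 1 / 2) = 1 / sqrt x"
  using powr_minus_divide[of x "1 / 2"] powr_half_sqrt[of x] by simp

lemma S2_pos:
  assumes "1 \<le> n" "\<forall>j\<in>{1..m n}. 1 \<le> K n j" shows "0 < S2 n"
proof -
  have "S2 n \<noteq> 0" using kS2_ge(2)[OF assms] by auto
  then show ?thesis using S2_nonneg[of n] by simp
qed

lemma factor_norm: "cmod (factor c n j) \<le> 1" if "K n j < N n j"
proof -
  interpret prob_space "excess_law (N n j) (K n j)" by (rule prob_space_excess_law[OF that])
  have mX [measurable]: "excess_hill Q (K n j) \<in> borel_measurable (excess_law (N n j) (K n j))"
    using measurable_excess_hill[OF Q_measurable, of "K n j"] by (simp add: measurable_cong_sets[OF sets_excess_law refl])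
  have "cmod (factor c n j) \<le> (\<integral>p. cmod (iexp (c * (excess_hill Q (K n j) p - \<gamma> - A (real (N n j) / real (K n j)) * \<beta> (K n j))))
      \<partial>excess_law (N n j) (K n j))"
    unfolding factor_def by (rule integral_norm_bound)
  also have "\<dots> = 1" using prob_space by simp
  finally show ?thesis .
qed

text \<open>\<open>\<kappa>\<close> treats both normalisations at once: it is \<open>1\<close> for
  the standardised statistic and \<open>sqrt (k * S2)\<close> for the factor \<open>sqrt k\<close>.
  The constant \<open>B\<close> must not depend on \<open>e\<close>, because \<open>e\<close> is
  sent to \<open>0\<close> afterwards.\<close>

lemma factor_sum_bound:
  assumes \<kappa>: "0 \<le> \<kappa>'" "\<forall>\<^sub>F n in sequentially. \<bar>\<kappa> n\<bar> \<le> \<kappa>'"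
    and \<tau>: "\<forall>\<^sub>F n in sequentially. \<tau> n = \<kappa> n * S2 n powr (- 1 / 2)"
  obtains B where "0 \<le> B" "\<And>e. 0 < e \<Longrightarrow> e \<le> 1 \<Longrightarrow> \<forall>\<^sub>F n in sequentially.
     (\<Sum>j=1..m n. cmod (factor (u * \<tau> n * \<omega> n j) n j - complex_of_real (exp (- ((u * \<tau> n * \<omega> n j * \<gamma>)\<^sup>2) / (2 * real (K n j)))))) \<le> B * e"
proof -
  have r: "0 \<le> - \<rho>" using rho by simp
  obtain L where L: "1 \<le> L" "\<forall>\<^sub>F n in sequentially. real (k n) * S2 n \<le> L"
    by (rule kS2_bounded)
  obtain a where a: "0 \<le> a" "\<forall>\<^sub>F n in sequentially. \<forall>j\<in>{1..m n}. sqrt (real (k n)) * \<bar>A (real (N n j) / real (K n j))\<bar> \<le> a"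
    by (rule ev_A_bound)
  obtain b where b: "0 \<le> b" "\<And>e. 0 < e \<Longrightarrow> \<forall>\<^sub>F n in sequentially. \<forall>j\<in>{1..m n}.
    \<bar>gamma_ratio (- \<rho>) (N n j) / gamma_ratio (- \<rho>) (K n j) / (1 - \<rho>) - \<beta> (K n j)\<bar> \<le> b * e"
    using ev_bias by blast
  obtain C where C: "0 \<le> C" "\<And>n k. 1 \<le> k \<Longrightarrow> k < n \<Longrightarrow>
    integrable (threshold_law n k) (\<lambda>t. exp (- (- \<rho>) * (t - ln (real n / real k))) * exp (\<bar>t - ln (real n / real k)\<bar> / 2)) \<and>
    (\<integral>t. exp (- (- \<rho>) * (t - ln (real n / real k))) * exp (\<bar>t - ln (real n / real k)\<bar> / 2) \<partial>threshold_law n k) \<le> C"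
    using threshold_moment_bound[OF r] by blast
  \<comment> \<open>\<open>U * \<bar>\<omega> n j\<bar>\<close> will bound
    \<open>\<bar>c j\<bar> * \<bar>\<alpha> j\<bar>\<close>, and \<open>W0\<close> the sum of
    \<open>(c j)^2 / K j\<close>. The summands of \<open>B\<close> follow the six terms of the
    estimate for one subsample.\<close>
  define U where "U = \<bar>u\<bar> * \<kappa>' * a"
  define W0 where "W0 = (u * \<kappa>')\<^sup>2"
  have UW: "0 \<le> U" "0 \<le> W0" using \<kappa> a by (auto simp: U_def W0_def)
  define B where "B = 2 + 2 * C * (U * L) + b * (U * L) + \<gamma>\<^sup>2 * W0 + U\<^sup>2 + 3 * \<bar>\<gamma>\<bar> ^ 3 * (W0 * (\<bar>u\<bar> * \<kappa>'))"
  show thesis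
  proof (rule that[of B])
    show "0 \<le> B" unfolding B_def using C b UW L \<kappa> by simp
    fix e :: real assume e: "0 < e" "e \<le> 1"
    obtain s0 where s0: "\<And>s t y. s0 \<le> s \<Longrightarrow> s0 \<le> t \<Longrightarrow> 0 \<le> y \<Longrightarrow>
      \<bar>ln (Q (t + y) / Q t) - \<gamma> * y - A (exp s) * exp (\<rho> * (t - s)) * limit_shape \<rho> y\<bar>
        \<le> e * \<bar>A (exp s)\<bar> * (exp (\<rho> * (t - s)) * exp (\<bar>t - s\<bar> / 2)) * exp (y / 2)"
      using log_quantile_uniform_second_order[OF C2 mono_on_quantile[OF distD] measurable_quantile[OF distD] e(1)]
      unfolding Q_def by blast
    \<comment> \<open>The variance sum is requested below \<open>e^2\<close> because it will be
      divided by \<open>\<eta> = e\<close>.\<close>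
    have e2: "0 < e\<^sup>2" using e by simp
    from \<kappa>(2) \<tau> L(2) a(2) b(2)[OF e(1)] ev_tail_sum[OF e(1), of s0] ev_variance_sum[OF e2] ev_weight_small[OF e(1)]
      ev_ratio[of s0] ev_KN
    show "\<forall>\<^sub>F n in sequentially.
     (\<Sum>j=1..m n. cmod (factor (u * \<tau> n * \<omega> n j) n j - complex_of_real (exp (- ((u * \<tau> n * \<omega> n j * \<gamma>)\<^sup>2) / (2 * real (K n j)))))) \<le> B * e"
    proof eventually_elim
      case (elim n)
      note kap = elim(1) and tau = elim(2) and kL = elim(3) and Ab = elim(4) and bias = elim(5) and tail = elim(6)
        and var = elim(7) and small = elim(8) and ratio = elim(9) and KN = elim(10)
      have n1: "1 \<le> n" and K1: "\<forall>j\<in>{1..m n}. 1 \<le> K n j" using KN by blast+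
      note KS = kS2_ge[OF n1 K1]
      have S: "0 < S2 n" by (rule S2_pos[OF n1 K1])
      from powr_minus_half[OF S2_nonneg] have tau': "\<tau> n = \<kappa> n / sqrt (S2 n)" unfolding tau by simp
      have sk: "1 \<le> sqrt (real (k n)) * sqrt (S2 n)"
        using KS(2) by (simp add: real_sqrt_mult[symmetric])
      \<comment> \<open>This puts the normalisation on the scale \<open>sqrt k\<close>, on which the
        values of \<open>A\<close> are bounded.\<close>
      have tk: "\<bar>\<tau> n\<bar> \<le> \<kappa>' * sqrt (real (k n))"
      proof -
        have "\<bar>\<tau> n\<bar> = \<bar>\<kappa> n\<bar> * (1 / sqrt (S2 n))" unfolding tau' using S by (simp add: abs_divide)
        also have "\<dots> \<le> \<kappa>' * sqrt (real (k n))"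
          using kap \<kappa>(1) sk S by (intro mult_mono) (auto simp: pos_divide_le_eq)
        finally show ?thesis .
      qed
      have wL: "(\<Sum>j=1..m n. \<bar>\<omega> n j\<bar>) \<le> L"
      proof (rule power2_le_imp_le)
        \<comment> \<open>Since \<open>L \<ge> 1\<close>, the bound \<open>sqrt L\<close> from
          Cauchy-Schwarz may be replaced by \<open>L\<close>.\<close>
        have "L * 1 \<le> L * L" using L(1) by (intro mult_left_mono) auto
        then show "(\<Sum>j=1..m n. \<bar>\<omega> n j\<bar>)\<^sup>2 \<le> L\<^sup>2" using KS(1) kL by (simp add: power2_eq_square)
      qed (use L(1) in simp)
      define c where "c j = u * \<tau> n * \<omega> n j" for j
      define \<alpha> where "\<alpha> j = A (real (N n j) / real (K n j))" for j
      have c\<alpha>: "\<bar>c j\<bar> * \<bar>\<alpha> j\<bar> \<le> U * \<bar>\<omega> n j\<bar>" if j: "j \<in> {1..m n}" for j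
      proof -
        have "\<bar>\<tau> n\<bar> * \<bar>\<alpha> j\<bar> \<le> \<kappa>' * sqrt (real (k n)) * \<bar>\<alpha> j\<bar>" using tk by (intro mult_right_mono) auto
        also have "\<dots> = \<kappa>' * (sqrt (real (k n)) * \<bar>\<alpha> j\<bar>)" by simp
        also have "\<dots> \<le> \<kappa>' * a" using Ab j \<kappa>(1) by (intro mult_left_mono) (auto simp: \<alpha>_def)
        finally have "(\<bar>u\<bar> * \<bar>\<omega> n j\<bar>) * (\<bar>\<tau> n\<bar> * \<bar>\<alpha> j\<bar>) \<le> (\<bar>u\<bar> * \<bar>\<omega> n j\<bar>) * (\<kappa>' * a)" by (intro mult_left_mono) auto
        then show ?thesis by (simp add: c_def U_def abs_mult mult_ac)
      qed
      have sumU: "(\<Sum>j=1..m n. \<bar>c j\<bar> * \<bar>\<alpha> j\<bar>) \<le> U * L"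
      proof -
        have "(\<Sum>j=1..m n. \<bar>c j\<bar> * \<bar>\<alpha> j\<bar>) \<le> (\<Sum>j=1..m n. U * \<bar>\<omega> n j\<bar>)" by (rule sum_mono[OF c\<alpha>])
        also have "\<dots> = U * (\<Sum>j=1..m n. \<bar>\<omega> n j\<bar>)" by (simp add: sum_distrib_left)
        also have "\<dots> \<le> U * L" using wL UW by (intro mult_left_mono) auto
        finally show ?thesis .
      qed
      have sumW: "(\<Sum>j=1..m n. (c j)\<^sup>2 / real (K n j)) \<le> W0"
      proof -
        have "(\<Sum>j=1..m n. (c j)\<^sup>2 / real (K n j)) = (u * \<tau> n)\<^sup>2 * S2 n"
          by (simp add: c_def S2_def sum_distrib_left power_mult_distrib)
        also have "\<dots> = (u * \<kappa> n)\<^sup>2"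
          using S by (simp add: tau' power_mult_distrib power_divide)
        also have "\<dots> = u\<^sup>2 * \<bar>\<kappa> n\<bar>\<^sup>2" by (simp add: power_mult_distrib)
        also have "\<dots> \<le> u\<^sup>2 * \<kappa>'\<^sup>2" using kap by (intro mult_left_mono power_mono) auto
        finally show ?thesis by (simp add: W0_def power_mult_distrib)
      qed
      have cK: "\<bar>c j\<bar> / real (K n j) \<le> \<bar>u\<bar> * \<kappa>' * e" if j: "j \<in> {1..m n}" for j
      proof -
        have "\<bar>c j\<bar> / real (K n j) = \<bar>u\<bar> * \<bar>\<kappa> n\<bar> * ((\<bar>\<omega> n j\<bar> / real (K n j)) / sqrt (S2 n))"
          using S by (simp add: c_def tau' abs_mult abs_divide)
        also have "\<dots> \<le> \<bar>u\<bar> * \<kappa>' * e"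
        proof (intro mult_mono)
          have "\<bar>\<omega> n j\<bar> / real (K n j) \<le> e * sqrt (S2 n)" using small j by blast
          moreover have "0 < sqrt (S2 n)" using S by simp
          ultimately show "\<bar>\<omega> n j\<bar> / real (K n j) / sqrt (S2 n) \<le> e" by (simp only: pos_divide_le_eq)
        qed (use kap \<kappa>(1) S in auto)
        finally show ?thesis .
      qed
      let ?P = "\<lambda>j. measure (threshold_law (N n j) (K n j)) {..<s0}"
      let ?V = "\<lambda>j. excess_variance_bound (- \<rho>) (N n j) (K n j)"
      have single: "cmod (factor (c j) n j - complex_of_real (exp (- ((c j * \<gamma>)\<^sup>2) / (2 * real (K n j)))))
          \<le> 2 * ?P j + (2 * C * e + b * e) * (\<bar>c j\<bar> * \<bar>\<alpha> j\<bar>) + (e * \<gamma>\<^sup>2 + 3 * \<bar>\<gamma>\<bar> ^ 3 * (\<bar>u\<bar> * \<kappa>' * e)) * ((c j)\<^sup>2 / real (K n j))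
            + U\<^sup>2 / e * ((\<omega> n j)\<^sup>2 * ?V j)" (is "_ \<le> ?rhs j") if j: "j \<in> {1..m n}" for j
      proof -
        have K: "1 \<le> K n j" "K n j < N n j" using KN j by auto
        interpret one_sample "N n j" "K n j" \<rho> by standard (use K rho in auto)
        have s: "s0 \<le> s" using ratio j by (simp add: s_def)
        have es: "A (exp s) = \<alpha> j" using K by (simp add: s_def \<alpha>_def)
        have V0: "0 \<le> ?V j"
          by (rule variance_bound_nonneg)
        have "cmod (factor (c j) n j - complex_of_real (exp (- ((c j * \<gamma>)\<^sup>2) / (2 * real (K n j)))))
          \<le> 2 * ?P j + 2 * C * e * (\<bar>c j\<bar> * \<bar>\<alpha> j\<bar>) + \<bar>c j\<bar> * \<bar>\<alpha> j\<bar> * \<bar>mW - \<beta> (K n j)\<bar>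
            + e * ((c j * \<gamma>)\<^sup>2 / real (K n j)) + (c j * \<alpha> j)\<^sup>2 * ?V j / e + 3 * \<bar>c j * \<gamma>\<bar> ^ 3 / (real (K n j))\<^sup>2"
          unfolding factor_def \<alpha>_def[symmetric]
        proof (rule char_excess_hill[OF Q_measurable e])
          show "integrable T (\<lambda>t. G t * exp (\<bar>t - s\<bar> / 2))" "(\<integral>t. G t * exp (\<bar>t - s\<bar> / 2) \<partial>T) \<le> C"
            using C(2)[OF K] by (simp_all add: G_def s_def)
          fix t y :: real assume t: "s0 \<le> t" and y: "0 \<le> y"
          show "\<bar>ln (Q (t + y) / Q t) - \<gamma> * y - \<alpha> j * G t * limit_shape \<rho> y\<bar> \<le> e * \<bar>\<alpha> j\<bar> * (G t * exp (\<bar>t - s\<bar> / 2)) * exp (y / 2)"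
            using s0[OF s t y] unfolding es G_def .
        qed (use e in simp)
        also have "\<dots> \<le> 2 * ?P j + 2 * C * e * (\<bar>c j\<bar> * \<bar>\<alpha> j\<bar>) + \<bar>c j\<bar> * \<bar>\<alpha> j\<bar> * (b * e)
            + e * \<gamma>\<^sup>2 * ((c j)\<^sup>2 / real (K n j)) + U\<^sup>2 / e * ((\<omega> n j)\<^sup>2 * ?V j) + 3 * \<bar>\<gamma>\<bar> ^ 3 * (\<bar>u\<bar> * \<kappa>' * e) * ((c j)\<^sup>2 / real (K n j))"
        proof (intro add_mono order_refl)
          have "\<bar>mW - \<beta> (K n j)\<bar> \<le> b * e" using bias j by (simp add: mW_def mG_def)
          then show "\<bar>c j\<bar> * \<bar>\<alpha> j\<bar> * \<bar>mW - \<beta> (K n j)\<bar> \<le> \<bar>c j\<bar> * \<bar>\<alpha> j\<bar> * (b * e)"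
            by (intro mult_left_mono) auto
          show "e * ((c j * \<gamma>)\<^sup>2 / real (K n j)) \<le> e * \<gamma>\<^sup>2 * ((c j)\<^sup>2 / real (K n j))"
            by (simp add: power_mult_distrib mult_ac)
          have "(c j * \<alpha> j)\<^sup>2 = (\<bar>c j\<bar> * \<bar>\<alpha> j\<bar>)\<^sup>2" by (simp add: power_mult_distrib)
          also have "\<dots> \<le> (U * \<bar>\<omega> n j\<bar>)\<^sup>2" by (intro power_mono c\<alpha> j) auto
          finally have "(c j * \<alpha> j)\<^sup>2 * (?V j / e) \<le> (U * \<bar>\<omega> n j\<bar>)\<^sup>2 * (?V j / e)"
            using V0 e by (intro mult_right_mono) auto
          then show "(c j * \<alpha> j)\<^sup>2 * ?V j / e \<le> U\<^sup>2 / e * ((\<omega> n j)\<^sup>2 * ?V j)"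
            by (simp add: power_mult_distrib mult_ac)
          \<comment> \<open>The cubic error is split as \<open>\<bar>c\<bar> / K\<close>, uniformly
            of order \<open>e\<close> by the Lyapunov condition, times \<open>c^2 / K\<close>, which
            sums to at most \<open>W0\<close>.\<close>
          have cube: "3 * (x * g) ^ 3 / y\<^sup>2 = 3 * g ^ 3 * (x / y) * (x\<^sup>2 / y)" for x g y :: real
            by (simp add: power3_eq_cube power2_eq_square)
          have "3 * \<bar>c j * \<gamma>\<bar> ^ 3 / (real (K n j))\<^sup>2 = 3 * \<bar>\<gamma>\<bar> ^ 3 * (\<bar>c j\<bar> / real (K n j)) * (\<bar>c j\<bar>\<^sup>2 / real (K n j))"
            unfolding abs_mult by (rule cube)
          also have "\<dots> \<le> 3 * \<bar>\<gamma>\<bar> ^ 3 * (\<bar>u\<bar> * \<kappa>' * e) * (\<bar>c j\<bar>\<^sup>2 / real (K n j))"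
            using cK[OF j] by (intro mult_right_mono mult_left_mono) auto
          finally show "3 * \<bar>c j * \<gamma>\<bar> ^ 3 / (real (K n j))\<^sup>2 \<le> 3 * \<bar>\<gamma>\<bar> ^ 3 * (\<bar>u\<bar> * \<kappa>' * e) * ((c j)\<^sup>2 / real (K n j))"
            by simp
        qed
        also have "\<dots> = ?rhs j" by (simp only: distrib_left distrib_right mult_ac add_ac)
        finally show ?thesis .
      qed
      have "(\<Sum>j=1..m n. cmod (factor (c j) n j - complex_of_real (exp (- ((c j * \<gamma>)\<^sup>2) / (2 * real (K n j)))))) \<le> (\<Sum>j=1..m n. ?rhs j)"
        by (rule sum_mono[OF single])
      also have "\<dots> = 2 * (\<Sum>j=1..m n. ?P j) + (2 * C * e + b * e) * (\<Sum>j=1..m n. \<bar>c j\<bar> * \<bar>\<alpha> j\<bar>)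
          + (e * \<gamma>\<^sup>2 + 3 * \<bar>\<gamma>\<bar> ^ 3 * (\<bar>u\<bar> * \<kappa>' * e)) * (\<Sum>j=1..m n. (c j)\<^sup>2 / real (K n j)) + U\<^sup>2 / e * (\<Sum>j=1..m n. (\<omega> n j)\<^sup>2 * ?V j)"
        by (simp only: sum.distrib sum_distrib_left)
      also have "\<dots> \<le> 2 * e + (2 * C * e + b * e) * (U * L) + (e * \<gamma>\<^sup>2 + 3 * \<bar>\<gamma>\<bar> ^ 3 * (\<bar>u\<bar> * \<kappa>' * e)) * W0 + U\<^sup>2 / e * e\<^sup>2"
        using tail sumU sumW var C(1) b(1) e \<kappa>(1) by (intro add_mono mult_left_mono) auto
      also have "\<dots> = B * e"
        using e by (simp add: B_def power2_eq_square algebra_simps)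
      finally show ?case by (simp add: c_def)
    qed
  qed
qed

text \<open>Levy's continuity theorem. Since all factors have modulus at most \<open>1\<close>, the
  difference between the product of the characteristic functions and the product of their Gaussian
  counterparts is at most the sum of the single differences, which \<open>factor_sum_bound\<close>
  makes arbitrarily small.\<close>

theorem weak_conv_statistic:
  assumes \<kappa>: "\<kappa> \<longlonglongrightarrow> \<kappa>0" "\<kappa>0 \<noteq> 0"
    and \<tau>: "\<forall>\<^sub>F n in sequentially. \<tau> n = \<kappa> n * S2 n powr (- 1 / 2)"
  shows "weak_conv_m (\<lambda>n. distr (M n) borel (statistic (\<tau> n) n)) (normal_distribution 0 (\<kappa>0\<^sup>2 * \<gamma>\<^sup>2))"
proof (rule levy_continuity_eventually)
  have v: "0 < \<kappa>0\<^sup>2 * \<gamma>\<^sup>2" using \<kappa>(2) gam by simp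
  show "real_distribution (normal_distribution 0 (\<kappa>0\<^sup>2 * \<gamma>\<^sup>2))" by (rule char_normal_distribution[OF v])
  show "\<forall>\<^sub>F n in sequentially. real_distribution (distr (M n) borel (statistic (\<tau> n) n))"
    using ev_KN by eventually_elim (intro char_statistic, auto)
  fix u
  let ?w = "\<lambda>n j. complex_of_real (exp (- ((u * \<tau> n * \<omega> n j * \<gamma>)\<^sup>2) / (2 * real (K n j))))"
  have "\<forall>\<^sub>F n in sequentially. \<bar>\<kappa> n\<bar> < \<bar>\<kappa>0\<bar> + 1"
    by (rule order_tendstoD(2)[OF tendsto_rabs[OF \<kappa>(1)]]) simp
  then have kap: "\<forall>\<^sub>F n in sequentially. \<bar>\<kappa> n\<bar> \<le> \<bar>\<kappa>0\<bar> + 1" by eventually_elim simp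
  have k0: "0 \<le> \<bar>\<kappa>0\<bar> + 1" by simp
  obtain B where B: "0 \<le> B" "\<And>e. 0 < e \<Longrightarrow> e \<le> 1 \<Longrightarrow> \<forall>\<^sub>F n in sequentially.
     (\<Sum>j=1..m n. cmod (factor (u * \<tau> n * \<omega> n j) n j - ?w n j)) \<le> B * e"
    using factor_sum_bound[OF k0 kap \<tau>, of u] by blast
  have diff: "(\<lambda>n. char (distr (M n) borel (statistic (\<tau> n) n)) u - (\<Prod>j=1..m n. ?w n j)) \<longlonglongrightarrow> 0"
  proof (rule tendstoI)
    fix \<epsilon> :: real assume \<epsilon>: "0 < \<epsilon>"
    define e where "e = min 1 (\<epsilon> / (B + 1))"
    have e: "0 < e" "e \<le> 1" using \<epsilon> B(1) by (auto simp: e_def)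
    have "B * e \<le> B * (\<epsilon> / (B + 1))" using B(1) by (intro mult_left_mono) (auto simp: e_def)
    also have "\<dots> < \<epsilon>" using \<epsilon> B(1) by (simp add: pos_divide_less_eq)
    finally have Be: "B * e < \<epsilon>" .
    from B(2)[OF e] ev_KN
    show "\<forall>\<^sub>F n in sequentially. dist (char (distr (M n) borel (statistic (\<tau> n) n)) u - (\<Prod>j=1..m n. ?w n j)) 0 < \<epsilon>"
    proof eventually_elim
      case (elim n)
      have "char (distr (M n) borel (statistic (\<tau> n) n)) u = (\<Prod>j=1..m n. factor (u * \<tau> n * \<omega> n j) n j)"
        using elim(2) by (intro char_statistic) auto
      then have "cmod (char (distr (M n) borel (statistic (\<tau> n) n)) u - (\<Prod>j=1..m n. ?w n j))
          = cmod ((\<Prod>j=1..m n. factor (u * \<tau> n * \<omega> n j) n j) - (\<Prod>j=1..m n. ?w n j))" by simp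
      also have "\<dots> \<le> (\<Sum>j=1..m n. cmod (factor (u * \<tau> n * \<omega> n j) n j - ?w n j))"
        using elim(2) by (intro norm_prod_diff factor_norm) auto
      also have "\<dots> < \<epsilon>" using elim(1) Be by linarith
      finally show ?case by simp
    qed
  qed
  have "(\<lambda>n. \<Prod>j=1..m n. ?w n j) \<longlonglongrightarrow> char (normal_distribution 0 (\<kappa>0\<^sup>2 * \<gamma>\<^sup>2)) u"
  proof -
    have "(\<lambda>n. complex_of_real (exp (- ((\<kappa> n)\<^sup>2 * \<gamma>\<^sup>2 * u\<^sup>2) / 2))) \<longlonglongrightarrow> complex_of_real (exp (- (\<kappa>0\<^sup>2 * \<gamma>\<^sup>2 * u\<^sup>2) / 2))"
      by (intro tendsto_intros \<kappa>) auto
    \<comment> \<open>The Gaussian exponents add up exactly: normalising by \<open>S2\<close> leaves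
      the variance \<open>\<kappa>^2 * \<gamma>^2\<close>, so the only limit to take is that of
      \<open>\<kappa>\<close>.\<close>
    moreover have "\<forall>\<^sub>F n in sequentially. complex_of_real (exp (- ((\<kappa> n)\<^sup>2 * \<gamma>\<^sup>2 * u\<^sup>2) / 2)) = (\<Prod>j=1..m n. ?w n j)"
      using \<tau> ev_KN
    proof eventually_elim
      case (elim n)
      have S: "0 < S2 n" using elim(2) by (intro S2_pos) blast+
      have sq: "(S2 n powr (- 1 / 2))\<^sup>2 * S2 n = 1"
        unfolding powr_minus_half[OF S2_nonneg] using S by (simp add: power_divide)
      have "(\<Sum>j=1..m n. - ((u * \<tau> n * \<omega> n j * \<gamma>)\<^sup>2) / (2 * real (K n j))) = - ((u * \<tau> n * \<gamma>)\<^sup>2 / 2) * S2 n"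
        by (simp add: S2_def sum_distrib_left sum_negf power_mult_distrib mult_ac)
      also have "\<dots> = - ((\<kappa> n)\<^sup>2 * \<gamma>\<^sup>2 * u\<^sup>2) / 2 * ((S2 n powr (- 1 / 2))\<^sup>2 * S2 n)"
        unfolding elim(1) by (simp add: power_mult_distrib mult_ac)
      also have "\<dots> = - ((\<kappa> n)\<^sup>2 * \<gamma>\<^sup>2 * u\<^sup>2) / 2" unfolding sq by simp
      finally have "exp (- ((\<kappa> n)\<^sup>2 * \<gamma>\<^sup>2 * u\<^sup>2) / 2) = (\<Prod>j=1..m n. exp (- ((u * \<tau> n * \<omega> n j * \<gamma>)\<^sup>2) / (2 * real (K n j))))"
        by (simp only: exp_sum[symmetric] finite_atLeastAtMost)
      then show ?case by (simp only: of_real_prod)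
    qed
    ultimately show ?thesis
      unfolding char_normal_distribution(1)[OF v] by (rule Lim_transform_eventually)
  qed
  from tendsto_add[OF diff this]
  show "(\<lambda>n. char (distr (M n) borel (statistic (\<tau> n) n)) u) \<longlonglongrightarrow> char (normal_distribution 0 (\<kappa>0\<^sup>2 * \<gamma>\<^sup>2)) u"
    by simp
qed

end

theorem theorem6:
  fixes M :: "nat \<Rightarrow> 'a measure"
    and X :: "nat \<Rightarrow> nat \<Rightarrow> nat \<Rightarrow> 'a \<Rightarrow> real"
    and D :: "real measure"
    and \<gamma> \<rho> :: real and A :: "real \<Rightarrow> real"
    and m :: "nat \<Rightarrow> nat" and N K :: "nat \<Rightarrow> nat \<Rightarrow> nat"
    and k :: "nat \<Rightarrow> nat"
    and \<omega> :: "nat \<Rightarrow> nat \<Rightarrow> real"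
  assumes prob: "\<And>n. prob_space (M n)"
    and indep: "\<And>n. prob_space.indep_vars (M n) (\<lambda>_. borel) (\<lambda>(j, i). X n i j)
                  (SIGMA j:{1..m n}. {1..N n j})"
    and ident: "\<And>n j i. j \<in> {1..m n} \<Longrightarrow> i \<in> {1..N n j} \<Longrightarrow> distr (M n) borel (X n i j) = D"
    and distD: "real_distribution D"
    and contF: "continuous_on UNIV (cdf D)"
    and C2: "second_order_condition (cdf D) \<gamma> \<rho> A"
    and total: "\<And>n. n \<ge> 1 \<Longrightarrow> (\<Sum>j=1..m n. N n j) = n"
    and m_lim: "filterlim m at_top sequentially"
    and N_lim: "filterlim (\<lambda>n. INF j\<in>{1..m n}. real (N n j) / ln (real (m n))) at_top sequentially"
    and K_pos: "\<And>n j. n \<ge> 1 \<Longrightarrow> j \<in> {1..m n} \<Longrightarrow> K n j \<ge> 1"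
    and k_def: "\<And>n. k n = (\<Sum>j=1..m n. K n j)"
    and w_sum: "\<And>n. n \<ge> 1 \<Longrightarrow> (\<Sum>j=1..m n. \<omega> n j) = 1"
    and w_limsup: "limsup (\<lambda>n. ereal (real (k n) * (\<Sum>j=1..m n. (\<omega> n j)\<^sup>2 / real (K n j)))) < \<infinity>"
    and w_lyapunov: "\<exists>\<delta>>0. (\<lambda>n.
          (\<Sum>j=1..m n. real (K n j) powr (- \<delta> / 2) * ((\<omega> n j)\<^sup>2 / real (K n j)) powr (1 + \<delta> / 2))
          / (\<Sum>j=1..m n. (\<omega> n j)\<^sup>2 / real (K n j)) powr (1 + \<delta> / 2)) \<longlonglongrightarrow> 0"
    and KN_lim: "(\<lambda>n. SUP j\<in>{1..m n}. real (K n j) / real (N n j)) \<longlonglongrightarrow> 0"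
    and A_bigo: "(\<lambda>n. sqrt (real (k n)) * (SUP j\<in>{1..m n}. \<bar>A (real (N n j) / real (K n j))\<bar>))
                   \<in> O(\<lambda>_. 1)"
  shows "weak_conv_m
           (\<lambda>n. distr (M n) borel (\<lambda>s.
              (\<Sum>j=1..m n. (\<omega> n j)\<^sup>2 / real (K n j)) powr (- 1 / 2)
              * (weighted_hill_estimator (m n) (\<omega> n) (K n) (N n) (\<lambda>i j. X n i j s)
                 - \<gamma> - hill_bias \<rho> A (m n) (\<omega> n) (K n) (N n))))
           (normal_distribution 0 (\<gamma>\<^sup>2))
       \<and> (\<forall>v\<ge>1. (\<lambda>n. real (k n) * (\<Sum>j=1..m n. (\<omega> n j)\<^sup>2 / real (K n j))) \<longlonglongrightarrow> v \<longrightarrow>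
            weak_conv_m
              (\<lambda>n. distr (M n) borel (\<lambda>s.
                 sqrt (real (k n))
                 * (weighted_hill_estimator (m n) (\<omega> n) (K n) (N n) (\<lambda>i j. X n i j s)
                    - \<gamma> - hill_bias \<rho> A (m n) (\<omega> n) (K n) (N n))))
              (normal_distribution 0 (v * \<gamma>\<^sup>2)))"
proof -
  interpret weighted_hill_setting M X D \<gamma> \<rho> A m N K k \<omega>
    by (rule weighted_hill_setting.intro) (fact prob indep ident distD C2 m_lim N_lim K_pos k_def w_sum w_limsup w_lyapunov KN_lim A_bigo)+
  have "weak_conv_m (\<lambda>n. distr (M n) borel (statistic (S2 n powr (- 1 / 2)) n)) (normal_distribution 0 (1\<^sup>2 * \<gamma>\<^sup>2))"
    by (rule weak_conv_statistic[of "\<lambda>_. 1"]) auto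
  then have standardised: "weak_conv_m (\<lambda>n. distr (M n) borel (statistic (S2 n powr (- 1 / 2)) n)) (normal_distribution 0 (\<gamma>\<^sup>2))"
    by simp
  have scaled: "weak_conv_m (\<lambda>n. distr (M n) borel (statistic (sqrt (real (k n))) n)) (normal_distribution 0 (v * \<gamma>\<^sup>2))"
    if v: "1 \<le> v" and lim: "(\<lambda>n. real (k n) * S2 n) \<longlonglongrightarrow> v" for v
  proof -
    \<comment> \<open>Writing \<open>sqrt k = sqrt (k * S2) / sqrt S2\<close> gives the second claim
      the form of the first, with \<open>\<kappa>\<close> tending to \<open>sqrt v\<close>.\<close>
    have "weak_conv_m (\<lambda>n. distr (M n) borel (statistic (sqrt (real (k n))) n)) (normal_distribution 0 ((sqrt v)\<^sup>2 * \<gamma>\<^sup>2))"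
    proof (rule weak_conv_statistic)
      show "(\<lambda>n. sqrt (real (k n) * S2 n)) \<longlonglongrightarrow> sqrt v" by (rule tendsto_real_sqrt[OF lim])
      show "sqrt v \<noteq> 0" using v by simp
      show "\<forall>\<^sub>F n in sequentially. sqrt (real (k n)) = sqrt (real (k n) * S2 n) * S2 n powr (- 1 / 2)"
        using ev_KN
      proof eventually_elim
        case (elim n)
        have S: "0 < S2 n" using elim by (intro S2_pos) blast+
        then show ?case by (simp only: powr_minus_half[OF S2_nonneg]) (simp add: real_sqrt_mult)
      qed
    qed
    then show ?thesis using v by simp
  qed
  show ?thesis
    using standardised scaled unfolding statistic_def[abs_def] S2_def by blast
qed

end
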